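(* Let $R$ be a commutative ring. Then there is an exact equivalence of categories $$\mathsf{Tate}^{Dr}_{\aleph_0}(R)\xrightarrow{\ \sim\ }P_f(E),$$ where $E$ is the Beilinson $1$-fold cubical algebra $$E:=\operatorname{End}_{\mathsf{Tate}^{Dr}_{\aleph_0}(R)}\bigl(R((t))\bigr),$$ and $R((t))$ denotes the Tate $R$-module in the sense of Drinfeld of that name.
   Context: $P_f(E)$ is the category of finitely generated projective right $E$-modules. Tate $R$-modules à la Drinfeld: an elementary Tate $R$-module is a topological $R$-module isomorphic to $P\oplus Q^{*}$ with $P,Q$ discrete projective $R$-modules and $Q^*=\operatorname{Hom}_R(Q,R)$ carrying the topology in which the annihilators of finitely generated submodules of $Q$ form a basis of neighbourhoods of $0$. A Tate $R$-module is a topological $R$-module that is a direct summand of an elementary one; morphisms are continuous $R$-linear maps. $\mathsf{Tate}^{Dr}_{\aleph_0}(R)$ is the full subcategory of those of countable type (direct summands of $P\oplus Q^*$ with $P,Q$ countably generated). $R((t))=R[[t]]\oplus t^{-1}R[t^{-1}]$ has its usual $t$-adic topology. Known comparison: $\mathsf{Tate}^{Dr}_{\aleph_0}(R)$ is equivalent to the category $\mathsf{Tate}_{\aleph_0}(P_f(R))$ of countable Tate objects in $P_f(R)$, and its exact structure is the one transported from there (which is the split exact one). Here, for an exact category $\mathcal{D}$, $\mathsf{Ind}^a_{\aleph_0}(\mathcal{D})$ is the category of colimits (in left exact functors $\mathcal{D}^{op}\to\mathsf{Ab}$) of countable directed diagrams with admissible monic transition maps, $\mathsf{Pro}^a_{\aleph_0}(\mathcal{D}):=\mathsf{Ind}^a_{\aleph_0}(\mathcal{D}^{op})^{op}$,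 $\mathsf{Tate}^{el}_{\aleph_0}(\mathcal{D})$ is the smallest extension-closed full subcategory of $\mathsf{Ind}^a_{\aleph_0}\mathsf{Pro}^a_{\aleph_0}(\mathcal{D})$ containing both, and $\mathsf{Tate}_{\aleph_0}(\mathcal{D})$ is its idempotent completion. Under the equivalence $R((t))$ corresponds to the elementary Tate object $\operatorname{colim}_i\lim_j t^{-i}R[t]/t^j$. A Beilinson $1$-fold cubical algebra is an associative algebra $A$ with two-sided ideals $I^+,I^-$ such that $I^++I^-=A$. On $E=\operatorname{End}(R((t)))$ the ideals are: $I^+$ = bounded endomorphisms (factoring through a lattice), $I^-$ = discrete endomorphisms (vanishing on a lattice), where a lattice in $X\in\mathsf{Tate}^{el}_{\aleph_0}(\mathcal{D})$ is an admissible sub-object $L\hookrightarrow X$ with $L\in\mathsf{Pro}^a_{\aleph_0}(\mathcal{D})$ and $X/L\in\mathsf{Ind}^a_{\aleph_0}(\mathcal{D})$, with $\mathcal{D}=P_f(R)$. *)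

theory Defs
  imports "HOL-Analysis.Abstract_Topology" "HOL-Analysis.Product_Topology" "HOL-Analysis.Function_Topology" "HOL-Algebra.Ideal" "HOL-Algebra.Module"
begin

section \<open>Modules\<close>

text \<open>
  Modules are HOL-Algebra \<^typ>\<open>('a, 'b) module\<close> records. Such a record inherits from rings the fields
  \<^const>\<open>mult\<close> and \<^const>\<open>one\<close>, which mean nothing for a module; \<open>mk_module\<close> leaves them unspecified.
\<close>

definition mk_module ::
  "'b set \<Rightarrow> 'b \<Rightarrow> ('b \<Rightarrow> 'b \<Rightarrow> 'b) \<Rightarrow> ('a \<Rightarrow> 'b \<Rightarrow> 'b) \<Rightarrow> ('a, 'b) module" where
  "mk_module C z p s =
     \<lparr>carrier = C, mult = undefined, one = undefined, zero = z, add = p, smult = s\<rparr>"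

text \<open>Right modules over a possibly noncommutative ring: \<open>a \<odot>\<^bsub>M\<^esub> x\<close> stands for \<open>x \<cdot> a\<close>.\<close>

locale right_module = E?: ring E + M?: abelian_group M
  for E :: "('e, 'x) ring_scheme" (structure) and M :: "('e, 'm, 'y) module_scheme" (structure) +
  assumes closed: "\<lbrakk>a \<in> carrier E; x \<in> carrier M\<rbrakk> \<Longrightarrow> a \<odot>\<^bsub>M\<^esub> x \<in> carrier M"
    and l_distr: "\<lbrakk>a \<in> carrier E; b \<in> carrier E; x \<in> carrier M\<rbrakk> \<Longrightarrow>
      (a \<oplus>\<^bsub>E\<^esub> b) \<odot>\<^bsub>M\<^esub> x = a \<odot>\<^bsub>M\<^esub> x \<oplus>\<^bsub>M\<^esub> b \<odot>\<^bsub>M\<^esub> x"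
    and r_distr: "\<lbrakk>a \<in> carrier E; x \<in> carrier M; y \<in> carrier M\<rbrakk> \<Longrightarrow>
      a \<odot>\<^bsub>M\<^esub> (x \<oplus>\<^bsub>M\<^esub> y) = a \<odot>\<^bsub>M\<^esub> x \<oplus>\<^bsub>M\<^esub> a \<odot>\<^bsub>M\<^esub> y"
    and assoc: "\<lbrakk>a \<in> carrier E; b \<in> carrier E; x \<in> carrier M\<rbrakk> \<Longrightarrow>
      (a \<otimes>\<^bsub>E\<^esub> b) \<odot>\<^bsub>M\<^esub> x = b \<odot>\<^bsub>M\<^esub> (a \<odot>\<^bsub>M\<^esub> x)"
    and one: "x \<in> carrier M \<Longrightarrow> \<one>\<^bsub>E\<^esub> \<odot>\<^bsub>M\<^esub> x = x"

lemma right_module_iff_module: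
  assumes "cring R"
  shows "right_module R M \<longleftrightarrow> module R M"
proof -
  interpret cring R by fact
  show ?thesis
  proof
    assume "right_module R M"
    then interpret right_module R M .
    show "module R M"
    proof (rule moduleI)
      fix a b x assume *: "a \<in> carrier R" "b \<in> carrier R" "x \<in> carrier M"
      show "(a \<otimes>\<^bsub>R\<^esub> b) \<odot>\<^bsub>M\<^esub> x = a \<odot>\<^bsub>M\<^esub> (b \<odot>\<^bsub>M\<^esub> x)"
        using assoc[OF *(2,1,3)] m_comm[OF *(1,2)] by simp
    qed (rule assms M.abelian_group_axioms closed l_distr r_distr one; assumption?)+
  next
    assume "module R M"
    then interpret module R M .
    show "right_module R M"
    proof (intro right_module.intro right_module_axioms.intro)
      fix a b x assume *: "a \<in> carrier R" "b \<in> carrier R" "x \<in> carrier M"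
      show "(a \<otimes>\<^bsub>R\<^esub> b) \<odot>\<^bsub>M\<^esub> x = b \<odot>\<^bsub>M\<^esub> (a \<odot>\<^bsub>M\<^esub> x)"
        using smult_assoc1[OF *(2,1,3)] m_comm[OF *(1,2)] by simp
    qed (rule ring_axioms M.abelian_group_axioms smult_closed smult_l_distr smult_r_distr smult_one; assumption?)+
  qed
qed

text \<open>Linear maps are extensional functions, so that equal maps are equal as HOL functions.\<close>

definition linear_maps ::
  "('a, 'x) ring_scheme \<Rightarrow> ('a, 'm, 'y) module_scheme \<Rightarrow> ('a, 'n, 'z) module_scheme \<Rightarrow> ('m \<Rightarrow> 'n) set" where
  "linear_maps R M N = {f \<in> carrier M \<rightarrow>\<^sub>E carrier N.
     (\<forall>x\<in>carrier M. \<forall>y\<in>carrier M. f (x \<oplus>\<^bsub>M\<^esub> y) = f x \<oplus>\<^bsub>N\<^esub> f y) \<and>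
     (\<forall>a\<in>carrier R. \<forall>x\<in>carrier M. f (a \<odot>\<^bsub>M\<^esub> x) = a \<odot>\<^bsub>N\<^esub> f x)}"

definition modules_isomorphic ::
  "('a, 'x) ring_scheme \<Rightarrow> ('a, 'm, 'y) module_scheme \<Rightarrow> ('a, 'n, 'z) module_scheme \<Rightarrow> bool" where
  "modules_isomorphic R M N \<longleftrightarrow> (\<exists>f\<in>linear_maps R M N. bij_betw f (carrier M) (carrier N))"

definition dsum ::
  "('a, 'm, 'y) module_scheme \<Rightarrow> ('a, 'n, 'z) module_scheme \<Rightarrow> ('a, 'm \<times> 'n) module" where
  "dsum M N = mk_module (carrier M \<times> carrier N) (\<zero>\<^bsub>M\<^esub>, \<zero>\<^bsub>N\<^esub>)
     (\<lambda>u v. (fst u \<oplus>\<^bsub>M\<^esub> fst v, snd u \<oplus>\<^bsub>N\<^esub> snd v))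
     (\<lambda>a u. (a \<odot>\<^bsub>M\<^esub> fst u, a \<odot>\<^bsub>N\<^esub> snd u))"

definition free_right_module :: "('a, 'x) ring_scheme \<Rightarrow> 'i set \<Rightarrow> ('a, 'i \<Rightarrow> 'a) module" where
  "free_right_module E I = mk_module
     {f \<in> I \<rightarrow>\<^sub>E carrier E. finite {i \<in> I. f i \<noteq> \<zero>\<^bsub>E\<^esub>}}
     (\<lambda>i\<in>I. \<zero>\<^bsub>E\<^esub>) (\<lambda>f g. \<lambda>i\<in>I. f i \<oplus>\<^bsub>E\<^esub> g i) (\<lambda>a f. \<lambda>i\<in>I. f i \<otimes>\<^bsub>E\<^esub> a)"

text \<open>
  A projective module is a direct summand of a free module. Index sets inside the carrier type
  of \<open>M\<close> suffice, because a projective \<open>M\<close> is a summand of the free module on its own carrier; the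
  complement can be taken inside that free module.
\<close>

definition projective :: "('a, 'x) ring_scheme \<Rightarrow> ('a, 'm, 'y) module_scheme \<Rightarrow> bool" where
  "projective E M \<longleftrightarrow> right_module E M \<and>
     (\<exists>(I :: 'm set) (N :: ('a, 'm \<Rightarrow> 'a) module).
        right_module E N \<and> modules_isomorphic E (dsum M N) (free_right_module E I))"

definition submodule_generated ::
  "('a, 'x) ring_scheme \<Rightarrow> ('a, 'm, 'y) module_scheme \<Rightarrow> 'm set \<Rightarrow> 'm set" where
  "submodule_generated E M S = \<Inter>{H. submodule H E M \<and> S \<subseteq> H}"

definition finitely_generated :: "('a, 'x) ring_scheme \<Rightarrow> ('a, 'm, 'y) module_scheme \<Rightarrow> bool" where
  "finitely_generated E M \<longleftrightarrow>
     (\<exists>S\<subseteq>carrier M. finite S \<and> submodule_generated E M S = carrier M)"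

definition countably_generated :: "('a, 'x) ring_scheme \<Rightarrow> ('a, 'm, 'y) module_scheme \<Rightarrow> bool" where
  "countably_generated E M \<longleftrightarrow>
     (\<exists>S\<subseteq>carrier M. countable S \<and> submodule_generated E M S = carrier M)"


section \<open>Preadditive categories with a class of short exact sequences\<close>

text \<open>
  \<open>Hom C A B\<close> is the group of morphisms from \<open>A\<close> to \<open>B\<close>: the operation \<^const>\<open>mult\<close> of this record is the
  addition of morphisms. \<open>Cmp C A B D g f\<close> is the composite of \<open>f\<close> from \<open>A\<close> to \<open>B\<close> and \<open>g\<close> from \<open>B\<close> to \<open>D\<close>.
  \<open>Confl C A i B p D\<close> says that \<open>A \<rightarrow> B \<rightarrow> D\<close>, with maps \<open>i\<close> and \<open>p\<close>, is a short exact sequence of the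
  exact structure.
\<close>

record ('o, 'm) exact_cat =
  Ob :: "'o set"
  Hom :: "'o \<Rightarrow> 'o \<Rightarrow> 'm monoid"
  Cmp :: "'o \<Rightarrow> 'o \<Rightarrow> 'o \<Rightarrow> 'm \<Rightarrow> 'm \<Rightarrow> 'm"
  Idn :: "'o \<Rightarrow> 'm"
  Confl :: "'o \<Rightarrow> 'm \<Rightarrow> 'o \<Rightarrow> 'm \<Rightarrow> 'o \<Rightarrow> bool"

locale preadditive_category =
  fixes C :: "('o, 'm) exact_cat"
  assumes hom_group: "\<lbrakk>A \<in> Ob C; B \<in> Ob C\<rbrakk> \<Longrightarrow> comm_group (Hom C A B)"
    and idn: "A \<in> Ob C \<Longrightarrow> Idn C A \<in> carrier (Hom C A A)"
    and cmp_left: "\<lbrakk>A \<in> Ob C; B \<in> Ob C; D \<in> Ob C; g \<in> carrier (Hom C B D)\<rbrakk> \<Longrightarrow>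
      (\<lambda>f. Cmp C A B D g f) \<in> hom (Hom C A B) (Hom C A D)"
    and cmp_right: "\<lbrakk>A \<in> Ob C; B \<in> Ob C; D \<in> Ob C; f \<in> carrier (Hom C A B)\<rbrakk> \<Longrightarrow>
      (\<lambda>g. Cmp C A B D g f) \<in> hom (Hom C B D) (Hom C A D)"
    and cmp_idn: "\<lbrakk>A \<in> Ob C; B \<in> Ob C; f \<in> carrier (Hom C A B)\<rbrakk> \<Longrightarrow>
      Cmp C A A B f (Idn C A) = f \<and> Cmp C A B B (Idn C B) f = f"
    and cmp_assoc: "\<lbrakk>A \<in> Ob C; B \<in> Ob C; D \<in> Ob C; X \<in> Ob C;
      f \<in> carrier (Hom C A B); g \<in> carrier (Hom C B D); h \<in> carrier (Hom C D X)\<rbrakk> \<Longrightarrow>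
      Cmp C A D X h (Cmp C A B D g f) = Cmp C A B X (Cmp C B D X h g) f"

definition admissible_monic :: "('o, 'm) exact_cat \<Rightarrow> 'o \<Rightarrow> 'o \<Rightarrow> 'm \<Rightarrow> bool" where
  "admissible_monic C A B i \<longleftrightarrow> (\<exists>p D. Confl C A i B p D)"

definition admissible_epic :: "('o, 'm) exact_cat \<Rightarrow> 'o \<Rightarrow> 'o \<Rightarrow> 'm \<Rightarrow> bool" where
  "admissible_epic C B D p \<longleftrightarrow> (\<exists>A i. Confl C A i B p D)"

text \<open>Functors that are additive and preserve short exact sequences.\<close>

locale exact_functor = C: preadditive_category C + D: preadditive_category D
  for C :: "('o, 'm) exact_cat" and D :: "('p, 'n) exact_cat" +
  fixes Fo :: "'o \<Rightarrow> 'p" and Fm :: "'o \<Rightarrow> 'o \<Rightarrow> 'm \<Rightarrow> 'n"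
  assumes ob: "A \<in> Ob C \<Longrightarrow> Fo A \<in> Ob D"
    and additive: "\<lbrakk>A \<in> Ob C; B \<in> Ob C\<rbrakk> \<Longrightarrow> Fm A B \<in> hom (Hom C A B) (Hom D (Fo A) (Fo B))"
    and idn: "A \<in> Ob C \<Longrightarrow> Fm A A (Idn C A) = Idn D (Fo A)"
    and cmp: "\<lbrakk>A \<in> Ob C; B \<in> Ob C; X \<in> Ob C;
      f \<in> carrier (Hom C A B); g \<in> carrier (Hom C B X)\<rbrakk> \<Longrightarrow>
      Fm A X (Cmp C A B X g f) = Cmp D (Fo A) (Fo B) (Fo X) (Fm B X g) (Fm A B f)"
    and exact: "Confl C A i B p X \<Longrightarrow>
      Confl D (Fo A) (Fm A B i) (Fo B) (Fm B X p) (Fo X)"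

definition isomorphism :: "('o, 'm) exact_cat \<Rightarrow> 'o \<Rightarrow> 'o \<Rightarrow> 'm \<Rightarrow> bool" where
  "isomorphism C A B f \<longleftrightarrow> f \<in> carrier (Hom C A B) \<and>
     (\<exists>g\<in>carrier (Hom C B A). Cmp C A B A g f = Idn C A \<and> Cmp C B A B f g = Idn C B)"

definition naturally_isomorphic_to_identity ::
  "('o, 'm) exact_cat \<Rightarrow> ('o \<Rightarrow> 'o) \<Rightarrow> ('o \<Rightarrow> 'o \<Rightarrow> 'm \<Rightarrow> 'm) \<Rightarrow> bool" where
  "naturally_isomorphic_to_identity C To Tm \<longleftrightarrow> (\<exists>\<eta>.
     (\<forall>A\<in>Ob C. isomorphism C A (To A) (\<eta> A)) \<and>
     (\<forall>A\<in>Ob C. \<forall>B\<in>Ob C. \<forall>f\<in>carrier (Hom C A B).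
        Cmp C A B (To B) (\<eta> B) f = Cmp C A (To A) (To B) (Tm A B f) (\<eta> A)))"

definition exact_equivalence ::
  "('o, 'm) exact_cat \<Rightarrow> ('p, 'n) exact_cat \<Rightarrow> ('o \<Rightarrow> 'p) \<Rightarrow> ('o \<Rightarrow> 'o \<Rightarrow> 'm \<Rightarrow> 'n) \<Rightarrow> bool" where
  "exact_equivalence C D Fo Fm \<longleftrightarrow> exact_functor C D Fo Fm \<and>
     (\<exists>Go Gm. exact_functor D C Go Gm \<and>
        naturally_isomorphic_to_identity C
          (\<lambda>A. Go (Fo A)) (\<lambda>A B f. Gm (Fo A) (Fo B) (Fm A B f)) \<and>
        naturally_isomorphic_to_identity D
          (\<lambda>A. Fo (Go A)) (\<lambda>A B f. Fm (Go A) (Go B) (Gm A B f)))"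

definition pointwise_group :: "('m \<Rightarrow> 'n) set \<Rightarrow> 'm set \<Rightarrow> ('n, 'z) ring_scheme \<Rightarrow> ('m \<Rightarrow> 'n) monoid" where
  "pointwise_group H A N =
     \<lparr>carrier = H, mult = (\<lambda>f g. \<lambda>x\<in>A. f x \<oplus>\<^bsub>N\<^esub> g x), one = (\<lambda>x\<in>A. \<zero>\<^bsub>N\<^esub>)\<rparr>"


section \<open>Finitely generated projective right modules\<close>

definition Pf :: "('a, 'x) ring_scheme \<Rightarrow> (('a, 'm) module, 'm \<Rightarrow> 'm) exact_cat" where
  "Pf E =
     \<lparr>Ob = {M. right_module E M \<and> finitely_generated E M \<and> projective E M},
      Hom = (\<lambda>M N. pointwise_group (linear_maps E M N) (carrier M) N),
      Cmp = (\<lambda>A B C g f. compose (carrier A) g f),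
      Idn = (\<lambda>A. \<lambda>x\<in>carrier A. x),
      Confl = (\<lambda>A i B p C.
        (\<forall>M\<in>{A, B, C}. right_module E M \<and> finitely_generated E M \<and> projective E M) \<and>
        i \<in> linear_maps E A B \<and> p \<in> linear_maps E B C \<and>
        inj_on i (carrier A) \<and> i ` carrier A = {y \<in> carrier B. p y = \<zero>\<^bsub>C\<^esub>} \<and>
        p ` carrier B = carrier C)\<rparr>"


section \<open>Topological modules\<close>

record ('a, 'b) tmodule = "('a, 'b) module" +
  topo :: "'b topology"

text \<open>The ring of scalars is discrete, so scalar multiplication is continuous iff every scalar acts
  continuously; continuity of negation is then automatic.\<close>

definition topological_module :: "('a, 'x) ring_scheme \<Rightarrow> ('a, 'm) tmodule \<Rightarrow> bool" where
  "topological_module R M \<longleftrightarrow> module R M \<and> topspace (topo M) = carrier M \<and>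
     continuous_map (prod_topology (topo M) (topo M)) (topo M) (\<lambda>u. fst u \<oplus>\<^bsub>M\<^esub> snd u) \<and>
     (\<forall>a\<in>carrier R. continuous_map (topo M) (topo M) (\<lambda>x. a \<odot>\<^bsub>M\<^esub> x))"

definition with_topology :: "('a, 'm) module \<Rightarrow> 'm topology \<Rightarrow> ('a, 'm) tmodule" where
  "with_topology M T = module.extend M (tmodule.fields T)"

definition discrete_tmodule :: "('a, 'm) module \<Rightarrow> ('a, 'm) tmodule" where
  "discrete_tmodule M = with_topology M (discrete_topology (carrier M))"

definition tdsum :: "('a, 'm) tmodule \<Rightarrow> ('a, 'n) tmodule \<Rightarrow> ('a, 'm \<times> 'n) tmodule" where
  "tdsum M N = with_topology (dsum M N) (prod_topology (topo M) (topo N))"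

definition continuous_linear_maps ::
  "('a, 'x) ring_scheme \<Rightarrow> ('a, 'm) tmodule \<Rightarrow> ('a, 'n) tmodule \<Rightarrow> ('m \<Rightarrow> 'n) set" where
  "continuous_linear_maps R M N = {f \<in> linear_maps R M N. continuous_map (topo M) (topo N) f}"

definition topological_isomorphism ::
  "('a, 'x) ring_scheme \<Rightarrow> ('a, 'm) tmodule \<Rightarrow> ('a, 'n) tmodule \<Rightarrow> ('m \<Rightarrow> 'n) \<Rightarrow> bool" where
  "topological_isomorphism R M N f \<longleftrightarrow>
     f \<in> linear_maps R M N \<and> bij_betw f (carrier M) (carrier N) \<and> homeomorphic_map (topo M) (topo N) f"

definition topologically_isomorphic ::
  "('a, 'x) ring_scheme \<Rightarrow> ('a, 'm) tmodule \<Rightarrow> ('a, 'n) tmodule \<Rightarrow> bool" where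
  "topologically_isomorphic R M N \<longleftrightarrow> (\<exists>f. topological_isomorphism R M N f)"

text \<open>The topology in which the family \<open>B\<close> of submodules of \<open>M\<close> is a basis of neighbourhoods of \<open>0\<close>.\<close>

definition topology_with_basis_at_zero :: "('a, 'm, 'y) module_scheme \<Rightarrow> 'm set set \<Rightarrow> 'm topology" where
  "topology_with_basis_at_zero M B =
     topology (\<lambda>U. U \<subseteq> carrier M \<and> (\<forall>x\<in>U. \<exists>V\<in>B. (\<lambda>v. x \<oplus>\<^bsub>M\<^esub> v) ` V \<subseteq> U))"

lemma openin_topology_with_basis_at_zero:
  assumes "\<And>V W. \<lbrakk>V \<in> B; W \<in> B\<rbrakk> \<Longrightarrow> \<exists>U\<in>B. U \<subseteq> V \<inter> W"
  shows "openin (topology_with_basis_at_zero M B) U \<longleftrightarrow>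
    U \<subseteq> carrier M \<and> (\<forall>x\<in>U. \<exists>V\<in>B. (\<lambda>v. x \<oplus>\<^bsub>M\<^esub> v) ` V \<subseteq> U)"
proof -
  let ?op = "\<lambda>U. U \<subseteq> carrier M \<and> (\<forall>x\<in>U. \<exists>V\<in>B. (\<lambda>v. x \<oplus>\<^bsub>M\<^esub> v) ` V \<subseteq> U)"
  have "?op (S \<inter> T)" if S: "?op S" and T: "?op T" for S T
  proof (intro conjI ballI)
    show "S \<inter> T \<subseteq> carrier M" using S by blast
    fix x assume x: "x \<in> S \<inter> T"
    obtain V where V: "V \<in> B" "(\<lambda>v. x \<oplus>\<^bsub>M\<^esub> v) ` V \<subseteq> S" using S x by auto
    obtain W where W: "W \<in> B" "(\<lambda>v. x \<oplus>\<^bsub>M\<^esub> v) ` W \<subseteq> T" using T x by auto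
    obtain U where U: "U \<in> B" "U \<subseteq> V \<inter> W" using assms[OF V(1) W(1)] by auto
    have "(\<lambda>v. x \<oplus>\<^bsub>M\<^esub> v) ` U \<subseteq> S" "(\<lambda>v. x \<oplus>\<^bsub>M\<^esub> v) ` U \<subseteq> T"
      using image_mono[of U V "\<lambda>v. x \<oplus>\<^bsub>M\<^esub> v"] image_mono[of U W "\<lambda>v. x \<oplus>\<^bsub>M\<^esub> v"] U(2) V(2) W(2)
      by simp_all
    then have "(\<lambda>v. x \<oplus>\<^bsub>M\<^esub> v) ` U \<subseteq> S \<inter> T" by simp
    then show "\<exists>V\<in>B. (\<lambda>v. x \<oplus>\<^bsub>M\<^esub> v) ` V \<subseteq> S \<inter> T" using U(1) by (rule bexI)
  qed
  moreover have "?op (\<Union>K)" if K: "\<forall>S\<in>K. ?op S" for K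
  proof (intro conjI ballI)
    show "\<Union>K \<subseteq> carrier M" using K by blast
    fix x assume "x \<in> \<Union>K"
    then obtain S where S: "S \<in> K" "x \<in> S" by auto
    have "?op S" using K S(1) by (rule bspec)
    then obtain V where V: "V \<in> B" "(\<lambda>v. x \<oplus>\<^bsub>M\<^esub> v) ` V \<subseteq> S" using S(2) by auto
    then have "(\<lambda>v. x \<oplus>\<^bsub>M\<^esub> v) ` V \<subseteq> \<Union>K" using Union_upper[OF S(1)] by (rule_tac subset_trans)
    then show "\<exists>V\<in>B. (\<lambda>v. x \<oplus>\<^bsub>M\<^esub> v) ` V \<subseteq> \<Union>K" using V(1) by (rule bexI)
  qed
  ultimately have "istopology ?op"
    unfolding istopology_def by simp
  then show ?thesis
    unfolding topology_with_basis_at_zero_def by simp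
qed

definition dual_module :: "('a, 'x) ring_scheme \<Rightarrow> ('a, 'q) module \<Rightarrow> ('a, 'q \<Rightarrow> 'a) module" where
  "dual_module R Q = mk_module
     {f \<in> carrier Q \<rightarrow>\<^sub>E carrier R.
       (\<forall>x\<in>carrier Q. \<forall>y\<in>carrier Q. f (x \<oplus>\<^bsub>Q\<^esub> y) = f x \<oplus>\<^bsub>R\<^esub> f y) \<and>
       (\<forall>a\<in>carrier R. \<forall>x\<in>carrier Q. f (a \<odot>\<^bsub>Q\<^esub> x) = a \<otimes>\<^bsub>R\<^esub> f x)}
     (\<lambda>x\<in>carrier Q. \<zero>\<^bsub>R\<^esub>) (\<lambda>f g. \<lambda>x\<in>carrier Q. f x \<oplus>\<^bsub>R\<^esub> g x) (\<lambda>a f. \<lambda>x\<in>carrier Q. a \<otimes>\<^bsub>R\<^esub> f x)"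

definition annihilator :: "('a, 'x) ring_scheme \<Rightarrow> ('a, 'q) module \<Rightarrow> 'q set \<Rightarrow> ('q \<Rightarrow> 'a) set" where
  "annihilator R Q H = {f \<in> carrier (dual_module R Q). \<forall>x\<in>H. f x = \<zero>\<^bsub>R\<^esub>}"

definition dual :: "('a, 'x) ring_scheme \<Rightarrow> ('a, 'q) module \<Rightarrow> ('a, 'q \<Rightarrow> 'a) tmodule" where
  "dual R Q = with_topology (dual_module R Q)
     (topology_with_basis_at_zero (dual_module R Q)
       {annihilator R Q (submodule_generated R Q S) | S.
          S \<subseteq> carrier Q \<and> finite S})"

lemma openin_dual:
  "openin (topo (dual R Q)) U \<longleftrightarrow>
     U \<subseteq> carrier (dual_module R Q) \<and>
     (\<forall>f\<in>U. \<exists>S. S \<subseteq> carrier Q \<and> finite S \<and>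
        (\<lambda>g. f \<oplus>\<^bsub>dual_module R Q\<^esub> g) `
          annihilator R Q (submodule_generated R Q S) \<subseteq> U)"
proof -
  let ?V = "\<lambda>S. annihilator R Q (submodule_generated R Q S)"
  have mono: "?V (S \<union> T) \<subseteq> ?V S \<inter> ?V T" for S T
    unfolding annihilator_def submodule_generated_def by blast
  have "\<exists>U\<in>{?V S |S. S \<subseteq> carrier Q \<and> finite S}. U \<subseteq> V \<inter> W"
    if V: "V \<in> {?V S |S. S \<subseteq> carrier Q \<and> finite S}"
      and W: "W \<in> {?V S |S. S \<subseteq> carrier Q \<and> finite S}" for V W
  proof -
    obtain S T where ST: "V = ?V S" "W = ?V T" "S \<subseteq> carrier Q" "T \<subseteq> carrier Q" "finite S" "finite T"
      using V W by auto
    then have "S \<union> T \<subseteq> carrier Q \<and> finite (S \<union> T)" by simp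
    then show ?thesis using mono[of S T] ST(1,2) by blast
  qed
  note * = openin_topology_with_basis_at_zero[OF this]
  have "topo (dual R Q) =
      topology_with_basis_at_zero (dual_module R Q) {?V S |S. S \<subseteq> carrier Q \<and> finite S}"
    unfolding dual_def with_topology_def by (simp add: tmodule.defs module.defs)
  then have "openin (topo (dual R Q)) U \<longleftrightarrow> U \<subseteq> carrier (dual_module R Q) \<and>
      (\<forall>f\<in>U. \<exists>V\<in>{?V S |S. S \<subseteq> carrier Q \<and> finite S}. (\<lambda>g. f \<oplus>\<^bsub>dual_module R Q\<^esub> g) ` V \<subseteq> U)"
    by (simp only: *)
  moreover have "(\<exists>V\<in>{?V S |S. S \<subseteq> carrier Q \<and> finite S}. P V) \<longleftrightarrow>
      (\<exists>S. S \<subseteq> carrier Q \<and> finite S \<and> P (?V S))" for P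
    by blast
  ultimately show ?thesis by (simp only:)
qed


section \<open>Tate modules of countable type\<close>

text \<open>
  Every countably generated \<open>R\<close>-module is isomorphic to one whose carrier consists of functions
  \<^typ>\<open>nat \<Rightarrow> 'a\<close>, where \<^typ>\<open>'a\<close> is the type of elements of \<open>R\<close>; restricting \<open>P\<close> and \<open>Q\<close> to that
  type therefore loses nothing. The complement \<open>N\<close> can be taken inside \<open>P \<oplus> Q\<^sup>*\<close>.
\<close>

definition countable_tate_module :: "('a, 'x) ring_scheme \<Rightarrow> ('a, 'm) tmodule \<Rightarrow> bool" where
  "countable_tate_module R M \<longleftrightarrow> topological_module R M \<and>
     (\<exists>(P :: ('a, nat \<Rightarrow> 'a) module) (Q :: ('a, nat \<Rightarrow> 'a) module)
       (N :: ('a, (nat \<Rightarrow> 'a) \<times> ((nat \<Rightarrow> 'a) \<Rightarrow> 'a)) tmodule).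
        module R P \<and> projective R P \<and> countably_generated R P \<and>
        module R Q \<and> projective R Q \<and> countably_generated R Q \<and>
        topological_module R N \<and>
        topologically_isomorphic R (tdsum M N) (tdsum (discrete_tmodule P) (dual R Q)))"

text \<open>Short exact sequences isomorphic to \<open>A \<rightarrow> A \<oplus> C \<rightarrow> C\<close>.\<close>

definition split_exact ::
  "('a, 'x) ring_scheme \<Rightarrow> ('a, 'm) tmodule \<Rightarrow> ('m \<Rightarrow> 'n) \<Rightarrow> ('a, 'n) tmodule \<Rightarrow>
     ('n \<Rightarrow> 'k) \<Rightarrow> ('a, 'k) tmodule \<Rightarrow> bool" where
  "split_exact R A i B p C \<longleftrightarrow>
     i \<in> continuous_linear_maps R A B \<and> p \<in> continuous_linear_maps R B C \<and>
     (\<exists>\<phi>. topological_isomorphism R B (tdsum A C) \<phi> \<and>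
        (\<forall>a\<in>carrier A. \<phi> (i a) = (a, \<zero>\<^bsub>C\<^esub>)) \<and> (\<forall>b\<in>carrier B. p b = snd (\<phi> b)))"

text \<open>
  Objects have carriers in a fixed type \<^typ>\<open>'m\<close>. Every countable Tate module injects as a set into
  \<open>R((t))\<close> (defined below), so all isomorphism classes are represented as soon as \<open>R((t))\<close> injects into
  \<^typ>\<open>'m\<close>. In the same way \<open>Pf E\<close> is essentially independent of the type of carriers once the ring \<open>E\<close>,
  infinite or zero, injects into that type. The exact structure is the split one.
\<close>

definition Tate_Dr :: "('a, 'x) ring_scheme \<Rightarrow> (('a, 'm) tmodule, 'm \<Rightarrow> 'm) exact_cat" where
  "Tate_Dr R =
     \<lparr>Ob = {M. countable_tate_module R M},
      Hom = (\<lambda>M N. pointwise_group (continuous_linear_maps R M N) (carrier M) N),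
      Cmp = (\<lambda>A B C g f. compose (carrier A) g f),
      Idn = (\<lambda>A. \<lambda>x\<in>carrier A. x),
      Confl = (\<lambda>A i B p C.
        (\<forall>M\<in>{A, B, C}. countable_tate_module R M) \<and> split_exact R A i B p C)\<rparr>"

text \<open>\<open>R((t))\<close>: a series is the function sending \<open>n\<close> to its coefficient at \<open>t\<^sup>n\<close>.\<close>

definition laurent_module :: "('a, 'x) ring_scheme \<Rightarrow> ('a, int \<Rightarrow> 'a) module" where
  "laurent_module R = mk_module
     {f. (\<forall>n. f n \<in> carrier R) \<and> (\<exists>N. \<forall>n<N. f n = \<zero>\<^bsub>R\<^esub>)}
     (\<lambda>n. \<zero>\<^bsub>R\<^esub>) (\<lambda>f g n. f n \<oplus>\<^bsub>R\<^esub> g n) (\<lambda>a f n. a \<otimes>\<^bsub>R\<^esub> f n)"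

definition laurent :: "('a, 'x) ring_scheme \<Rightarrow> ('a, int \<Rightarrow> 'a) tmodule" where
  "laurent R = with_topology (laurent_module R)
     (topology_with_basis_at_zero (laurent_module R)
       (range (\<lambda>N. {f \<in> carrier (laurent_module R). \<forall>n<N. f n = \<zero>\<^bsub>R\<^esub>})))"

lemma openin_laurent:
  "openin (topo (laurent R)) U \<longleftrightarrow>
     U \<subseteq> carrier (laurent_module R) \<and>
     (\<forall>f\<in>U. \<exists>N. (\<lambda>g. f \<oplus>\<^bsub>laurent_module R\<^esub> g) `
        {g \<in> carrier (laurent_module R). \<forall>n<N. g n = \<zero>\<^bsub>R\<^esub>} \<subseteq> U)"
proof -
  let ?V = "\<lambda>N. {g \<in> carrier (laurent_module R). \<forall>n<N. g n = \<zero>\<^bsub>R\<^esub>}"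
  have mono: "?V (max N N') \<subseteq> ?V N \<inter> ?V N'" for N N' by auto
  have "\<exists>U\<in>range ?V. U \<subseteq> V \<inter> W" if "V \<in> range ?V" "W \<in> range ?V" for V W
  proof -
    obtain N N' where "V = ?V N" "W = ?V N'" using \<open>V \<in> range ?V\<close> \<open>W \<in> range ?V\<close> by (elim rangeE)
    with mono[of N N'] show ?thesis by (intro bexI[of _ "?V (max N N')"]) (simp, rule rangeI)
  qed
  note * = openin_topology_with_basis_at_zero[OF this]
  have "topo (laurent R) = topology_with_basis_at_zero (laurent_module R) (range ?V)"
    unfolding laurent_def with_topology_def by (simp add: tmodule.defs module.defs)
  then show ?thesis by (simp only: * bex_simps)
qed

text \<open>The ring of endomorphisms, multiplication being composition; it is an algebra over the
  commutative ring of scalars.\<close>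

definition End_algebra :: "('a, 'x) ring_scheme \<Rightarrow> ('a, 'm) tmodule \<Rightarrow> ('a, 'm \<Rightarrow> 'm) module" where
  "End_algebra R X =
     \<lparr>carrier = continuous_linear_maps R X X,
      mult = (\<lambda>g f. compose (carrier X) g f),
      one = (\<lambda>x\<in>carrier X. x),
      zero = (\<lambda>x\<in>carrier X. \<zero>\<^bsub>X\<^esub>),
      add = (\<lambda>f g. \<lambda>x\<in>carrier X. f x \<oplus>\<^bsub>X\<^esub> g x),
      smult = (\<lambda>a f. \<lambda>x\<in>carrier X. a \<odot>\<^bsub>X\<^esub> f x)\<rparr>"


section \<open>Lattices, bounded and discrete endomorphisms\<close>

definition countable_directed :: "nat set \<Rightarrow> (nat \<Rightarrow> nat \<Rightarrow> bool) \<Rightarrow> bool" where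
  "countable_directed I prec \<longleftrightarrow> I \<noteq> {} \<and> (\<forall>i\<in>I. prec i i) \<and>
     (\<forall>i\<in>I. \<forall>j\<in>I. prec i j \<and> prec j i \<longrightarrow> i = j) \<and>
     (\<forall>i\<in>I. \<forall>j\<in>I. \<forall>k\<in>I. prec i j \<and> prec j k \<longrightarrow> prec i k) \<and>
     (\<forall>i\<in>I. \<forall>j\<in>I. \<exists>k\<in>I. prec i k \<and> prec j k)"

definition admissible_ind_diagram ::
  "('o, 'm) exact_cat \<Rightarrow> nat set \<Rightarrow> (nat \<Rightarrow> nat \<Rightarrow> bool) \<Rightarrow> (nat \<Rightarrow> 'o) \<Rightarrow> (nat \<Rightarrow> nat \<Rightarrow> 'm) \<Rightarrow> bool" where
  "admissible_ind_diagram C I prec X t \<longleftrightarrow> countable_directed I prec \<and>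
     (\<forall>i\<in>I. X i \<in> Ob C \<and> t i i = Idn C (X i)) \<and>
     (\<forall>i\<in>I. \<forall>j\<in>I. prec i j \<longrightarrow> admissible_monic C (X i) (X j) (t i j)) \<and>
     (\<forall>i\<in>I. \<forall>j\<in>I. \<forall>k\<in>I. prec i j \<and> prec j k \<longrightarrow> t i k = Cmp C (X i) (X j) (X k) (t j k) (t i j))"

text \<open>The transition map attached to \<open>prec i j\<close> is \<open>t i j\<close> from \<open>X j\<close> to \<open>X i\<close>.\<close>

definition admissible_pro_diagram ::
  "('o, 'm) exact_cat \<Rightarrow> nat set \<Rightarrow> (nat \<Rightarrow> nat \<Rightarrow> bool) \<Rightarrow> (nat \<Rightarrow> 'o) \<Rightarrow> (nat \<Rightarrow> nat \<Rightarrow> 'm) \<Rightarrow> bool" where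
  "admissible_pro_diagram C I prec X t \<longleftrightarrow> countable_directed I prec \<and>
     (\<forall>i\<in>I. X i \<in> Ob C \<and> t i i = Idn C (X i)) \<and>
     (\<forall>i\<in>I. \<forall>j\<in>I. prec i j \<longrightarrow> admissible_epic C (X j) (X i) (t i j)) \<and>
     (\<forall>i\<in>I. \<forall>j\<in>I. \<forall>k\<in>I. prec i j \<and> prec j k \<longrightarrow> t i k = Cmp C (X k) (X j) (X i) (t i j) (t j k))"

text \<open>
  The realisation functor from Tate objects in \<^term>\<open>Pf R\<close> to topological modules sends admissible
  Ind-objects to colimits with the discrete topology and admissible Pro-objects to limits of discrete
  modules. As the transition maps of an admissible Ind-diagram are injective, its colimit is a
  module that is the union of compatible injective images of the members of the diagram.
  Finitely generated modules can be carried by the type \<^typ>\<open>nat \<Rightarrow> 'a\<close>.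
\<close>

definition ind_object :: "('a, 'x) ring_scheme \<Rightarrow> ('a, 'm) tmodule \<Rightarrow> bool" where
  "ind_object R M \<longleftrightarrow> topological_module R M \<and> topo M = discrete_topology (carrier M) \<and>
     (\<exists>I prec (X :: nat \<Rightarrow> ('a, nat \<Rightarrow> 'a) module) t u.
        admissible_ind_diagram (Pf R) I prec X t \<and>
        (\<forall>i\<in>I. u i \<in> linear_maps R (X i) M \<and> inj_on (u i) (carrier (X i))) \<and>
        (\<forall>i\<in>I. \<forall>j\<in>I. prec i j \<longrightarrow> u i = compose (carrier (X i)) (u j) (t i j)) \<and>
        (\<Union>i\<in>I. u i ` carrier (X i)) = carrier M)"

definition limit_module ::
  "nat set \<Rightarrow> (nat \<Rightarrow> nat \<Rightarrow> bool) \<Rightarrow> (nat \<Rightarrow> ('a, 'd) module) \<Rightarrow> (nat \<Rightarrow> nat \<Rightarrow> 'd \<Rightarrow> 'd) \<Rightarrow>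
     ('a, nat \<Rightarrow> 'd) module" where
  "limit_module I prec X t = mk_module
     {x \<in> \<Pi>\<^sub>E i\<in>I. carrier (X i). \<forall>i\<in>I. \<forall>j\<in>I. prec i j \<longrightarrow> t i j (x j) = x i}
     (\<lambda>i\<in>I. \<zero>\<^bsub>X i\<^esub>) (\<lambda>x y. \<lambda>i\<in>I. x i \<oplus>\<^bsub>X i\<^esub> y i) (\<lambda>a x. \<lambda>i\<in>I. a \<odot>\<^bsub>X i\<^esub> x i)"

definition limit_tmodule ::
  "nat set \<Rightarrow> (nat \<Rightarrow> nat \<Rightarrow> bool) \<Rightarrow> (nat \<Rightarrow> ('a, 'd) module) \<Rightarrow> (nat \<Rightarrow> nat \<Rightarrow> 'd \<Rightarrow> 'd) \<Rightarrow>
     ('a, nat \<Rightarrow> 'd) tmodule" where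
  "limit_tmodule I prec X t = with_topology (limit_module I prec X t)
     (subtopology (product_topology (\<lambda>i. discrete_topology (carrier (X i))) I)
       (carrier (limit_module I prec X t)))"

definition pro_object :: "('a, 'x) ring_scheme \<Rightarrow> ('a, 'm) tmodule \<Rightarrow> bool" where
  "pro_object R M \<longleftrightarrow> topological_module R M \<and>
     (\<exists>I prec (X :: nat \<Rightarrow> ('a, nat \<Rightarrow> 'a) module) t.
        admissible_pro_diagram (Pf R) I prec X t \<and>
        topologically_isomorphic R M (limit_tmodule I prec X t))"

definition sub_tmodule :: "('a, 'm) tmodule \<Rightarrow> 'm set \<Rightarrow> ('a, 'm) tmodule" where
  "sub_tmodule X L = X\<lparr>carrier := L, topo := subtopology (topo X) L\<rparr>"

text \<open>
  Admissible sub-objects are taken with respect to the split exact structure. The quotient \<open>X / L\<close> is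
  the third term \<open>C\<close> of the sequence; as the sequence splits, \<open>C\<close> can be realised inside \<open>X\<close>.
\<close>

definition tate_lattice :: "('a, 'x) ring_scheme \<Rightarrow> ('a, 'm) tmodule \<Rightarrow> 'm set \<Rightarrow> bool" where
  "tate_lattice R X L \<longleftrightarrow> submodule L R X \<and> pro_object R (sub_tmodule X L) \<and>
     (\<exists>(C :: ('a, 'm) tmodule) p.
        split_exact R (sub_tmodule X L) (\<lambda>x\<in>L. x) X p C \<and> ind_object R C)"

definition bounded_endos :: "('a, 'x) ring_scheme \<Rightarrow> ('a, 'm) tmodule \<Rightarrow> ('m \<Rightarrow> 'm) set" where
  "bounded_endos R X = {f \<in> continuous_linear_maps R X X.
     \<exists>L. tate_lattice R X L \<and>
       (\<exists>g\<in>continuous_linear_maps R X (sub_tmodule X L). f = compose (carrier X) (\<lambda>x\<in>L. x) g)}"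

definition discrete_endos :: "('a, 'x) ring_scheme \<Rightarrow> ('a, 'm) tmodule \<Rightarrow> ('m \<Rightarrow> 'm) set" where
  "discrete_endos R X = {f \<in> continuous_linear_maps R X X.
     \<exists>L. tate_lattice R X L \<and> (\<forall>x\<in>L. f x = \<zero>\<^bsub>X\<^esub>)}"


section \<open>Cubical algebras\<close>

text \<open>The locale \<^locale>\<open>algebra\<close> of HOL-Algebra is about commutative algebras only.\<close>

definition associative_algebra :: "('a, 'x) ring_scheme \<Rightarrow> ('a, 'e, 'y) module_scheme \<Rightarrow> bool" where
  "associative_algebra R A \<longleftrightarrow> module R A \<and> ring A \<and>
     (\<forall>a\<in>carrier R. \<forall>x\<in>carrier A. \<forall>y\<in>carrier A.
        (a \<odot>\<^bsub>A\<^esub> x) \<otimes>\<^bsub>A\<^esub> y = a \<odot>\<^bsub>A\<^esub> (x \<otimes>\<^bsub>A\<^esub> y) \<and> x \<otimes>\<^bsub>A\<^esub> (a \<odot>\<^bsub>A\<^esub> y) = a \<odot>\<^bsub>A\<^esub> (x \<otimes>\<^bsub>A\<^esub> y))"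

definition beilinson_cubical_algebra ::
  "('a, 'x) ring_scheme \<Rightarrow> ('a, 'e, 'y) module_scheme \<Rightarrow> 'e set \<Rightarrow> 'e set \<Rightarrow> bool" where
  "beilinson_cubical_algebra R A J K \<longleftrightarrow>
     associative_algebra R A \<and> ideal J A \<and> ideal K A \<and> J <+>\<^bsub>A\<^esub> K = carrier A"

end

theory Submission
  imports Defs
begin

text \<open>
  If \<open>P\<close> and \<open>Q\<close> are countably generated projective, dual bases make \<open>P \<oplus> Q\<^sup>*\<close> a retract of
  \<open>t\<^sup>-\<^sup>1R[t\<^sup>-\<^sup>1] \<oplus> R[[t]] = R((t))\<close>, so every countable Tate module is a retract of \<open>R((t))\<close>. Likewise
  \<open>R((t)) \<cong> R((t))\<^sup>k\<close> makes \<open>E\<^sup>k\<close> a retract of \<open>E\<close>, so every finitely generated projective right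
  \<open>E\<close>-module is a retract of \<open>E\<close>. Both categories are therefore presented by idempotents \<open>e A\<close> of \<open>E\<close>,
  with \<open>Hom A B = e B \<cdot> E \<cdot> e A\<close>, with every idempotent of \<open>E\<close> occurring up to equivalence, and with the
  split sequences as short exact sequences; two categories presented in this way over the same ring
  are exactly equivalent.

  For the ideals, every lattice in \<open>R((t))\<close> lies between two of the lattices \<open>t\<^sup>n R[[t]]\<close>. Hence an
  endomorphism is bounded iff its image lies in some \<open>t\<^sup>n R[[t]]\<close> and discrete iff it vanishes on some
  \<open>t\<^sup>n R[[t]]\<close>, and cutting the values of an endomorphism at \<open>t\<^sup>0\<close> writes it as the sum of a bounded and
  a discrete one.
\<close>

section \<open>Concrete additive categories\<close>

text \<open>The textbook functor sends a Tate module \<open>M\<close> to the right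
  \<open>E\<close>-module of morphisms from R((t)) to \<open>M\<close>. In HOL the elements of that
  module are functions into the carrier type of \<open>M\<close>, whereas objects of
  \<open>Pf E\<close> must have carriers in the given type \<open>'n\<close>. Idempotents avoid the
  change of type: each object is reduced to an element of \<open>E\<close>, morphisms are compared
  inside \<open>E\<close>, and an object of the prescribed type is made only where an idempotent has
  to be realised, by copying a summand along an injection.

  On the topological side the difficulty is that a lattice is given abstractly, by some diagram of
  finitely generated projective modules. That it lies in some \<open>t^n R[[t]]\<close> holds
  because modulo \<open>R[[t]]\<close> it has only finitely many generators. That bounded
  endomorphisms form an ideal is not formal either: every continuous endomorphism has to be shown to
  carry \<open>t^n R[[t]]\<close> into some \<open>t^N R[[t]]\<close>.\<close>

text \<open>Both \<open>Pf\<close> and \<open>Tate_Dr\<close> are instances. The extension type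
  \<open>'z\<close> covers modules with and without a topology, and \<open>H\<close> stands for the
  respective set of maps.\<close>

lemma preadditive_concrete:
  fixes C :: "(('a, 'm, 'z) module_scheme, 'm \<Rightarrow> 'm) exact_cat"
  assumes Hom: "\<And>A B. Hom C A B = pointwise_group (H A B) (carrier A) B"
    and Cmp: "\<And>A B D g f. Cmp C A B D g f = compose (carrier A) g f"
    and Idn: "\<And>A. Idn C A = (\<lambda>x\<in>carrier A. x)"
    and group: "\<And>A. A \<in> Ob C \<Longrightarrow> abelian_group A"
    and ext: "\<And>A B f. \<lbrakk>A \<in> Ob C; B \<in> Ob C; f \<in> H A B\<rbrakk> \<Longrightarrow> f \<in> carrier A \<rightarrow>\<^sub>E carrier B"
    and additive: "\<And>A B f x y. \<lbrakk>A \<in> Ob C; B \<in> Ob C; f \<in> H A B; x \<in> carrier A; y \<in> carrier A\<rbrakk> \<Longrightarrow>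
      f (x \<oplus>\<^bsub>A\<^esub> y) = f x \<oplus>\<^bsub>B\<^esub> f y"
    and zero: "\<And>A B. \<lbrakk>A \<in> Ob C; B \<in> Ob C\<rbrakk> \<Longrightarrow> (\<lambda>x\<in>carrier A. \<zero>\<^bsub>B\<^esub>) \<in> H A B"
    and add: "\<And>A B f g. \<lbrakk>A \<in> Ob C; B \<in> Ob C; f \<in> H A B; g \<in> H A B\<rbrakk> \<Longrightarrow>
      (\<lambda>x\<in>carrier A. f x \<oplus>\<^bsub>B\<^esub> g x) \<in> H A B"
    and neg: "\<And>A B f. \<lbrakk>A \<in> Ob C; B \<in> Ob C; f \<in> H A B\<rbrakk> \<Longrightarrow> (\<lambda>x\<in>carrier A. \<ominus>\<^bsub>B\<^esub> f x) \<in> H A B"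
    and id: "\<And>A. A \<in> Ob C \<Longrightarrow> (\<lambda>x\<in>carrier A. x) \<in> H A A"
    and comp: "\<And>A B D f g. \<lbrakk>A \<in> Ob C; B \<in> Ob C; D \<in> Ob C; f \<in> H A B; g \<in> H B D\<rbrakk> \<Longrightarrow>
      compose (carrier A) g f \<in> H A D"
  shows "preadditive_category C"
proof (rule preadditive_category.intro)
  have mem: "f x \<in> carrier B" if "A \<in> Ob C" "B \<in> Ob C" "f \<in> H A B" "x \<in> carrier A" for A B f x
    using ext[OF that(1-3)] that(4) by auto
  fix A B assume A: "A \<in> Ob C" and B: "B \<in> Ob C"
  interpret B: abelian_group B using B by (rule group)
  interpret A: abelian_group A using A by (rule group)
  let ?G = "pointwise_group (H A B) (carrier A) B"
  have "comm_group ?G"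
  proof (rule comm_groupI)
    fix f assume "f \<in> carrier ?G"
    then have f: "f \<in> H A B" by (simp add: pointwise_group_def)
    then show "\<one>\<^bsub>?G\<^esub> \<otimes>\<^bsub>?G\<^esub> f = f"
      using ext[OF A B f]
      by (auto simp: pointwise_group_def fun_eq_iff mem[OF A B] PiE_def extensional_def)
    show "\<exists>g\<in>carrier ?G. g \<otimes>\<^bsub>?G\<^esub> f = \<one>\<^bsub>?G\<^esub>"
      using neg[OF A B f]
      by (intro bexI[of _ "\<lambda>x\<in>carrier A. \<ominus>\<^bsub>B\<^esub> f x"])
        (auto simp: pointwise_group_def fun_eq_iff mem[OF A B f] B.l_neg)
  qed (auto simp: pointwise_group_def fun_eq_iff zero A B add mem[OF A B] B.a_ac)
  then show "comm_group (Hom C A B)" unfolding Hom .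
  show "Cmp C A A B f (Idn C A) = f \<and> Cmp C A B B (Idn C B) f = f" if "f \<in> carrier (Hom C A B)" for f
  proof -
    have "f \<in> H A B" using that by (simp add: Hom pointwise_group_def)
    with ext[OF A B this] show ?thesis
      by (auto simp: Cmp Idn fun_eq_iff compose_def mem[OF A B] PiE_def extensional_def)
  qed
  fix D assume D: "D \<in> Ob C"
  interpret D: abelian_group D using D by (rule group)
  show "(\<lambda>f. Cmp C A B D g f) \<in> hom (Hom C A B) (Hom C A D)" if "g \<in> carrier (Hom C B D)" for g
  proof -
    have "g \<in> H B D" using that by (simp add: Hom pointwise_group_def)
    then show ?thesis
      by (auto simp: hom_def Hom Cmp pointwise_group_def comp[OF A B D, unfolded compose_def] fun_eq_iff compose_def
          mem[OF A B] additive[OF B D])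
  qed
  show "(\<lambda>g. Cmp C A B D g f) \<in> hom (Hom C B D) (Hom C A D)" if "f \<in> carrier (Hom C A B)" for f
  proof -
    have "f \<in> H A B" using that by (simp add: Hom pointwise_group_def)
    then show ?thesis
      by (auto simp: hom_def Hom Cmp pointwise_group_def comp[OF A B D, unfolded compose_def] fun_eq_iff compose_def
          mem[OF A B])
  qed
  fix X f g h assume X: "X \<in> Ob C" and f: "f \<in> carrier (Hom C A B)"
    and "g \<in> carrier (Hom C B D)" "h \<in> carrier (Hom C D X)"
  have "f \<in> H A B" using f by (simp add: Hom pointwise_group_def)
  then show "Cmp C A D X h (Cmp C A B D g f) = Cmp C A B X (Cmp C B D X h g) f"
    by (auto simp: Cmp fun_eq_iff compose_def mem[OF A B])
qed (simp add: Hom Idn id pointwise_group_def)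

section \<open>Categories presented by idempotents of a ring\<close>

text \<open>Full faithfulness and essential surjectivity onto the idempotent completion of
  \<open>E\<close>, regarded as a category with one object: \<open>\<theta>\<close> identifies the
  morphisms with a corner of \<open>E\<close>, and \<open>realised\<close> says that every
  idempotent is isomorphic to some \<open>e X\<close>. Short exact sequences enter as split ones,
  written with equations that every additive functor respects.\<close>

locale idempotent_presentation = preadditive_category C + E: ring E
  for C :: "('o, 'm) exact_cat" and E :: "('e, 'x) ring_scheme" +
  fixes e :: "'o \<Rightarrow> 'e" and \<theta> :: "'o \<Rightarrow> 'o \<Rightarrow> 'm \<Rightarrow> 'e"
  assumes \<theta>_bij: "\<lbrakk>A \<in> Ob C; B \<in> Ob C\<rbrakk> \<Longrightarrow>
      bij_betw (\<theta> A B) (carrier (Hom C A B)) {x \<in> carrier E. e B \<otimes>\<^bsub>E\<^esub> x = x \<and> x \<otimes>\<^bsub>E\<^esub> e A = x}"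
    and \<theta>_add: "\<lbrakk>A \<in> Ob C; B \<in> Ob C; f \<in> carrier (Hom C A B); g \<in> carrier (Hom C A B)\<rbrakk> \<Longrightarrow>
      \<theta> A B (f \<otimes>\<^bsub>Hom C A B\<^esub> g) = \<theta> A B f \<oplus>\<^bsub>E\<^esub> \<theta> A B g"
    and \<theta>_idn: "A \<in> Ob C \<Longrightarrow> \<theta> A A (Idn C A) = e A"
    and \<theta>_cmp: "\<lbrakk>A \<in> Ob C; B \<in> Ob C; D \<in> Ob C; f \<in> carrier (Hom C A B); g \<in> carrier (Hom C B D)\<rbrakk> \<Longrightarrow>
      \<theta> A D (Cmp C A B D g f) = \<theta> B D g \<otimes>\<^bsub>E\<^esub> \<theta> A B f"
    and realised: "\<lbrakk>a \<in> carrier E; a \<otimes>\<^bsub>E\<^esub> a = a\<rbrakk> \<Longrightarrow>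
      \<exists>X\<in>Ob C. \<exists>u\<in>carrier E. \<exists>v\<in>carrier E. u \<otimes>\<^bsub>E\<^esub> v = e X \<and> v \<otimes>\<^bsub>E\<^esub> u = a"
    and confl_iff: "Confl C A i B p D \<longleftrightarrow>
      A \<in> Ob C \<and> B \<in> Ob C \<and> D \<in> Ob C \<and> i \<in> carrier (Hom C A B) \<and> p \<in> carrier (Hom C B D) \<and>
      (\<exists>r\<in>carrier (Hom C B A). \<exists>s\<in>carrier (Hom C D B).
         Cmp C A B A r i = Idn C A \<and> Cmp C D B D p s = Idn C D \<and>
         Cmp C B A B i r \<otimes>\<^bsub>Hom C B B\<^esub> Cmp C B D B s p = Idn C B)"
begin

lemma cmp_closed [intro]:
  "\<lbrakk>A \<in> Ob C; B \<in> Ob C; D \<in> Ob C; f \<in> carrier (Hom C A B); g \<in> carrier (Hom C B D)\<rbrakk> \<Longrightarrow>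
    Cmp C A B D g f \<in> carrier (Hom C A D)"
  using cmp_left[of A B D g] by (auto simp: hom_def)

lemma \<theta>_mem:
  assumes "A \<in> Ob C" "B \<in> Ob C" "f \<in> carrier (Hom C A B)"
  shows "\<theta> A B f \<in> carrier E" "e B \<otimes>\<^bsub>E\<^esub> \<theta> A B f = \<theta> A B f" "\<theta> A B f \<otimes>\<^bsub>E\<^esub> e A = \<theta> A B f"
  using bij_betw_apply[OF \<theta>_bij assms(3)] assms by auto

text \<open>The identity is a morphism, so its image \<open>e A\<close> under
  \<open>\<theta>\<close> satisfies the equations of the corner, and these say that
  \<open>e A\<close> is idempotent.\<close>

lemma e_closed [simp]: "A \<in> Ob C \<Longrightarrow> e A \<in> carrier E"
  and e_idem [simp]: "A \<in> Ob C \<Longrightarrow> e A \<otimes>\<^bsub>E\<^esub> e A = e A"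
  using \<theta>_mem[of A A "Idn C A"] by (simp_all add: idn \<theta>_idn)

lemma \<theta>_inj:
  assumes "A \<in> Ob C" "B \<in> Ob C" "f \<in> carrier (Hom C A B)" "g \<in> carrier (Hom C A B)" "\<theta> A B f = \<theta> A B g"
  shows "f = g"
  using \<theta>_bij[OF assms(1,2)] assms(3-) by (auto simp: bij_betw_def inj_on_def)

definition \<theta>_inv :: "'o \<Rightarrow> 'o \<Rightarrow> 'e \<Rightarrow> 'm" where
  "\<theta>_inv A B x = inv_into (carrier (Hom C A B)) (\<theta> A B) x"

lemma \<theta>_inv:
  assumes "A \<in> Ob C" "B \<in> Ob C" "x \<in> carrier E" "e B \<otimes>\<^bsub>E\<^esub> x = x" "x \<otimes>\<^bsub>E\<^esub> e A = x"
  shows "\<theta>_inv A B x \<in> carrier (Hom C A B)" "\<theta> A B (\<theta>_inv A B x) = x"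
  using \<theta>_bij[OF assms(1,2)] assms(3-) unfolding \<theta>_inv_def
  by (auto simp: bij_betw_def inv_into_into f_inv_into_f)

end

text \<open>Replace \<open>u\<close> by \<open>uvu\<close> and \<open>v\<close> by
  \<open>vuv\<close>. Their products are the third powers of the idempotents \<open>uv\<close> and
  \<open>vu\<close>, and the absorption rules hold because \<open>uvu\<close> equals both
  \<open>e u\<close> and \<open>u a\<close>, and \<open>vuv\<close> equals both \<open>a v\<close>
  and \<open>v e\<close>.\<close>

lemma (in ring) equivalent_idempotents_normalised:
  assumes uv: "u \<in> carrier R" "v \<in> carrier R" and e: "u \<otimes> v = e" "e \<otimes> e = e" and a: "v \<otimes> u = a" "a \<otimes> a = a"
  obtains u' v' where "u' \<in> carrier R" "v' \<in> carrier R" "u' \<otimes> v' = e" "v' \<otimes> u' = a"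
    "e \<otimes> u' = u'" "u' \<otimes> a = u'" "a \<otimes> v' = v'" "v' \<otimes> e = v'"
proof
  \<comment> \<open>Idempotency is stated with products nested to the right, and below also with a
    factor \<open>x\<close> at the end, so that the simplifier can shorten every word in
    \<open>u\<close> and \<open>v\<close>.\<close>
  have E: "u \<otimes> (v \<otimes> (u \<otimes> v)) = u \<otimes> v" (is "?l = _")
  proof -
    have "?l = (u \<otimes> v) \<otimes> (u \<otimes> v)" using uv by (simp only: m_assoc m_closed)
    then show ?thesis by (simp only: e)
  qed
  have A: "v \<otimes> (u \<otimes> (v \<otimes> u)) = v \<otimes> u" (is "?l = _")
  proof -
    have "?l = (v \<otimes> u) \<otimes> (v \<otimes> u)" using uv by (simp only: m_assoc m_closed)
    then show ?thesis by (simp only: a)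
  qed
  have E': "u \<otimes> (v \<otimes> (u \<otimes> (v \<otimes> x))) = u \<otimes> (v \<otimes> x)" if "x \<in> carrier R" for x
    using arg_cong[OF E, of "\<lambda>y. y \<otimes> x"] uv that by (simp add: m_assoc)
  have A': "v \<otimes> (u \<otimes> (v \<otimes> (u \<otimes> x))) = v \<otimes> (u \<otimes> x)" if "x \<in> carrier R" for x
    using arg_cong[OF A, of "\<lambda>y. y \<otimes> x"] uv that by (simp add: m_assoc)
  let ?u = "u \<otimes> v \<otimes> u" and ?v = "v \<otimes> u \<otimes> v"
  show "?u \<in> carrier R" "?v \<in> carrier R" using uv by auto
  show "?u \<otimes> ?v = e" "?v \<otimes> ?u = a" "e \<otimes> ?u = ?u" "?u \<otimes> a = ?u" "a \<otimes> ?v = ?v" "?v \<otimes> e = ?v"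
    unfolding e(1)[symmetric] a(1)[symmetric] using uv by (simp_all add: m_assoc E A E' A')
qed

text \<open>\<open>u A\<close> and \<open>v A\<close> are mutually inverse isomorphisms between
  \<open>e A\<close> and \<open>e' (F A)\<close> in the idempotent completion of \<open>E\<close>;
  the last two assumptions place them in the right corners.\<close>

locale two_presentations = C: idempotent_presentation C E e \<theta> + D: idempotent_presentation D E e' \<theta>'
  for C :: "('o, 'm) exact_cat" and D :: "('p, 'n) exact_cat" and E :: "('e, 'x) ring_scheme"
    and e \<theta> e' \<theta>' +
  fixes F :: "'o \<Rightarrow> 'p" and u v :: "'o \<Rightarrow> 'e"
  assumes F: "A \<in> Ob C \<Longrightarrow> F A \<in> Ob D"
    and uv_closed [simp]: "A \<in> Ob C \<Longrightarrow> u A \<in> carrier E" "A \<in> Ob C \<Longrightarrow> v A \<in> carrier E"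
    and uv: "A \<in> Ob C \<Longrightarrow> u A \<otimes>\<^bsub>E\<^esub> v A = e' (F A)" "A \<in> Ob C \<Longrightarrow> v A \<otimes>\<^bsub>E\<^esub> u A = e A"
    and u_norm: "A \<in> Ob C \<Longrightarrow> e' (F A) \<otimes>\<^bsub>E\<^esub> u A = u A" "A \<in> Ob C \<Longrightarrow> u A \<otimes>\<^bsub>E\<^esub> e A = u A"
    and v_norm: "A \<in> Ob C \<Longrightarrow> e A \<otimes>\<^bsub>E\<^esub> v A = v A" "A \<in> Ob C \<Longrightarrow> v A \<otimes>\<^bsub>E\<^esub> e' (F A) = v A"
begin

text \<open>Conjugation by these isomorphisms carries the corner of \<open>A\<close> and
  \<open>B\<close> to that of \<open>F A\<close> and \<open>F B\<close>;
  \<open>D.\<theta>_inv\<close> turns the result back into a morphism of \<open>D\<close>.\<close>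

definition Fm :: "'o \<Rightarrow> 'o \<Rightarrow> 'm \<Rightarrow> 'n" where
  "Fm A B f = D.\<theta>_inv (F A) (F B) (u B \<otimes>\<^bsub>E\<^esub> \<theta> A B f \<otimes>\<^bsub>E\<^esub> v A)"

lemma uv_assoc:
  assumes "A \<in> Ob C" "x \<in> carrier E"
  shows "u A \<otimes>\<^bsub>E\<^esub> (v A \<otimes>\<^bsub>E\<^esub> x) = e' (F A) \<otimes>\<^bsub>E\<^esub> x" "v A \<otimes>\<^bsub>E\<^esub> (u A \<otimes>\<^bsub>E\<^esub> x) = e A \<otimes>\<^bsub>E\<^esub> x"
    "e' (F A) \<otimes>\<^bsub>E\<^esub> (u A \<otimes>\<^bsub>E\<^esub> x) = u A \<otimes>\<^bsub>E\<^esub> x" "u A \<otimes>\<^bsub>E\<^esub> (e A \<otimes>\<^bsub>E\<^esub> x) = u A \<otimes>\<^bsub>E\<^esub> x"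
    "e A \<otimes>\<^bsub>E\<^esub> (v A \<otimes>\<^bsub>E\<^esub> x) = v A \<otimes>\<^bsub>E\<^esub> x" "v A \<otimes>\<^bsub>E\<^esub> (e' (F A) \<otimes>\<^bsub>E\<^esub> x) = v A \<otimes>\<^bsub>E\<^esub> x"
  using assms F by (simp_all add: C.E.m_assoc[symmetric] uv u_norm v_norm)

lemma \<theta>_assoc:
  assumes "A \<in> Ob C" "B \<in> Ob C" "f \<in> carrier (Hom C A B)" "x \<in> carrier E"
  shows "e B \<otimes>\<^bsub>E\<^esub> (\<theta> A B f \<otimes>\<^bsub>E\<^esub> x) = \<theta> A B f \<otimes>\<^bsub>E\<^esub> x" "\<theta> A B f \<otimes>\<^bsub>E\<^esub> (e A \<otimes>\<^bsub>E\<^esub> x) = \<theta> A B f \<otimes>\<^bsub>E\<^esub> x"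
  using assms by (simp_all add: C.E.m_assoc[symmetric] C.\<theta>_mem)

lemma Fm:
  assumes "A \<in> Ob C" "B \<in> Ob C" "f \<in> carrier (Hom C A B)"
  shows "Fm A B f \<in> carrier (Hom D (F A) (F B))" "\<theta>' (F A) (F B) (Fm A B f) = u B \<otimes>\<^bsub>E\<^esub> \<theta> A B f \<otimes>\<^bsub>E\<^esub> v A"
  unfolding Fm_def using assms
  by (intro D.\<theta>_inv; simp add: F C.\<theta>_mem C.E.m_assoc uv_assoc v_norm)+

lemma Fm_idn: "A \<in> Ob C \<Longrightarrow> Fm A A (Idn C A) = Idn D (F A)"
  by (rule D.\<theta>_inj[of "F A" "F A"]) (simp_all add: F Fm C.idn D.idn C.\<theta>_idn D.\<theta>_idn C.E.m_assoc uv v_norm)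

lemma Fm_cmp:
  assumes "A \<in> Ob C" "B \<in> Ob C" "X \<in> Ob C" "f \<in> carrier (Hom C A B)" "g \<in> carrier (Hom C B X)"
  shows "Fm A X (Cmp C A B X g f) = Cmp D (F A) (F B) (F X) (Fm B X g) (Fm A B f)"
  by (rule D.\<theta>_inj[of "F A" "F X"])
    (use assms in \<open>simp_all add: F Fm C.cmp_closed D.cmp_closed C.\<theta>_cmp D.\<theta>_cmp C.E.m_assoc uv_assoc C.\<theta>_mem \<theta>_assoc\<close>)

lemma Fm_add:
  assumes "A \<in> Ob C" "B \<in> Ob C" "f \<in> carrier (Hom C A B)" "g \<in> carrier (Hom C A B)"
  shows "Fm A B (f \<otimes>\<^bsub>Hom C A B\<^esub> g) = Fm A B f \<otimes>\<^bsub>Hom D (F A) (F B)\<^esub> Fm A B g"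
proof -
  interpret G: comm_group "Hom C A B" using assms by (intro C.hom_group)
  interpret G': comm_group "Hom D (F A) (F B)" using assms by (intro D.hom_group F)
  show ?thesis
    by (rule D.\<theta>_inj[of "F A" "F B"])
      (use assms in \<open>simp_all add: F Fm C.\<theta>_add D.\<theta>_add C.\<theta>_mem C.E.r_distr C.E.l_distr\<close>)
qed

text \<open>A short exact sequence comes with maps \<open>r\<close> and \<open>s\<close> that
  satisfy equations in composites, sums and identities, and \<open>Fm\<close> respects all
  three.\<close>

lemma exact_functor: "exact_functor C D F Fm"
proof (intro exact_functor.intro exact_functor_axioms.intro)
  show "preadditive_category C" "preadditive_category D"
    by (rule C.preadditive_category_axioms D.preadditive_category_axioms)+
next
  fix A i B p X assume "Confl C A i B p X"
  then obtain r s where *: "A \<in> Ob C" "B \<in> Ob C" "X \<in> Ob C"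
    "i \<in> carrier (Hom C A B)" "p \<in> carrier (Hom C B X)"
    "r \<in> carrier (Hom C B A)" "s \<in> carrier (Hom C X B)"
    and eq: "Cmp C A B A r i = Idn C A" "Cmp C X B X p s = Idn C X"
    "Cmp C B A B i r \<otimes>\<^bsub>Hom C B B\<^esub> Cmp C B X B s p = Idn C B"
    unfolding C.confl_iff by blast
  show "Confl D (F A) (Fm A B i) (F B) (Fm B X p) (F X)"
    unfolding D.confl_iff
  proof (intro conjI bexI)
    show "Cmp D (F A) (F B) (F A) (Fm B A r) (Fm A B i) = Idn D (F A)"
      using * eq by (simp add: Fm_cmp[symmetric] Fm_idn)
    show "Cmp D (F X) (F B) (F X) (Fm B X p) (Fm X B s) = Idn D (F X)"
      using * eq by (simp add: Fm_cmp[symmetric] Fm_idn)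
    have "Cmp C B A B i r \<in> carrier (Hom C B B)" "Cmp C B X B s p \<in> carrier (Hom C B B)"
      using * by (auto intro: C.cmp_closed)
    then show "Cmp D (F B) (F A) (F B) (Fm A B i) (Fm B A r) \<otimes>\<^bsub>Hom D (F B) (F B)\<^esub>
        Cmp D (F B) (F X) (F B) (Fm X B s) (Fm B X p) = Idn D (F B)"
      using * eq by (simp add: Fm_cmp[symmetric] Fm_add[symmetric] Fm_idn)
  qed (use * in \<open>auto intro: F Fm\<close>)
qed (auto simp: F Fm Fm_idn Fm_cmp Fm_add hom_def)

end

text \<open>Conjugating twice is conjugation by the product, so the natural isomorphism is
  \<open>u' (F A) u A\<close>, with inverse \<open>v A v' (F A)\<close>. Naturality holds since the
  inner factors cancel down to \<open>e A\<close>, which the elements of the corner absorb.\<close>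

lemma naturally_isomorphic_to_identity_two_presentations:
  assumes F: "two_presentations C D E e \<theta> e' \<theta>' F u v"
    and G: "two_presentations D C E e' \<theta>' e \<theta> G u' v'"
  shows "naturally_isomorphic_to_identity C (\<lambda>A. G (F A))
    (\<lambda>A B f. two_presentations.Fm C E \<theta>' \<theta> G u' v' (F A) (F B) (two_presentations.Fm D E \<theta> \<theta>' F u v A B f))"
proof -
  interpret F: two_presentations C D E e \<theta> e' \<theta>' F u v by fact
  interpret G: two_presentations D C E e' \<theta>' e \<theta> G u' v' by fact
  note [simp] = F.F G.F F.u_norm F.v_norm G.u_norm G.v_norm F.uv G.uv F.uv_assoc G.uv_assoc F.C.E.m_assoc
    F.C.\<theta>_mem F.\<theta>_assoc
  define \<eta> where "\<eta> A = F.C.\<theta>_inv A (G (F A)) (u' (F A) \<otimes>\<^bsub>E\<^esub> u A)" for A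
  define \<zeta> where "\<zeta> A = F.C.\<theta>_inv (G (F A)) A (v A \<otimes>\<^bsub>E\<^esub> v' (F A))" for A
  have \<eta>: "\<eta> A \<in> carrier (Hom C A (G (F A)))" "\<theta> A (G (F A)) (\<eta> A) = u' (F A) \<otimes>\<^bsub>E\<^esub> u A"
    if "A \<in> Ob C" for A
    unfolding \<eta>_def using that by (intro F.C.\<theta>_inv; simp)+
  have \<zeta>: "\<zeta> A \<in> carrier (Hom C (G (F A)) A)" "\<theta> (G (F A)) A (\<zeta> A) = v A \<otimes>\<^bsub>E\<^esub> v' (F A)"
    if "A \<in> Ob C" for A
    unfolding \<zeta>_def using that by (intro F.C.\<theta>_inv; simp)+
  show ?thesis unfolding naturally_isomorphic_to_identity_def isomorphism_def
  proof (intro exI[of _ \<eta>] conjI ballI)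
    fix A assume A: "A \<in> Ob C"
    show "\<eta> A \<in> carrier (Hom C A (G (F A)))" using A by (rule \<eta>)
    have "Cmp C A (G (F A)) A (\<zeta> A) (\<eta> A) = Idn C A"
      by (rule F.C.\<theta>_inj[of A A]) (use A in \<open>simp_all add: \<eta> \<zeta> F.C.cmp_closed F.C.idn F.C.\<theta>_cmp F.C.\<theta>_idn\<close>)
    moreover have "Cmp C (G (F A)) A (G (F A)) (\<eta> A) (\<zeta> A) = Idn C (G (F A))"
      by (rule F.C.\<theta>_inj[of "G (F A)" "G (F A)"])
        (use A in \<open>simp_all add: \<eta> \<zeta> F.C.cmp_closed F.C.idn F.C.\<theta>_cmp F.C.\<theta>_idn\<close>)
    ultimately show "\<exists>g\<in>carrier (Hom C (G (F A)) A). Cmp C A (G (F A)) A g (\<eta> A) = Idn C A \<and>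
        Cmp C (G (F A)) A (G (F A)) (\<eta> A) g = Idn C (G (F A))"
      using \<zeta>[OF A] by blast
    fix B f assume B: "B \<in> Ob C" and f: "f \<in> carrier (Hom C A B)"
    show "Cmp C A B (G (F B)) (\<eta> B) f = Cmp C A (G (F A)) (G (F B)) (G.Fm (F A) (F B) (F.Fm A B f)) (\<eta> A)"
      by (rule F.C.\<theta>_inj[of A "G (F B)"])
        (use A B f in \<open>simp_all add: \<eta> F.C.cmp_closed F.Fm G.Fm F.C.\<theta>_cmp\<close>)
  qed
qed

text \<open>\<open>realised\<close> for \<open>D\<close> is applied to the idempotent
  \<open>e A\<close>, and the equivalence found is normalised. The objects \<open>F A\<close> are
  mere choices.\<close>

lemma ex_two_presentations:
  assumes "idempotent_presentation C E e \<theta>" "idempotent_presentation D E e' \<theta>'"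
  shows "\<exists>F u v. two_presentations C D E e \<theta> e' \<theta>' F u v"
proof -
  interpret C: idempotent_presentation C E e \<theta> by fact
  interpret D: idempotent_presentation D E e' \<theta>' by fact
  let ?P = "\<lambda>A X u v. X \<in> Ob D \<and> u \<in> carrier E \<and> v \<in> carrier E \<and> u \<otimes>\<^bsub>E\<^esub> v = e' X \<and> v \<otimes>\<^bsub>E\<^esub> u = e A \<and>
      e' X \<otimes>\<^bsub>E\<^esub> u = u \<and> u \<otimes>\<^bsub>E\<^esub> e A = u \<and> e A \<otimes>\<^bsub>E\<^esub> v = v \<and> v \<otimes>\<^bsub>E\<^esub> e' X = v"
  have "\<exists>X u v. ?P A X u v" if A: "A \<in> Ob C" for A
  proof -
    obtain X u v where X: "X \<in> Ob D" and uv: "u \<in> carrier E" "v \<in> carrier E" "u \<otimes>\<^bsub>E\<^esub> v = e' X" "v \<otimes>\<^bsub>E\<^esub> u = e A"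
      using D.realised[of "e A"] A by auto
    obtain u' v' where "?P A X u' v'"
      using C.E.equivalent_idempotents_normalised[OF uv(1,2,3) _ uv(4)] X A by (metis C.e_idem D.e_idem)
    then show ?thesis by blast
  qed
  then obtain F u v where "\<And>A. A \<in> Ob C \<Longrightarrow> ?P A (F A) (u A) (v A)" by metis
  then have "two_presentations C D E e \<theta> e' \<theta>' F u v" by unfold_locales auto
  then show ?thesis by blast
qed

text \<open>\<open>F\<close> and \<open>G\<close> are chosen independently of each other. They are
  still inverse up to isomorphism, because a composite of two such functors is again a conjugation
  inside \<open>E\<close>.\<close>

theorem exact_equivalence_presentations:
  assumes "idempotent_presentation C E e \<theta>" "idempotent_presentation D E e' \<theta>'"
  shows "\<exists>Fo Fm. exact_equivalence C D Fo Fm"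
proof -
  obtain F u v where F: "two_presentations C D E e \<theta> e' \<theta>' F u v"
    using ex_two_presentations[OF assms] by blast
  obtain G u' v' where G: "two_presentations D C E e' \<theta>' e \<theta> G u' v'"
    using ex_two_presentations[OF assms(2,1)] by blast
  have "exact_equivalence C D F (two_presentations.Fm D E \<theta> \<theta>' F u v)"
    unfolding exact_equivalence_def
    using two_presentations.exact_functor[OF F] two_presentations.exact_functor[OF G]
      naturally_isomorphic_to_identity_two_presentations[OF F G]
      naturally_isomorphic_to_identity_two_presentations[OF G F]
    by blast
  then show ?thesis by blast
qed


section \<open>Right modules\<close>

lemma mk_module_simps [simp]:
  "carrier (mk_module C z p s) = C" "zero (mk_module C z p s) = z"
  "add (mk_module C z p s) = p" "smult (mk_module C z p s) = s"
  by (simp_all add: mk_module_def)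

lemma linear_mapsD:
  assumes "f \<in> linear_maps E M N"
  shows "x \<in> carrier M \<Longrightarrow> f x \<in> carrier N"
    and "\<lbrakk>x \<in> carrier M; y \<in> carrier M\<rbrakk> \<Longrightarrow> f (x \<oplus>\<^bsub>M\<^esub> y) = f x \<oplus>\<^bsub>N\<^esub> f y"
    and "\<lbrakk>a \<in> carrier E; x \<in> carrier M\<rbrakk> \<Longrightarrow> f (a \<odot>\<^bsub>M\<^esub> x) = a \<odot>\<^bsub>N\<^esub> f x"
    and "f \<in> extensional (carrier M)" "f \<in> carrier M \<rightarrow>\<^sub>E carrier N"
  using assms by (auto simp: linear_maps_def PiE_def)

lemma linear_maps_eqI:
  assumes "f \<in> linear_maps E M N" "g \<in> linear_maps E M N'" "\<And>x. x \<in> carrier M \<Longrightarrow> f x = g x"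
  shows "f = g"
  using assms by (intro extensionalityI[of f "carrier M" g]) (auto dest: linear_mapsD)

lemma abelian_group_idem_zero: "abelian_group M \<Longrightarrow> x \<in> carrier M \<Longrightarrow> x \<oplus>\<^bsub>M\<^esub> x = x \<Longrightarrow> x = \<zero>\<^bsub>M\<^esub>"
proof -
  assume "abelian_group M" then interpret abelian_group M .
  assume "x \<in> carrier M" "x \<oplus>\<^bsub>M\<^esub> x = x"
  then show ?thesis using add.l_cancel_one' by metis
qed

context right_module
begin

lemma smult_zero_right: "a \<in> carrier E \<Longrightarrow> a \<odot>\<^bsub>M\<^esub> \<zero>\<^bsub>M\<^esub> = \<zero>\<^bsub>M\<^esub>"
  by (rule abelian_group_idem_zero) (simp_all add: closed M.abelian_group_axioms r_distr[symmetric])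

lemma smult_zero_left: "x \<in> carrier M \<Longrightarrow> \<zero>\<^bsub>E\<^esub> \<odot>\<^bsub>M\<^esub> x = \<zero>\<^bsub>M\<^esub>"
  by (rule abelian_group_idem_zero) (simp_all add: closed M.abelian_group_axioms l_distr[symmetric])

lemma smult_minus: "a \<in> carrier E \<Longrightarrow> x \<in> carrier M \<Longrightarrow> a \<odot>\<^bsub>M\<^esub> (\<ominus>\<^bsub>M\<^esub> x) = \<ominus>\<^bsub>M\<^esub> (a \<odot>\<^bsub>M\<^esub> x)"
  by (rule M.minus_equality[symmetric]) (simp_all add: closed r_distr[symmetric] M.l_neg smult_zero_right)

lemma restrict_linear:
  assumes "\<And>x. x \<in> carrier M \<Longrightarrow> g x \<in> carrier N"
    "\<And>x y. \<lbrakk>x \<in> carrier M; y \<in> carrier M\<rbrakk> \<Longrightarrow> g (x \<oplus>\<^bsub>M\<^esub> y) = g x \<oplus>\<^bsub>N\<^esub> g y"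
    "\<And>a x. \<lbrakk>a \<in> carrier E; x \<in> carrier M\<rbrakk> \<Longrightarrow> g (a \<odot>\<^bsub>M\<^esub> x) = a \<odot>\<^bsub>N\<^esub> g x"
  shows "(\<lambda>x\<in>carrier M. g x) \<in> linear_maps E M N"
  using assms by (auto simp: linear_maps_def closed)

lemma id_linear: "(\<lambda>x\<in>carrier M. x) \<in> linear_maps E M M"
  by (rule restrict_linear) auto

lemma compose_linear:
  assumes "f \<in> linear_maps E M N" "g \<in> linear_maps E N K"
  shows "compose (carrier M) g f \<in> linear_maps E M K"
  unfolding compose_def
  by (rule restrict_linear) (simp_all add: linear_mapsD[OF assms(1)] linear_mapsD[OF assms(2)])

lemma submodule_right_module:
  assumes "submodule H E M"
  shows "right_module E (M\<lparr>carrier := H\<rparr>)"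
proof -
  interpret H: submodule H E M by fact
  have sub: "x \<in> carrier M" if "x \<in> H" for x using H.subset that by auto
  have neg: "\<exists>y\<in>H. y \<oplus>\<^bsub>M\<^esub> x = \<zero>\<^bsub>M\<^esub>" if "x \<in> H" for x
    using H.m_inv_closed[OF that] M.l_neg[OF sub[OF that]] by (auto simp: a_inv_def)
  have "abelian_group (M\<lparr>carrier := H\<rparr>)"
  proof (rule abelian_groupI)
    fix x assume "x \<in> carrier (M\<lparr>carrier := H\<rparr>)"
    then show "\<exists>y\<in>carrier (M\<lparr>carrier := H\<rparr>). y \<oplus>\<^bsub>M\<lparr>carrier := H\<rparr>\<^esub> x = \<zero>\<^bsub>M\<lparr>carrier := H\<rparr>\<^esub>"
      using neg[of x] by simp
  qed (use H.m_closed H.one_closed in \<open>simp_all add: sub M.a_ac\<close>)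
  then show ?thesis
    by (intro right_module.intro right_module_axioms.intro E.ring_axioms)
      (auto simp: sub l_distr r_distr assoc one)
qed

text \<open>Closure under negatives follows from closure under the scalar -1.\<close>

lemma submoduleI':
  assumes "H \<subseteq> carrier M" "\<zero>\<^bsub>M\<^esub> \<in> H" "\<And>x y. \<lbrakk>x \<in> H; y \<in> H\<rbrakk> \<Longrightarrow> x \<oplus>\<^bsub>M\<^esub> y \<in> H"
    "\<And>a x. \<lbrakk>a \<in> carrier E; x \<in> H\<rbrakk> \<Longrightarrow> a \<odot>\<^bsub>M\<^esub> x \<in> H"
  shows "submodule H E M"
proof (intro submodule.intro submodule_axioms.intro subgroup.intro)
  fix x assume x: "x \<in> H"
  then have X: "x \<in> carrier M" using assms(1) by auto
  have "(\<ominus>\<^bsub>E\<^esub> \<one>\<^bsub>E\<^esub>) \<odot>\<^bsub>M\<^esub> x \<oplus>\<^bsub>M\<^esub> x = \<zero>\<^bsub>M\<^esub>"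
    using l_distr[of "\<ominus>\<^bsub>E\<^esub> \<one>\<^bsub>E\<^esub>" "\<one>\<^bsub>E\<^esub>" x] X by (simp add: one E.l_neg smult_zero_left)
  then have "\<ominus>\<^bsub>M\<^esub> x = (\<ominus>\<^bsub>E\<^esub> \<one>\<^bsub>E\<^esub>) \<odot>\<^bsub>M\<^esub> x" using X by (intro M.minus_equality) (auto simp: closed)
  then show "inv\<^bsub>add_monoid M\<^esub> x \<in> H" using assms(4)[OF _ x, of "\<ominus>\<^bsub>E\<^esub> \<one>\<^bsub>E\<^esub>"] by (simp add: a_inv_def)
qed (use assms in auto)

lemma submodule_finsum:
  assumes "submodule H E M" "finite A" "\<And>i. i \<in> A \<Longrightarrow> f i \<in> H"
  shows "finsum M f A \<in> H"
proof -
  interpret H: submodule H E M by fact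
  have sub: "x \<in> carrier M" if "x \<in> H" for x using H.subset that by auto
  show ?thesis using assms(2,3)
  proof (induction A rule: finite_induct)
    case empty then show ?case using H.one_closed by simp
  next
    case (insert i A)
    then show ?case using H.m_closed by (subst M.finsum_insert) (auto intro: sub)
  qed
qed

lemma submodule_generated_in: "submodule H E M \<Longrightarrow> S \<subseteq> H \<Longrightarrow> submodule_generated E M S \<subseteq> H"
  by (auto simp: submodule_generated_def)

lemma submodule_carrier: "submodule (carrier M) E M"
  by (rule submoduleI') (auto simp: closed)

end

lemma linear_map_zero:
  assumes "right_module E M" "right_module E N" "f \<in> linear_maps E M N"
  shows "f \<zero>\<^bsub>M\<^esub> = \<zero>\<^bsub>N\<^esub>"
proof -
  interpret M: right_module E M by fact
  interpret N: right_module E N by fact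
  show ?thesis
    using M.smult_zero_left[of "\<zero>\<^bsub>M\<^esub>"] N.smult_zero_left[of "f \<zero>\<^bsub>M\<^esub>"]
      linear_mapsD(3)[OF assms(3), of "\<zero>\<^bsub>E\<^esub>" "\<zero>\<^bsub>M\<^esub>"] linear_mapsD(1)[OF assms(3), of "\<zero>\<^bsub>M\<^esub>"] by simp
qed

lemma linear_map_neg:
  assumes "right_module E M" "right_module E N" "f \<in> linear_maps E M N" "x \<in> carrier M"
  shows "f (\<ominus>\<^bsub>M\<^esub> x) = \<ominus>\<^bsub>N\<^esub> f x"
proof -
  interpret M: right_module E M by fact
  interpret N: right_module E N by fact
  show ?thesis using assms(4) linear_mapsD(2)[OF assms(3), of "\<ominus>\<^bsub>M\<^esub> x" x]
    by (intro N.minus_equality[symmetric])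
      (auto simp: linear_mapsD(1)[OF assms(3)] M.l_neg linear_map_zero[OF assms(1-3)])
qed

lemma linear_map_finsum:
  assumes "right_module E M" "right_module E N" "f \<in> linear_maps E M N"
    and "finite A" "\<And>i. i \<in> A \<Longrightarrow> g i \<in> carrier M"
  shows "f (finsum M g A) = finsum N (\<lambda>i. f (g i)) A"
proof -
  interpret M: right_module E M by fact
  interpret N: right_module E N by fact
  show ?thesis using assms(4,5)
    by (induction A rule: finite_induct)
      (simp_all add: linear_map_zero[OF assms(1-3)] linear_mapsD[OF assms(3)] Pi_def)
qed

lemma submodule_image:
  assumes M: "right_module E M" and N: "right_module E N" and f: "f \<in> linear_maps E M N" and H: "submodule H E M"
  shows "submodule (f ` H) E N"
proof -
  interpret M: right_module E M by (rule M)
  interpret N: right_module E N by (rule N)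
  interpret H: submodule H E M by (rule H)
  have sub: "x \<in> carrier M" if "x \<in> H" for x using H.subset that by auto
  show ?thesis
  proof (rule N.submoduleI')
    show "\<zero>\<^bsub>N\<^esub> \<in> f ` H" using H.one_closed linear_map_zero[OF M N f] by (intro image_eqI[of _ _ "\<zero>\<^bsub>M\<^esub>"]) auto
  next
    fix x y assume "x \<in> f ` H" "y \<in> f ` H"
    then obtain u v where "u \<in> H" "v \<in> H" "x = f u" "y = f v" by blast
    then show "x \<oplus>\<^bsub>N\<^esub> y \<in> f ` H" using H.m_closed[of u v]
      by (intro image_eqI[of _ _ "u \<oplus>\<^bsub>M\<^esub> v"]) (auto simp: linear_mapsD(2)[OF f] sub)
  next
    fix a x assume a: "a \<in> carrier E" and "x \<in> f ` H"
    then obtain u where "u \<in> H" "x = f u" by blast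
    then show "a \<odot>\<^bsub>N\<^esub> x \<in> f ` H" using H.smult_closed[OF a, of u] a
      by (intro image_eqI[of _ _ "a \<odot>\<^bsub>M\<^esub> u"]) (auto simp: linear_mapsD(3)[OF f] sub)
  qed (use sub linear_mapsD(1)[OF f] in auto)
qed

lemma linear_map_inverse:
  assumes "right_module E M" "right_module E N" "f \<in> linear_maps E M N" "bij_betw f (carrier M) (carrier N)"
  obtains g where "g \<in> linear_maps E N M" "\<And>x. x \<in> carrier M \<Longrightarrow> g (f x) = x"
    "\<And>y. y \<in> carrier N \<Longrightarrow> f (g y) = y"
proof -
  interpret M: right_module E M by fact
  interpret N: right_module E N by fact
  let ?h = "inv_into (carrier M) f"
  have h: "?h y \<in> carrier M" "f (?h y) = y" if "y \<in> carrier N" for y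
    using assms(4) that by (auto simp: bij_betw_def inv_into_into f_inv_into_f)
  have eq: "?h y = x" if "x \<in> carrier M" "f x = y" for x y
    using assms(4) that by (auto simp: bij_betw_def inv_into_f_f)
  note f = linear_mapsD[OF assms(3)]
  have "(\<lambda>y\<in>carrier N. ?h y) \<in> linear_maps E N M"
    by (rule N.restrict_linear) (auto simp: h f intro!: eq M.closed)
  then show ?thesis by (rule that) (auto simp: h f intro!: eq)
qed

lemma modules_isomorphicI:
  assumes "f \<in> linear_maps E M N" "g \<in> linear_maps E N M"
    "\<And>x. x \<in> carrier M \<Longrightarrow> g (f x) = x" "\<And>y. y \<in> carrier N \<Longrightarrow> f (g y) = y"
  shows "modules_isomorphic E M N"
  unfolding modules_isomorphic_def
  by (rule bexI[OF _ assms(1)], rule bij_betw_byWitness[where f' = g])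
    (use assms(3,4) linear_mapsD(1)[OF assms(1)] linear_mapsD(1)[OF assms(2)] in auto)

lemma dsum_simps [simp]:
  "carrier (dsum M N) = carrier M \<times> carrier N" "zero (dsum M N) = (\<zero>\<^bsub>M\<^esub>, \<zero>\<^bsub>N\<^esub>)"
  "add (dsum M N) = (\<lambda>u v. (fst u \<oplus>\<^bsub>M\<^esub> fst v, snd u \<oplus>\<^bsub>N\<^esub> snd v))"
  "smult (dsum M N) = (\<lambda>a u. (a \<odot>\<^bsub>M\<^esub> fst u, a \<odot>\<^bsub>N\<^esub> snd u))"
  by (simp_all add: dsum_def)

lemma right_module_dsum:
  assumes "right_module E M" "right_module E N"
  shows "right_module E (dsum M N)"
proof -
  interpret M: right_module E M by fact
  interpret N: right_module E N by fact
  have "abelian_group (dsum M N)"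
  proof (rule abelian_groupI)
    fix x assume "x \<in> carrier (dsum M N)"
    then show "\<exists>y\<in>carrier (dsum M N). y \<oplus>\<^bsub>dsum M N\<^esub> x = \<zero>\<^bsub>dsum M N\<^esub>"
      by (intro bexI[of _ "(\<ominus>\<^bsub>M\<^esub> fst x, \<ominus>\<^bsub>N\<^esub> snd x)"]) (auto simp: M.M.l_neg N.M.l_neg)
  qed (auto simp: M.M.a_ac N.M.a_ac)
  then show ?thesis
    by (intro right_module.intro right_module_axioms.intro M.E.ring_axioms)
      (auto simp: M.closed N.closed M.l_distr N.l_distr M.r_distr N.r_distr M.assoc N.assoc M.one N.one)
qed


section \<open>Free modules and linear combinations\<close>

definition regular_module :: "('a, 'x) ring_scheme \<Rightarrow> ('a, 'a) module" where
  "regular_module E = mk_module (carrier E) \<zero>\<^bsub>E\<^esub> (add E) (\<lambda>a x. x \<otimes>\<^bsub>E\<^esub> a)"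

lemma regular_module_simps [simp]:
  "carrier (regular_module E) = carrier E" "zero (regular_module E) = \<zero>\<^bsub>E\<^esub>"
  "add (regular_module E) = add E" "smult (regular_module E) = (\<lambda>a x. x \<otimes>\<^bsub>E\<^esub> a)"
  by (simp_all add: regular_module_def)

lemma free_right_module_simps [simp]:
  "carrier (free_right_module E I) = {f \<in> I \<rightarrow>\<^sub>E carrier E. finite {i \<in> I. f i \<noteq> \<zero>\<^bsub>E\<^esub>}}"
  "zero (free_right_module E I) = (\<lambda>i\<in>I. \<zero>\<^bsub>E\<^esub>)"
  "add (free_right_module E I) = (\<lambda>f g. \<lambda>i\<in>I. f i \<oplus>\<^bsub>E\<^esub> g i)"
  "smult (free_right_module E I) = (\<lambda>a f. \<lambda>i\<in>I. f i \<otimes>\<^bsub>E\<^esub> a)"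
  by (simp_all add: free_right_module_def)

definition unit_vector :: "('a, 'x) ring_scheme \<Rightarrow> 'i set \<Rightarrow> 'i \<Rightarrow> 'i \<Rightarrow> 'a" where
  "unit_vector E I i = (\<lambda>j\<in>I. if i = j then \<one>\<^bsub>E\<^esub> else \<zero>\<^bsub>E\<^esub>)"

text \<open>The sum runs over the support of \<open>f\<close>, so that \<open>I\<close> may be
  infinite. Over an infinite set \<open>finsum\<close> is zero by convention.\<close>

definition lincomb ::
  "('a, 'x) ring_scheme \<Rightarrow> ('a, 'm, 'y) module_scheme \<Rightarrow> ('i \<Rightarrow> 'm) \<Rightarrow> 'i set \<Rightarrow> ('i \<Rightarrow> 'a) \<Rightarrow> 'm" where
  "lincomb E M m I f = finsum M (\<lambda>i. f i \<odot>\<^bsub>M\<^esub> m i) {i \<in> I. f i \<noteq> \<zero>\<^bsub>E\<^esub>}"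

context ring
begin

lemma right_module_regular: "right_module R (regular_module R)"
proof -
  have "abelian_group (regular_module R)"
    by (rule abelian_groupI) (auto simp: a_ac intro: bexI[of _ "\<ominus> _"] l_neg)
  then show ?thesis
    by (intro right_module.intro right_module_axioms.intro ring_axioms) (auto simp: l_distr r_distr m_assoc)
qed

lemma finite_support_add:
  assumes "finite {i \<in> I. f i \<noteq> \<zero>}" "finite {i \<in> I. g i \<noteq> \<zero>}"
  shows "finite {i \<in> I. f i \<oplus> g i \<noteq> \<zero>}"
  by (rule finite_subset[OF _ finite_UnI[OF assms]]) auto

lemma right_module_free: "right_module R (free_right_module R I)"
proof -
  let ?F = "free_right_module R I"
  have "abelian_group ?F"
  proof (rule abelian_groupI)
    fix f assume f: "f \<in> carrier ?F"
    have "finite {i \<in> I. \<ominus> f i \<noteq> \<zero>}"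
      by (rule finite_subset[of _ "{i \<in> I. f i \<noteq> \<zero>}"]) (use f in auto)
    moreover have "(\<lambda>i\<in>I. \<ominus> f i \<oplus> f i) = (\<lambda>i\<in>I. \<zero>)"
      using f by (intro restrict_ext l_neg) auto
    ultimately show "\<exists>y\<in>carrier ?F. y \<oplus>\<^bsub>?F\<^esub> f = \<zero>\<^bsub>?F\<^esub>"
      using f by (intro bexI[of _ "\<lambda>i\<in>I. \<ominus> f i"]) (auto cong: restrict_cong conj_cong)
    show "\<zero>\<^bsub>?F\<^esub> \<oplus>\<^bsub>?F\<^esub> f = f"
      using f by (auto simp: fun_eq_iff PiE_iff extensional_def)
    fix g assume g: "g \<in> carrier ?F"
    show "f \<oplus>\<^bsub>?F\<^esub> g \<in> carrier ?F"
      using finite_support_add[of I f g] f g by (auto cong: conj_cong)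
    show "f \<oplus>\<^bsub>?F\<^esub> g = g \<oplus>\<^bsub>?F\<^esub> f" using f g by (auto simp: fun_eq_iff PiE_iff a_comm)
    fix h assume h: "h \<in> carrier ?F"
    show "(f \<oplus>\<^bsub>?F\<^esub> g) \<oplus>\<^bsub>?F\<^esub> h = f \<oplus>\<^bsub>?F\<^esub> (g \<oplus>\<^bsub>?F\<^esub> h)"
      using f g h by (auto simp: fun_eq_iff PiE_iff a_assoc)
  qed (auto cong: conj_cong)
  then show ?thesis
  proof (intro right_module.intro right_module_axioms.intro ring_axioms)
    fix a f assume a: "a \<in> carrier R" and f: "f \<in> carrier ?F"
    have "finite {i \<in> I. f i \<otimes> a \<noteq> \<zero>}"
      by (rule finite_subset[of _ "{i \<in> I. f i \<noteq> \<zero>}"]) (use a f in auto)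
    then show "a \<odot>\<^bsub>?F\<^esub> f \<in> carrier ?F" using a f by (auto cong: conj_cong)
  qed (auto simp: fun_eq_iff PiE_iff extensional_def l_distr r_distr m_assoc)
qed

lemma unit_vector_closed: "unit_vector R I i \<in> carrier (free_right_module R I)"
proof -
  have "finite {j \<in> I. unit_vector R I i j \<noteq> \<zero>}"
    by (rule finite_subset[of _ "{i}"]) (auto simp: unit_vector_def)
  then show ?thesis by (auto simp: unit_vector_def)
qed

lemma free_eval_linear: "i \<in> I \<Longrightarrow>
  (\<lambda>f\<in>carrier (free_right_module R I). f i) \<in> linear_maps R (free_right_module R I) (regular_module R)"
  by (rule right_module.restrict_linear[OF right_module_free]) auto

end

context right_module
begin

text \<open>Terms outside the support vanish, so any finite set above the support gives the same
  sum. This allows combinations with different supports to be compared.\<close>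

lemma lincomb_eq:
  assumes "m \<in> I \<rightarrow> carrier M" "f \<in> I \<rightarrow> carrier E" "finite T" "{i \<in> I. f i \<noteq> \<zero>\<^bsub>E\<^esub>} \<subseteq> T" "T \<subseteq> I"
  shows "lincomb E M m I f = finsum M (\<lambda>i. f i \<odot>\<^bsub>M\<^esub> m i) T"
  unfolding lincomb_def
proof (rule M.add.finprod_mono_neutral_cong_left[OF assms(3,4)])
  fix i assume i: "i \<in> T - {i \<in> I. f i \<noteq> \<zero>\<^bsub>E\<^esub>}"
  then have "m i \<in> carrier M" "f i = \<zero>\<^bsub>E\<^esub>" using assms by auto
  then show "f i \<odot>\<^bsub>M\<^esub> m i = \<zero>\<^bsub>M\<^esub>" by (simp add: smult_zero_left)
qed (use assms in \<open>auto intro!: closed\<close>)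

lemma lincomb_closed:
  "\<lbrakk>m \<in> I \<rightarrow> carrier M; f \<in> I \<rightarrow> carrier E\<rbrakk> \<Longrightarrow> lincomb E M m I f \<in> carrier M"
  unfolding lincomb_def by (rule M.finsum_closed) (auto intro!: closed)

lemma finsum_smult:
  assumes "finite A" "a \<in> carrier E" "\<And>i. i \<in> A \<Longrightarrow> g i \<in> carrier M"
  shows "a \<odot>\<^bsub>M\<^esub> finsum M g A = finsum M (\<lambda>i. a \<odot>\<^bsub>M\<^esub> g i) A"
  using assms(1,3) by (induction A rule: finite_induct) (simp_all add: smult_zero_right assms(2) Pi_def closed r_distr)

lemma lincomb_linear:
  assumes m: "m \<in> I \<rightarrow> carrier M"
  shows "(\<lambda>f\<in>carrier (free_right_module E I). lincomb E M m I f) \<in> linear_maps E (free_right_module E I) M"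
proof (rule right_module.restrict_linear[OF E.right_module_free])
  let ?F = "free_right_module E I"
  fix f assume f: "f \<in> carrier ?F"
  let ?S = "\<lambda>f. {i \<in> I. f i \<noteq> \<zero>\<^bsub>E\<^esub>}"
  show "lincomb E M m I f \<in> carrier M" using f m by (auto intro!: lincomb_closed)
  show "lincomb E M m I (a \<odot>\<^bsub>?F\<^esub> f) = a \<odot>\<^bsub>M\<^esub> lincomb E M m I f" if a: "a \<in> carrier E" for a
  proof -
    have "lincomb E M m I (a \<odot>\<^bsub>?F\<^esub> f) = finsum M (\<lambda>i. (a \<odot>\<^bsub>?F\<^esub> f) i \<odot>\<^bsub>M\<^esub> m i) (?S f)"
      by (rule lincomb_eq) (use a f m in auto)
    also have "\<dots> = finsum M (\<lambda>i. a \<odot>\<^bsub>M\<^esub> (f i \<odot>\<^bsub>M\<^esub> m i)) (?S f)"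
      by (rule M.finsum_cong') (use a f m in \<open>auto simp: assoc PiE_iff Pi_iff intro!: closed\<close>)
    also have "\<dots> = a \<odot>\<^bsub>M\<^esub> lincomb E M m I f"
      unfolding lincomb_def by (rule finsum_smult[symmetric]) (use a f m in \<open>auto intro!: closed\<close>)
    finally show ?thesis .
  qed
  fix g assume g: "g \<in> carrier ?F"
  \<comment> \<open>One index set for all three sums; the support of the sum of \<open>f\<close> and
    \<open>g\<close> may be smaller, since coefficients can cancel.\<close>
  let ?T = "?S f \<union> ?S g"
  have T: "finite ?T" "?T \<subseteq> I" using f g by auto
  have fg: "f \<in> I \<rightarrow> carrier E" "g \<in> I \<rightarrow> carrier E" using f g by auto
  have "lincomb E M m I (f \<oplus>\<^bsub>?F\<^esub> g) = finsum M (\<lambda>i. (f \<oplus>\<^bsub>?F\<^esub> g) i \<odot>\<^bsub>M\<^esub> m i) ?T"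
    by (rule lincomb_eq) (use f g m T in auto)
  also have "\<dots> = finsum M (\<lambda>i. f i \<odot>\<^bsub>M\<^esub> m i \<oplus>\<^bsub>M\<^esub> g i \<odot>\<^bsub>M\<^esub> m i) ?T"
    by (rule M.finsum_cong') (use fg m in \<open>auto simp: l_distr Pi_iff closed\<close>)
  also have "\<dots> = finsum M (\<lambda>i. f i \<odot>\<^bsub>M\<^esub> m i) ?T \<oplus>\<^bsub>M\<^esub> finsum M (\<lambda>i. g i \<odot>\<^bsub>M\<^esub> m i) ?T"
    by (rule M.finsum_addf) (use fg m in \<open>auto simp: Pi_iff closed\<close>)
  also have "finsum M (\<lambda>i. f i \<odot>\<^bsub>M\<^esub> m i) ?T = lincomb E M m I f"
    by (rule lincomb_eq[symmetric]) (use fg m T in auto)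
  also have "finsum M (\<lambda>i. g i \<odot>\<^bsub>M\<^esub> m i) ?T = lincomb E M m I g"
    by (rule lincomb_eq[symmetric]) (use fg m T in auto)
  finally show "lincomb E M m I (f \<oplus>\<^bsub>?F\<^esub> g) = lincomb E M m I f \<oplus>\<^bsub>M\<^esub> lincomb E M m I g" .
qed

lemma lincomb_single:
  assumes "m \<in> I \<rightarrow> carrier M" "f \<in> I \<rightarrow> carrier E" "i \<in> I" "\<And>j. j \<in> I \<Longrightarrow> j \<noteq> i \<Longrightarrow> f j \<odot>\<^bsub>M\<^esub> m j = \<zero>\<^bsub>M\<^esub>"
    and "finite {i \<in> I. f i \<noteq> \<zero>\<^bsub>E\<^esub>}"
  shows "lincomb E M m I f = f i \<odot>\<^bsub>M\<^esub> m i"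
proof -
  \<comment> \<open>\<open>f i\<close> may be zero, so \<open>i\<close> has to be added to the
    support.\<close>
  let ?T = "insert i {i \<in> I. f i \<noteq> \<zero>\<^bsub>E\<^esub>}"
  have "lincomb E M m I f = finsum M (\<lambda>i. f i \<odot>\<^bsub>M\<^esub> m i) ?T"
    by (rule lincomb_eq) (use assms in auto)
  also have "\<dots> = finsum M (\<lambda>j. if i = j then f j \<odot>\<^bsub>M\<^esub> m j else \<zero>\<^bsub>M\<^esub>) ?T"
    by (rule M.finsum_cong') (use assms in \<open>auto simp: Pi_iff closed\<close>)
  also have "\<dots> = f i \<odot>\<^bsub>M\<^esub> m i"
    by (rule M.finsum_singleton) (use assms in \<open>auto simp: Pi_iff closed\<close>)
  finally show ?thesis .
qed

lemma lincomb_unit_vector: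
  assumes "m \<in> I \<rightarrow> carrier M" "i \<in> I"
  shows "lincomb E M m I (unit_vector E I i) = m i"
proof -
  have "lincomb E M m I (unit_vector E I i) = unit_vector E I i i \<odot>\<^bsub>M\<^esub> m i"
    using assms E.unit_vector_closed[of I i]
    by (intro lincomb_single) (auto simp: unit_vector_def Pi_iff smult_zero_left)
  then show ?thesis using assms by (auto simp: unit_vector_def one Pi_iff)
qed

end

lemma linear_map_lincomb:
  assumes M: "right_module E M" and N: "right_module E N" and q: "q \<in> linear_maps E M N"
    and "m \<in> I \<rightarrow> carrier M" "f \<in> carrier (free_right_module E I)"
  shows "q (lincomb E M m I f) = lincomb E N (\<lambda>i. q (m i)) I f"
proof -
  interpret M: right_module E M by fact
  interpret N: right_module E N by fact
  have "q (lincomb E M m I f) = finsum N (\<lambda>i. q (f i \<odot>\<^bsub>M\<^esub> m i)) {i \<in> I. f i \<noteq> \<zero>\<^bsub>E\<^esub>}"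
    unfolding lincomb_def by (rule linear_map_finsum[OF M N q]) (use assms in \<open>auto simp: Pi_iff PiE_iff M.closed\<close>)
  also have "\<dots> = lincomb E N (\<lambda>i. q (m i)) I f"
    unfolding lincomb_def
    by (rule N.M.finsum_cong')
      (use assms in \<open>auto simp: Pi_iff PiE_iff M.closed N.closed linear_mapsD[OF q]\<close>)
  finally show ?thesis .
qed

text \<open>The coordinate \<open>j\<close> is a linear map to the regular module. It can be moved
  inside the combination, where only the term of index \<open>j\<close> survives.\<close>

lemma (in ring) lincomb_unit_vectors:
  assumes f: "f \<in> carrier (free_right_module R I)"
  shows "lincomb R (free_right_module R I) (unit_vector R I) I f = f"
proof (rule extensionalityI[of _ I])
  let ?F = "free_right_module R I"
  interpret F: right_module R ?F by (rule right_module_free)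
  interpret Reg: right_module R "regular_module R" by (rule right_module_regular)
  have m: "unit_vector R I \<in> I \<rightarrow> carrier ?F" by (rule Pi_I, rule unit_vector_closed)
  have F: "lincomb R ?F (unit_vector R I) I f \<in> carrier ?F"
    using f by (intro F.lincomb_closed m) auto
  then show "lincomb R ?F (unit_vector R I) I f \<in> extensional I" by (auto simp: PiE_def)
  show "f \<in> extensional I" using f by (auto simp: PiE_def)
  fix j assume j: "j \<in> I"
  have "lincomb R ?F (unit_vector R I) I f j = (\<lambda>f\<in>carrier ?F. f j) (lincomb R ?F (unit_vector R I) I f)"
    using F by simp
  also have "\<dots> = lincomb R (regular_module R) (\<lambda>i. (\<lambda>f\<in>carrier ?F. f j) (unit_vector R I i)) I f"
    by (rule linear_map_lincomb[OF right_module_free right_module_regular free_eval_linear[OF j] m f])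
  also have "\<dots> = lincomb R (regular_module R) (\<lambda>i. unit_vector R I i j) I f"
    by (simp add: unit_vector_closed del: free_right_module_simps)
  also have "\<dots> = f j \<odot>\<^bsub>regular_module R\<^esub> unit_vector R I j j"
    using j f by (intro Reg.lincomb_single) (auto simp: unit_vector_def PiE_iff)
  finally show "lincomb R ?F (unit_vector R I) I f j = f j"
    using f j by (simp add: unit_vector_def PiE_iff)
qed

lemma linear_map_on_free:
  assumes "right_module E M" "q \<in> linear_maps E (free_right_module E I) M" "f \<in> carrier (free_right_module E I)"
  shows "q f = lincomb E M (\<lambda>i. q (unit_vector E I i)) I f"
proof -
  interpret M: right_module E M by fact
  have "unit_vector E I \<in> I \<rightarrow> carrier (free_right_module E I)" by (rule Pi_I, rule M.E.unit_vector_closed)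
  from linear_map_lincomb[OF M.E.right_module_free assms(1,2) this assms(3)] show ?thesis
    using M.E.lincomb_unit_vectors[OF assms(3)] by simp
qed


section \<open>Projective modules\<close>

text \<open>A map from a free module to \<open>M\<close> lifts through \<open>q\<close> once the
  images of the unit vectors are lifted. \<open>M\<close> is a retract of a free module by
  \<open>i\<close> and \<open>p\<close>; the lift of \<open>p\<close>, composed with
  \<open>i\<close>, is the section.\<close>

lemma projective_section:
  fixes E :: "('a, 'x) ring_scheme" and M :: "('a, 'm, 'y) module_scheme"
  assumes P: "projective E M" and B: "right_module E B" and q: "q \<in> linear_maps E B M"
    and surj: "q ` carrier B = carrier M"
  obtains s where "s \<in> linear_maps E M B" "\<And>x. x \<in> carrier M \<Longrightarrow> q (s x) = x"
proof -
  obtain I :: "'m set" and N :: "('a, 'm \<Rightarrow> 'a) module" where M: "right_module E M" and N: "right_module E N"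
    and iso: "modules_isomorphic E (dsum M N) (free_right_module E I)"
    using P unfolding projective_def by blast
  interpret M: right_module E M by (rule M)
  interpret N: right_module E N by (rule N)
  interpret B: right_module E B by (rule B)
  let ?F = "free_right_module E I"
  note F = M.E.right_module_free[of I] and MN = right_module_dsum[OF M N]
  interpret MN: right_module E "dsum M N" by (rule MN)
  interpret F: right_module E ?F by (rule F)
  obtain \<phi> where \<phi>: "\<phi> \<in> linear_maps E (dsum M N) ?F" "bij_betw \<phi> (carrier (dsum M N)) (carrier ?F)"
    using iso unfolding modules_isomorphic_def by blast
  obtain \<psi> where \<psi>: "\<psi> \<in> linear_maps E ?F (dsum M N)" "\<And>x. x \<in> carrier (dsum M N) \<Longrightarrow> \<psi> (\<phi> x) = x"
    using linear_map_inverse[OF MN F \<phi>] by blast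
  define i where "i = compose (carrier M) \<phi> (\<lambda>x\<in>carrier M. (x, \<zero>\<^bsub>N\<^esub>))"
  have i: "i \<in> linear_maps E M ?F"
    unfolding i_def
    by (rule M.compose_linear[OF M.restrict_linear \<phi>(1)]) (auto simp: N.smult_zero_right)
  define p where "p = compose (carrier ?F) (\<lambda>x\<in>carrier (dsum M N). fst x) \<psi>"
  have p: "p \<in> linear_maps E ?F M"
    unfolding p_def by (rule F.compose_linear[OF \<psi>(1) MN.restrict_linear]) auto
  have pi: "p (i x) = x" if "x \<in> carrier M" for x
    using that linear_mapsD(1)[OF i that] linear_mapsD(1)[OF \<psi>(1)] \<psi>(2)[of "(x, \<zero>\<^bsub>N\<^esub>)"]
    by (simp add: p_def i_def compose_def del: free_right_module_simps)
  have "\<exists>b\<in>carrier B. q b = p (unit_vector E I \<alpha>)" for \<alpha>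
    using surj linear_mapsD(1)[OF p M.E.unit_vector_closed] by (metis imageE)
  then obtain b where b: "\<And>\<alpha>. b \<alpha> \<in> carrier B" "\<And>\<alpha>. q (b \<alpha>) = p (unit_vector E I \<alpha>)" by metis
  show ?thesis
  proof (rule that)
    let ?g = "\<lambda>f\<in>carrier ?F. lincomb E B b I f"
    show "compose (carrier M) ?g i \<in> linear_maps E M B"
      by (rule M.compose_linear[OF i B.lincomb_linear]) (use b in auto)
    fix x assume x: "x \<in> carrier M"
    then have ix: "i x \<in> carrier ?F" by (rule linear_mapsD(1)[OF i])
    have "q (compose (carrier M) ?g i x) = q (lincomb E B b I (i x))" using x ix by (simp add: compose_def)
    also have "\<dots> = lincomb E M (\<lambda>\<alpha>. q (b \<alpha>)) I (i x)"
      by (rule linear_map_lincomb[OF B M q _ ix]) (use b in auto)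
    also have "\<dots> = p (i x)" unfolding b(2) by (rule linear_map_on_free[OF M p ix, symmetric])
    finally show "q (compose (carrier M) ?g i x) = x" using pi[OF x] by simp
  qed
qed

text \<open>The image is a submodule, and the unit vectors put the generators into it.\<close>

lemma (in right_module) lincomb_surj:
  assumes m: "m \<in> I \<rightarrow> carrier M" and gen: "submodule_generated E M (m ` I) = carrier M"
  shows "(\<lambda>f\<in>carrier (free_right_module E I). lincomb E M m I f) ` carrier (free_right_module E I) = carrier M"
    (is "?q ` carrier ?F = _")
proof
  note q = lincomb_linear[OF m]
  show "?q ` carrier ?F \<subseteq> carrier M" using linear_mapsD(1)[OF q] by blast
  have "submodule (?q ` carrier ?F) E M"
    by (rule submodule_image[OF E.right_module_free right_module_axioms q right_module.submodule_carrier[OF E.right_module_free]])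
  moreover have "m ` I \<subseteq> ?q ` carrier ?F"
  proof
    fix x assume "x \<in> m ` I"
    then obtain i where "i \<in> I" "x = m i" by blast
    then show "x \<in> ?q ` carrier ?F"
      using lincomb_unit_vector[OF m, of i] E.unit_vector_closed[of I i]
      by (intro image_eqI[of _ _ "unit_vector E I i"]) (auto simp del: free_right_module_simps)
  qed
  ultimately show "carrier M \<subseteq> ?q ` carrier ?F" using submodule_generated_in gen by metis
qed

text \<open>\<open>c\<close> is a section of the surjection from the free module that the generators
  define; its coordinates are the functionals of the dual basis.\<close>

lemma dual_basis:
  assumes P: "projective E M" and m: "m \<in> I \<rightarrow> carrier M"
    and gen: "submodule_generated E M (m ` I) = carrier M"
  obtains c where "c \<in> linear_maps E M (free_right_module E I)"
    "\<And>x. x \<in> carrier M \<Longrightarrow> lincomb E M m I (c x) = x"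
proof -
  interpret M: right_module E M using P by (simp add: projective_def)
  let ?F = "free_right_module E I"
  obtain s where s: "s \<in> linear_maps E M ?F"
    "\<And>x. x \<in> carrier M \<Longrightarrow> (\<lambda>f\<in>carrier ?F. lincomb E M m I f) (s x) = x"
    using projective_section[OF P M.E.right_module_free M.lincomb_linear[OF m] M.lincomb_surj[OF m gen]]
    by metis
  show ?thesis
    by (rule that[OF s(1)]) (use s linear_mapsD(1)[OF s(1)] in \<open>simp del: free_right_module_simps\<close>)
qed

lemma (in right_module) generated_by_lincomb:
  assumes m: "m \<in> I \<rightarrow> carrier M"
    and surj: "\<And>x. x \<in> carrier M \<Longrightarrow> \<exists>f\<in>I \<rightarrow> carrier E. lincomb E M m I f = x"
  shows "submodule_generated E M (m ` I) = carrier M"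
proof
  show "submodule_generated E M (m ` I) \<subseteq> carrier M"
    by (rule submodule_generated_in[OF submodule_carrier]) (use m in auto)
  show "carrier M \<subseteq> submodule_generated E M (m ` I)"
    unfolding submodule_generated_def
  proof safe
    fix x H assume x: "x \<in> carrier M" and H: "submodule H E M" "m ` I \<subseteq> H"
    obtain f where f: "f \<in> I \<rightarrow> carrier E" "lincomb E M m I f = x" using surj[OF x] by blast
    interpret H: submodule H E M by (rule H)
    let ?S = "{i \<in> I. f i \<noteq> \<zero>\<^bsub>E\<^esub>}"
    show "x \<in> H"
    proof (cases "finite ?S")
      case True
      then have "lincomb E M m I f \<in> H"
        unfolding lincomb_def using f H(2) by (intro submodule_finsum[OF H(1)]) auto
      then show ?thesis using f by simp
    next
      case False
      \<comment> \<open>An infinite support makes the combination zero by the convention for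
        \<open>finsum\<close>, and zero lies in every submodule.\<close>
      then have "x = \<zero>\<^bsub>M\<^esub>" using f by (simp add: lincomb_def)
      then show ?thesis using H.one_closed by simp
    qed
  qed
qed

lemma (in right_module) submodule_kernel:
  assumes N: "right_module E N" and f: "f \<in> linear_maps E M N"
  shows "submodule {x \<in> carrier M. f x = \<zero>\<^bsub>N\<^esub>} E M"
proof -
  interpret N: right_module E N by (rule N)
  show ?thesis
    by (rule submoduleI')
      (auto simp: linear_map_zero[OF right_module_axioms N f] linear_mapsD[OF f] N.smult_zero_right closed)
qed

lemma (in ring) linear_map_reindex:
  assumes "inj_on h I" and "\<And>i. i \<in> h ` I \<Longrightarrow> g i \<in> I \<and> h (g i) = i"
  shows "(\<lambda>f\<in>carrier (free_right_module R I). \<lambda>i\<in>h ` I. f (g i)) \<in>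
    linear_maps R (free_right_module R I) (free_right_module R (h ` I))"
proof (rule right_module.restrict_linear[OF right_module_free])
  fix f assume f: "f \<in> carrier (free_right_module R I)"
  have "{i \<in> h ` I. f (g i) \<noteq> \<zero>} \<subseteq> h ` {i \<in> I. f i \<noteq> \<zero>}"
  proof
    fix i assume i: "i \<in> {i \<in> h ` I. f (g i) \<noteq> \<zero>}"
    then show "i \<in> h ` {i \<in> I. f i \<noteq> \<zero>}"
      using assms(2)[of i] by (intro image_eqI[of _ _ "g i"]) auto
  qed
  then have "finite {i \<in> h ` I. f (g i) \<noteq> \<zero>}" by (rule finite_subset) (use f in simp)
  then show "(\<lambda>i\<in>h ` I. f (g i)) \<in> carrier (free_right_module R (h ` I))"
    using f assms(2) by (auto cong: conj_cong)
qed (use assms(2) in \<open>auto simp: fun_eq_iff\<close>)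

text \<open>The decomposition is \<open>y = d (q y) + (y - d (q y))\<close>, whose second part lies
  in the kernel of \<open>q\<close>.\<close>

lemma split_kernel:
  assumes M: "right_module E M" and G: "right_module E G"
    and d: "d \<in> linear_maps E M G" and q: "q \<in> linear_maps E G M"
    and qd: "\<And>x. x \<in> carrier M \<Longrightarrow> q (d x) = x"
  shows "modules_isomorphic E (dsum M (G\<lparr>carrier := {y \<in> carrier G. q y = \<zero>\<^bsub>M\<^esub>}\<rparr>)) G"
    (is "modules_isomorphic E (dsum M ?N) G")
proof -
  interpret M: right_module E M by (rule M)
  interpret G: right_module E G by (rule G)
  have N: "right_module E ?N" by (rule G.submodule_right_module[OF G.submodule_kernel[OF M q]])
  interpret MN: right_module E "dsum M ?N" by (rule right_module_dsum[OF M N])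
  note [simp] = linear_mapsD[OF d] linear_mapsD[OF q] qd linear_map_neg[OF M G d] linear_map_neg[OF G M q]
  have diff: "(x \<oplus>\<^bsub>G\<^esub> y) \<oplus>\<^bsub>G\<^esub> \<ominus>\<^bsub>G\<^esub> d (q (x \<oplus>\<^bsub>G\<^esub> y)) = (x \<oplus>\<^bsub>G\<^esub> \<ominus>\<^bsub>G\<^esub> d (q x)) \<oplus>\<^bsub>G\<^esub> (y \<oplus>\<^bsub>G\<^esub> \<ominus>\<^bsub>G\<^esub> d (q y))"
    if "x \<in> carrier G" "y \<in> carrier G" for x y
    using that by (simp add: G.M.minus_add G.M.a_ac)
  show ?thesis
  proof (rule modules_isomorphicI)
    let ?f = "\<lambda>u\<in>carrier (dsum M ?N). d (fst u) \<oplus>\<^bsub>G\<^esub> snd u"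
    let ?h = "\<lambda>y\<in>carrier G. (q y, y \<oplus>\<^bsub>G\<^esub> \<ominus>\<^bsub>G\<^esub> d (q y))"
    show "?f \<in> linear_maps E (dsum M ?N) G"
    proof (rule MN.restrict_linear)
      show "d (fst (u \<oplus>\<^bsub>dsum M ?N\<^esub> v)) \<oplus>\<^bsub>G\<^esub> snd (u \<oplus>\<^bsub>dsum M ?N\<^esub> v) =
          (d (fst u) \<oplus>\<^bsub>G\<^esub> snd u) \<oplus>\<^bsub>G\<^esub> (d (fst v) \<oplus>\<^bsub>G\<^esub> snd v)"
        if "u \<in> carrier (dsum M ?N)" "v \<in> carrier (dsum M ?N)" for u v
        using that by (auto simp: G.M.a_ac)
    qed (auto simp: G.r_distr)
    show "?h \<in> linear_maps E G (dsum M ?N)"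
    proof (rule G.restrict_linear)
      fix y assume y: "y \<in> carrier G"
      then show "(q y, y \<oplus>\<^bsub>G\<^esub> \<ominus>\<^bsub>G\<^esub> d (q y)) \<in> carrier (dsum M ?N)" by (simp add: M.M.r_neg)
      show "(q (x \<oplus>\<^bsub>G\<^esub> y), x \<oplus>\<^bsub>G\<^esub> y \<oplus>\<^bsub>G\<^esub> \<ominus>\<^bsub>G\<^esub> d (q (x \<oplus>\<^bsub>G\<^esub> y))) =
          (q x, x \<oplus>\<^bsub>G\<^esub> \<ominus>\<^bsub>G\<^esub> d (q x)) \<oplus>\<^bsub>dsum M ?N\<^esub> (q y, y \<oplus>\<^bsub>G\<^esub> \<ominus>\<^bsub>G\<^esub> d (q y))"
        if "x \<in> carrier G" for x
        using diff[OF that y] y that by simp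
      show "(q (a \<odot>\<^bsub>G\<^esub> y), a \<odot>\<^bsub>G\<^esub> y \<oplus>\<^bsub>G\<^esub> \<ominus>\<^bsub>G\<^esub> d (q (a \<odot>\<^bsub>G\<^esub> y))) =
          a \<odot>\<^bsub>dsum M ?N\<^esub> (q y, y \<oplus>\<^bsub>G\<^esub> \<ominus>\<^bsub>G\<^esub> d (q y))" if "a \<in> carrier E" for a
        using y that by (simp add: G.r_distr G.smult_minus)
    qed
    show "?h (?f u) = u" if "u \<in> carrier (dsum M ?N)" for u
    proof -
      obtain x y where u: "u = (x, y)" by (cases u)
      then have "x \<in> carrier M" "y \<in> carrier G" "q y = \<zero>\<^bsub>M\<^esub>" using that by auto
      then show ?thesis by (simp add: u G.M.a_ac G.M.r_neg1 G.M.r_neg2 G.M.r_neg)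
    qed
    show "?f (?h y) = y" if "y \<in> carrier G" for y
      using that by (simp add: M.M.r_neg G.M.a_ac G.M.r_neg1 G.M.r_neg2 G.M.r_neg)
  qed
qed

text \<open>Converse of \<open>dual_basis\<close>. Since \<open>projective\<close> wants index sets
  inside the type of \<open>M\<close>, the free module on \<open>I\<close> is replaced by the one on
  the image of \<open>I\<close> under \<open>m\<close>, which is why \<open>m\<close> is taken
  injective. The complement is the kernel of the map from this free module to
  \<open>M\<close>.\<close>

lemma projectiveI:
  fixes M :: "('a, 'm, 'y) module_scheme" and m :: "'i \<Rightarrow> 'm"
  assumes M: "right_module E M" and m: "m \<in> I \<rightarrow> carrier M" and inj: "inj_on m I"
    and c: "c \<in> linear_maps E M (free_right_module E I)"
    and mc: "\<And>x. x \<in> carrier M \<Longrightarrow> lincomb E M m I (c x) = x"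
  shows "projective E M"
proof -
  interpret M: right_module E M by (rule M)
  let ?F = "free_right_module E I" and ?G = "free_right_module E (m ` I)"
  interpret F: right_module E ?F by (rule M.E.right_module_free)
  interpret G: right_module E ?G by (rule M.E.right_module_free)
  let ?g = "inv_into I m"
  have g: "?g i \<in> I \<and> m (?g i) = i" if "i \<in> m ` I" for i
    using that by (simp add: inv_into_into f_inv_into_f)
  define d where "d = compose (carrier M) (\<lambda>f\<in>carrier ?F. \<lambda>i\<in>m ` I. f (?g i)) c"
  have d: "d \<in> linear_maps E M ?G"
    unfolding d_def by (rule M.compose_linear[OF c M.E.linear_map_reindex[OF inj g]])
  let ?q = "\<lambda>f\<in>carrier ?G. lincomb E M (\<lambda>i. i) (m ` I) f"
  have q: "?q \<in> linear_maps E ?G M" by (rule M.lincomb_linear) (use m in auto)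
  have qd: "?q (d x) = x" if x: "x \<in> carrier M" for x
  proof -
    have cx: "c x \<in> carrier ?F" by (rule linear_mapsD(1)[OF c x])
    have dx: "d x = (\<lambda>i\<in>m ` I. c x (?g i))" using x cx by (simp add: d_def compose_def)
    have "{i \<in> m ` I. d x i \<noteq> \<zero>\<^bsub>E\<^esub>} = m ` {i \<in> I. c x i \<noteq> \<zero>\<^bsub>E\<^esub>}"
      using inj by (auto simp: dx) (metis inj_onD)
    then have "?q (d x) = finsum M (\<lambda>i. d x i \<odot>\<^bsub>M\<^esub> i) (m ` {i \<in> I. c x i \<noteq> \<zero>\<^bsub>E\<^esub>})"
      using linear_mapsD(1)[OF d x] by (simp add: lincomb_def del: free_right_module_simps)
    also have "\<dots> = finsum M (\<lambda>i. d x (m i) \<odot>\<^bsub>M\<^esub> m i) {i \<in> I. c x i \<noteq> \<zero>\<^bsub>E\<^esub>}"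
      by (rule M.add.finprod_reindex)
        (use m cx inj in \<open>auto simp: dx Pi_iff PiE_iff intro!: M.closed intro: inj_on_subset\<close>)
    also have "\<dots> = lincomb E M m I (c x)"
      unfolding lincomb_def
      by (rule M.M.finsum_cong') (use m cx inj in \<open>auto simp: dx Pi_iff PiE_iff intro!: M.closed\<close>)
    finally show ?thesis using mc[OF x] by simp
  qed
  have "right_module E (?G\<lparr>carrier := {f \<in> carrier ?G. ?q f = \<zero>\<^bsub>M\<^esub>}\<rparr>)"
    by (rule G.submodule_right_module[OF G.submodule_kernel[OF M q]])
  moreover have "modules_isomorphic E (dsum M (?G\<lparr>carrier := {f \<in> carrier ?G. ?q f = \<zero>\<^bsub>M\<^esub>}\<rparr>)) ?G"
    using qd by (rule split_kernel[OF M G.right_module_axioms d q])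
  ultimately show ?thesis unfolding projective_def using M by blast
qed

lemma zero_ring_module_trivial:
  assumes "right_module E M" "\<one>\<^bsub>E\<^esub> = \<zero>\<^bsub>E\<^esub>" "x \<in> carrier M"
  shows "x = \<zero>\<^bsub>M\<^esub>"
  using assms right_module.one[of E M x] right_module.smult_zero_left[of E M x] by simp

lemma (in ring) inj_unit_vector: "\<one> \<noteq> \<zero> \<Longrightarrow> inj_on (unit_vector R I) I"
  by (auto simp: inj_on_def unit_vector_def fun_eq_iff restrict_def split: if_splits)

lemma (in ring) projective_free: "projective R (free_right_module R I)"
proof (cases "\<one> = \<zero>")
  case True \<comment> \<open>all unit vectors coincide, so they cannot serve as an index set\<close>
  let ?F = "free_right_module R I"
  interpret F: right_module R ?F by (rule right_module_free)
  have "(\<lambda>x\<in>carrier ?F. \<lambda>i\<in>{}. undefined) \<in> linear_maps R ?F (free_right_module R {})"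
    by (rule F.restrict_linear) auto
  \<comment> \<open>Over the zero ring every module vanishes, so the empty combination already gives
    every element.\<close>
  moreover have "lincomb R ?F m {} f = x" if "x \<in> carrier ?F" for m f x
    using zero_ring_module_trivial[OF right_module_free True that] by (simp add: lincomb_def)
  ultimately show ?thesis by (intro projectiveI[OF right_module_free, of undefined "{}"]) auto
next
  case False
  show ?thesis
    by (rule projectiveI[OF right_module_free _ inj_unit_vector[OF False] right_module.id_linear[OF right_module_free]])
      (auto simp: lincomb_unit_vectors unit_vector_closed simp del: free_right_module_simps)
qed

lemma (in ring) generated_free:
  "submodule_generated R (free_right_module R I) (unit_vector R I ` I) = carrier (free_right_module R I)"
proof (rule right_module.generated_by_lincomb[OF right_module_free])
  show "unit_vector R I \<in> I \<rightarrow> carrier (free_right_module R I)" by (rule Pi_I, rule unit_vector_closed)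
  fix f assume "f \<in> carrier (free_right_module R I)"
  then show "\<exists>g\<in>I \<rightarrow> carrier R. lincomb R (free_right_module R I) (unit_vector R I) I g = f"
    by (intro bexI[of _ f] lincomb_unit_vectors) auto
qed

lemma (in ring) finitely_generated_free: "finite I \<Longrightarrow> finitely_generated R (free_right_module R I)"
  unfolding finitely_generated_def
  by (rule exI[of _ "unit_vector R I ` I"]) (auto simp: generated_free unit_vector_closed simp del: free_right_module_simps)

lemma (in ring) countably_generated_free: "countable I \<Longrightarrow> countably_generated R (free_right_module R I)"
  unfolding countably_generated_def
  by (rule exI[of _ "unit_vector R I ` I"]) (auto simp: generated_free unit_vector_closed simp del: free_right_module_simps)

section \<open>Finitely generated projective modules over a ring with orthogonal isometries\<close>

text \<open>Such elements make the free module of every finite rank a retract of the regular module.\<close>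

locale self_absorbing_ring = ring E for E :: "('e, 'x) ring_scheme" (structure) +
  assumes isometries: "\<And>k :: nat. \<exists>a b. \<forall>i<k. \<forall>j<k. a j \<in> carrier E \<and> b i \<in> carrier E \<and>
    b i \<otimes> a j = (if i = j then \<one> else \<zero>)"
begin

text \<open>A dual basis embeds \<open>M\<close> into the free module of rank \<open>k\<close>. A
  vector is packed into one ring element, the sum of the products of \<open>a i\<close> with its
  \<open>i\<close>-th entry, and left multiplication by \<open>b i\<close> takes that entry out
  again.\<close>

lemma retract_of_regular:
  assumes fg: "finitely_generated E M" and P: "projective E M"
  shows "\<exists>\<phi>\<in>linear_maps E M (regular_module E). \<exists>\<psi>\<in>linear_maps E (regular_module E) M.
    \<forall>x\<in>carrier M. \<psi> (\<phi> x) = x"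
proof -
  interpret M: right_module E M using P by (simp add: projective_def)
  interpret Reg: right_module E "regular_module E" by (rule right_module_regular)
  obtain S where S: "S \<subseteq> carrier M" "finite S" "submodule_generated E M S = carrier M"
    using fg unfolding finitely_generated_def by blast
  obtain k :: nat and m where Sm: "S = m ` {i. i < k}"
    using finite_imp_nat_seg_image_inj_on[OF S(2)] by auto
  define I where "I = {i. i < k}"
  let ?F = "free_right_module E I"
  interpret F: right_module E ?F by (rule right_module_free)
  have m: "m \<in> I \<rightarrow> carrier M" using S Sm by (auto simp: I_def)
  obtain c where c: "c \<in> linear_maps E M ?F" "\<And>x. x \<in> carrier M \<Longrightarrow> lincomb E M m I (c x) = x"
    using dual_basis[OF P m] S(3) unfolding Sm I_def by metis
  obtain a b where ab: "\<And>i j. i \<in> I \<Longrightarrow> j \<in> I \<Longrightarrow> b i \<otimes> a j = (if i = j then \<one> else \<zero>)"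
    and a: "a \<in> I \<rightarrow> carrier (regular_module E)" and b: "b \<in> I \<rightarrow> carrier E"
    using isometries[of k] by (auto simp: I_def)
  define \<phi> where "\<phi> = compose (carrier M) (\<lambda>f\<in>carrier ?F. lincomb E (regular_module E) a I f) c"
  define \<psi> where "\<psi> = compose (carrier (regular_module E)) (\<lambda>f\<in>carrier ?F. lincomb E M m I f)
    (\<lambda>y\<in>carrier (regular_module E). \<lambda>i\<in>I. b i \<otimes> y)"
  have fin: "finite I" by (simp add: I_def)
  have \<phi>: "\<phi> \<in> linear_maps E M (regular_module E)"
    unfolding \<phi>_def by (rule M.compose_linear[OF c(1) Reg.lincomb_linear[OF a]])
  have \<psi>: "\<psi> \<in> linear_maps E (regular_module E) M"
    unfolding \<psi>_def
    by (rule Reg.compose_linear[OF Reg.restrict_linear M.lincomb_linear[OF m]])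
      (use b fin in \<open>auto simp: fun_eq_iff r_distr m_assoc Pi_iff\<close>)
  have "\<psi> (\<phi> x) = x" if x: "x \<in> carrier M" for x
  proof -
    have cx: "c x \<in> carrier ?F" by (rule linear_mapsD(1)[OF c(1) x])
    have \<phi>x: "\<phi> x = lincomb E (regular_module E) a I (c x)" using x cx by (simp add: \<phi>_def compose_def)
    have "b i \<otimes> \<phi> x = c x i" if i: "i \<in> I" for i
    proof -
      \<comment> \<open>Left multiplication is linear for the right module structure, so it can be
        moved into the combination, where orthogonality leaves a single term.\<close>
      have bi: "(\<lambda>y\<in>carrier (regular_module E). b i \<otimes> y) \<in> linear_maps E (regular_module E) (regular_module E)"
        using b i by (intro Reg.restrict_linear) (auto simp: r_distr m_assoc Pi_iff)
      have "b i \<otimes> \<phi> x = (\<lambda>y\<in>carrier (regular_module E). b i \<otimes> y) (\<phi> x)"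
        using linear_mapsD(1)[OF \<phi> x] by simp
      also have "\<dots> = lincomb E (regular_module E) (\<lambda>j. (\<lambda>y\<in>carrier (regular_module E). b i \<otimes> y) (a j)) I (c x)"
        unfolding \<phi>x by (rule linear_map_lincomb[OF right_module_regular right_module_regular bi a cx])
      also have "\<dots> = c x i \<odot>\<^bsub>regular_module E\<^esub> (\<lambda>y\<in>carrier (regular_module E). b i \<otimes> y) (a i)"
        using a i b cx by (intro Reg.lincomb_single) (auto simp: Pi_iff PiE_iff ab)
      also have "\<dots> = c x i" using a i cx by (auto simp: Pi_iff PiE_iff ab)
      finally show ?thesis .
    qed
    then have "(\<lambda>i\<in>I. b i \<otimes> \<phi> x) = c x" using cx by (auto simp: fun_eq_iff PiE_iff extensional_def)
    then show ?thesis using c(2)[OF x] cx linear_mapsD(1)[OF \<phi> x] by (simp add: \<psi>_def compose_def)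
  qed
  then show ?thesis using \<phi> \<psi> by blast
qed

end

section \<open>The category of finitely generated projective modules\<close>

lemma linear_maps_zero:
  assumes "right_module E M" "right_module E N"
  shows "(\<lambda>x\<in>carrier M. \<zero>\<^bsub>N\<^esub>) \<in> linear_maps E M N"
proof -
  interpret M: right_module E M by fact
  interpret N: right_module E N by fact
  show ?thesis by (rule M.restrict_linear) (auto simp: N.smult_zero_right)
qed

lemma linear_maps_add:
  assumes "right_module E M" "right_module E N" "f \<in> linear_maps E M N" "g \<in> linear_maps E M N"
  shows "(\<lambda>x\<in>carrier M. f x \<oplus>\<^bsub>N\<^esub> g x) \<in> linear_maps E M N"
proof -
  interpret M: right_module E M by fact
  interpret N: right_module E N by fact
  show ?thesis
    by (rule M.restrict_linear)
      (auto simp: linear_mapsD[OF assms(3)] linear_mapsD[OF assms(4)] N.M.a_ac N.r_distr)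
qed

lemma linear_maps_neg:
  assumes "right_module E M" "right_module E N" "f \<in> linear_maps E M N"
  shows "(\<lambda>x\<in>carrier M. \<ominus>\<^bsub>N\<^esub> f x) \<in> linear_maps E M N"
proof -
  interpret M: right_module E M by fact
  interpret N: right_module E N by fact
  show ?thesis
    by (rule M.restrict_linear)
      (auto simp: linear_mapsD[OF assms(3)] N.M.minus_add N.M.a_ac N.smult_minus)
qed

section \<open>Transport of modules along injections\<close>

text \<open>The carrier type of the objects of \<open>Pf\<close> and \<open>Tate_Dr\<close> is
  prescribed, so summands found inside \<open>E\<close> or R((t)) have to be copied into it.\<close>

definition transport_module :: "('b \<Rightarrow> 'c) \<Rightarrow> ('a, 'b, 'y) module_scheme \<Rightarrow> ('a, 'c) module" where
  "transport_module g M = mk_module (g ` carrier M) (g \<zero>\<^bsub>M\<^esub>)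
     (\<lambda>x y. g (inv_into (carrier M) g x \<oplus>\<^bsub>M\<^esub> inv_into (carrier M) g y))
     (\<lambda>a x. g (a \<odot>\<^bsub>M\<^esub> inv_into (carrier M) g x))"

lemma transport_module_simps [simp]:
  "carrier (transport_module g M) = g ` carrier M" "zero (transport_module g M) = g \<zero>\<^bsub>M\<^esub>"
  "add (transport_module g M) = (\<lambda>x y. g (inv_into (carrier M) g x \<oplus>\<^bsub>M\<^esub> inv_into (carrier M) g y))"
  "smult (transport_module g M) = (\<lambda>a x. g (a \<odot>\<^bsub>M\<^esub> inv_into (carrier M) g x))"
  by (simp_all add: transport_module_def)

context right_module
begin

lemma right_module_transport:
  assumes g: "inj_on g (carrier M)"
  shows "right_module E (transport_module g M)"
proof -
  note [simp] = inv_into_f_f[OF g]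
  have "abelian_group (transport_module g M)"
  proof (rule abelian_groupI)
    fix x assume "x \<in> carrier (transport_module g M)"
    then obtain y where "y \<in> carrier M" "x = g y" by auto
    then show "\<exists>y\<in>carrier (transport_module g M). y \<oplus>\<^bsub>transport_module g M\<^esub> x = \<zero>\<^bsub>transport_module g M\<^esub>"
      by (intro bexI[of _ "g (\<ominus>\<^bsub>M\<^esub> y)"]) (simp_all add: M.l_neg)
  qed (auto simp: M.a_ac)
  then show ?thesis
    by (intro right_module.intro right_module_axioms.intro E.ring_axioms)
      (auto simp: closed l_distr r_distr assoc one)
qed

lemma transport_inverse_linear:
  assumes g: "inj_on g (carrier M)"
  shows "(\<lambda>x\<in>g ` carrier M. inv_into (carrier M) g x) \<in> linear_maps E (transport_module g M) M"
proof -
  have "(\<lambda>x\<in>carrier (transport_module g M). inv_into (carrier M) g x) \<in> linear_maps E (transport_module g M) M"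
    by (rule right_module.restrict_linear[OF right_module_transport[OF g]])
      (auto simp: inv_into_f_f[OF g] closed)
  then show ?thesis by simp
qed

end

section \<open>Short exact sequences of projective modules as split sequences\<close>

lemma Pf_simps:
  "M \<in> Ob (Pf E) \<longleftrightarrow> right_module E M \<and> finitely_generated E M \<and> projective E M"
  "Hom (Pf E) M N = pointwise_group (linear_maps E M N) (carrier M) N"
  "Cmp (Pf E) A B D g f = compose (carrier A) g f"
  "Idn (Pf E) A = (\<lambda>x\<in>carrier A. x)"
  by (simp_all add: Pf_def)

lemma preadditive_Pf: "preadditive_category (Pf E)"
proof (rule preadditive_concrete[where H = "linear_maps E"])
  fix A B D f g assume "A \<in> Ob (Pf E)" "f \<in> linear_maps E A B" "g \<in> linear_maps E B D"
  then show "compose (carrier A) g f \<in> linear_maps E A D"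
    by (auto simp: Pf_simps intro: right_module.compose_linear)
next
  fix A assume "A \<in> Ob (Pf E)"
  then show "abelian_group A" by (simp add: Pf_simps right_module_def)
qed (auto simp: Pf_simps linear_mapsD linear_maps_zero linear_maps_add linear_maps_neg right_module.id_linear)

text \<open>Projectivity of \<open>D\<close> provides \<open>s\<close>. Then
  \<open>k x = x - s (p x)\<close> lies in the kernel of \<open>p\<close>, that is, in the image of
  the injective map \<open>i\<close>, and \<open>r x\<close> is its preimage.\<close>

lemma short_exact_split:
  assumes A: "right_module E A" and B: "right_module E B" and D: "right_module E D" and P: "projective E D"
    and i: "i \<in> linear_maps E A B" and p: "p \<in> linear_maps E B D"
    and inj: "inj_on i (carrier A)" and ex: "i ` carrier A = {y \<in> carrier B. p y = \<zero>\<^bsub>D\<^esub>}"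
    and surj: "p ` carrier B = carrier D"
  obtains r s where "r \<in> linear_maps E B A" "s \<in> linear_maps E D B" "\<And>x. x \<in> carrier A \<Longrightarrow> r (i x) = x"
    "\<And>x. x \<in> carrier D \<Longrightarrow> p (s x) = x" "\<And>x. x \<in> carrier B \<Longrightarrow> i (r x) \<oplus>\<^bsub>B\<^esub> s (p x) = x"
proof -
  interpret A: right_module E A by (rule A)
  interpret B: right_module E B by (rule B)
  interpret D: right_module E D by (rule D)
  obtain s where s: "s \<in> linear_maps E D B" "\<And>x. x \<in> carrier D \<Longrightarrow> p (s x) = x"
    using projective_section[OF P B p surj] by blast
  note [simp] = linear_mapsD[OF i] linear_mapsD[OF p] linear_mapsD[OF s(1)] s(2)
    linear_map_neg[OF B D p] linear_map_neg[OF D B s(1)]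
  define k where "k x = x \<oplus>\<^bsub>B\<^esub> \<ominus>\<^bsub>B\<^esub> s (p x)" for x
  have k: "k x \<in> carrier B" "p (k x) = \<zero>\<^bsub>D\<^esub>" if "x \<in> carrier B" for x
    using that by (simp_all add: k_def D.M.r_neg)
  have k_add: "k (x \<oplus>\<^bsub>B\<^esub> y) = k x \<oplus>\<^bsub>B\<^esub> k y" if "x \<in> carrier B" "y \<in> carrier B" for x y
    using that by (simp add: k_def B.M.minus_add B.M.a_ac)
  have k_smult: "k (a \<odot>\<^bsub>B\<^esub> x) = a \<odot>\<^bsub>B\<^esub> k x" if "a \<in> carrier E" "x \<in> carrier B" for a x
    using that by (simp add: k_def B.r_distr B.smult_minus)
  let ?h = "inv_into (carrier A) i"
  have h: "?h y \<in> carrier A" "i (?h y) = y" if "y \<in> carrier B" "p y = \<zero>\<^bsub>D\<^esub>" for y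
    using that ex by (auto simp: inv_into_into f_inv_into_f)
  have h_uniq: "?h y = x" if "x \<in> carrier A" "i x = y" for x y using inv_into_f_f[OF inj that(1)] that(2) by simp
  have ik: "k (i x) = i x" if "x \<in> carrier A" for x
  proof -
    have "p (i x) = \<zero>\<^bsub>D\<^esub>" using ex that by blast
    then show ?thesis using that linear_map_zero[OF D B s(1)] by (simp add: k_def)
  qed
  have hk: "?h (k x) \<in> carrier A" "i (?h (k x)) = k x" if "x \<in> carrier B" for x
    using h[OF k[OF that]] .
  show ?thesis
  proof (rule that)
    show "(\<lambda>x\<in>carrier B. ?h (k x)) \<in> linear_maps E B A"
    proof (rule B.restrict_linear)
      fix x assume x: "x \<in> carrier B"
      show "?h (k x) \<in> carrier A" using hk(1)[OF x] .
      show "?h (k (x \<oplus>\<^bsub>B\<^esub> y)) = ?h (k x) \<oplus>\<^bsub>A\<^esub> ?h (k y)" if y: "y \<in> carrier B" for y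
        using x y hk by (intro h_uniq) (simp_all add: k_add)
      show "?h (k (a \<odot>\<^bsub>B\<^esub> x)) = a \<odot>\<^bsub>A\<^esub> ?h (k x)" if a: "a \<in> carrier E" for a
        using a x hk by (intro h_uniq) (simp_all add: k_smult A.closed)
    qed
    fix x assume x: "x \<in> carrier B"
    then have "k x \<oplus>\<^bsub>B\<^esub> s (p x) = x" by (simp add: k_def B.M.a_assoc B.M.l_neg)
    then show "i ((\<lambda>x\<in>carrier B. ?h (k x)) x) \<oplus>\<^bsub>B\<^esub> s (p x) = x" using x by (simp add: hk)
  qed (use s in \<open>simp_all add: ik h_uniq\<close>)
qed

text \<open>At \<open>i x\<close> the decomposition reads \<open>i x + s (p (i x)) = i x\<close>;
  applying \<open>p\<close> makes \<open>p (i x)\<close> equal to its own double, hence zero. The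
  same argument at \<open>s x\<close> gives the vanishing of \<open>r (s x)\<close>.\<close>

lemma split_short_exact:
  assumes A: "right_module E A" and B: "right_module E B" and D: "right_module E D"
    and i: "i \<in> linear_maps E A B" and p: "p \<in> linear_maps E B D"
    and r: "r \<in> linear_maps E B A" and s: "s \<in> linear_maps E D B" and ri: "\<And>x. x \<in> carrier A \<Longrightarrow> r (i x) = x"
    and ps: "\<And>x. x \<in> carrier D \<Longrightarrow> p (s x) = x" and irsp: "\<And>x. x \<in> carrier B \<Longrightarrow> i (r x) \<oplus>\<^bsub>B\<^esub> s (p x) = x"
  shows "\<And>x. x \<in> carrier A \<Longrightarrow> p (i x) = \<zero>\<^bsub>D\<^esub>" "\<And>x. x \<in> carrier D \<Longrightarrow> r (s x) = \<zero>\<^bsub>A\<^esub>"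
    "inj_on i (carrier A)" "i ` carrier A = {y \<in> carrier B. p y = \<zero>\<^bsub>D\<^esub>}" "p ` carrier B = carrier D"
proof -
  interpret A: right_module E A by (rule A)
  interpret B: right_module E B by (rule B)
  interpret D: right_module E D by (rule D)
  note [simp] = linear_mapsD[OF i] linear_mapsD[OF p] linear_mapsD[OF r] linear_mapsD[OF s] ri ps
  show pi: "p (i x) = \<zero>\<^bsub>D\<^esub>" if x: "x \<in> carrier A" for x
    using arg_cong[OF irsp[of "i x"], of p] x by (intro abelian_group_idem_zero[OF D.M.abelian_group_axioms]) simp_all
  show "r (s x) = \<zero>\<^bsub>A\<^esub>" if x: "x \<in> carrier D" for x
    using arg_cong[OF irsp[of "s x"], of r] x by (intro abelian_group_idem_zero[OF A.M.abelian_group_axioms]) simp_all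
  show "inj_on i (carrier A)" by (rule inj_on_inverseI[of _ r]) simp
  show "p ` carrier B = carrier D"
  proof
    show "carrier D \<subseteq> p ` carrier B"
    proof
      fix x assume "x \<in> carrier D" then show "x \<in> p ` carrier B" by (intro image_eqI[of _ _ "s x"]) simp_all
    qed
  qed auto
  show "i ` carrier A = {y \<in> carrier B. p y = \<zero>\<^bsub>D\<^esub>}"
  proof safe
    fix y assume y: "y \<in> carrier B" "p y = \<zero>\<^bsub>D\<^esub>"
    have "i (r y) = y" using irsp[OF y(1)] y linear_map_zero[OF D B s] by simp
    then show "y \<in> i ` carrier A" using y by (intro image_eqI[of _ _ "r y"]) simp_all
  qed (simp_all add: pi)
qed

lemma restrict_eq_iff: "(\<lambda>x\<in>A. f x) = (\<lambda>x\<in>A. g x) \<longleftrightarrow> (\<forall>x\<in>A. f x = g x)"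
  by (auto simp: fun_eq_iff restrict_def)

text \<open>Exactness implies splitness because the third term is projective. The right-hand side is
  the form demanded by \<open>confl_iff\<close> of \<open>idempotent_presentation\<close>.\<close>

lemma Pf_confl_iff:
  fixes E C defines "C \<equiv> Pf E"
  shows "Confl C A i B p D \<longleftrightarrow>
      A \<in> Ob C \<and> B \<in> Ob C \<and> D \<in> Ob C \<and> i \<in> carrier (Hom C A B) \<and> p \<in> carrier (Hom C B D) \<and>
      (\<exists>r\<in>carrier (Hom C B A). \<exists>s\<in>carrier (Hom C D B).
         Cmp C A B A r i = Idn C A \<and> Cmp C D B D p s = Idn C D \<and>
         Cmp C B A B i r \<otimes>\<^bsub>Hom C B B\<^esub> Cmp C B D B s p = Idn C B)" (is "_ \<longleftrightarrow> ?rhs")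
proof
  assume "Confl C A i B p D"
  then have *: "A \<in> Ob C" "B \<in> Ob C" "D \<in> Ob C" "i \<in> linear_maps E A B" "p \<in> linear_maps E B D"
    "inj_on i (carrier A)" "i ` carrier A = {y \<in> carrier B. p y = \<zero>\<^bsub>D\<^esub>}" "p ` carrier B = carrier D"
    by (auto simp: C_def Pf_def)
  obtain r s where rs: "r \<in> linear_maps E B A" "s \<in> linear_maps E D B" "\<And>x. x \<in> carrier A \<Longrightarrow> r (i x) = x"
    "\<And>x. x \<in> carrier D \<Longrightarrow> p (s x) = x" "\<And>x. x \<in> carrier B \<Longrightarrow> i (r x) \<oplus>\<^bsub>B\<^esub> s (p x) = x"
    using short_exact_split[of E A B D i p] * by (auto simp: C_def Pf_simps)
  then have "Cmp C A B A r i = Idn C A" "Cmp C D B D p s = Idn C D"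
    "Cmp C B A B i r \<otimes>\<^bsub>Hom C B B\<^esub> Cmp C B D B s p = Idn C B"
    by (simp_all add: C_def Pf_simps pointwise_group_def compose_def restrict_eq_iff)
  moreover have "r \<in> carrier (Hom C B A)" "s \<in> carrier (Hom C D B)" "i \<in> carrier (Hom C A B)" "p \<in> carrier (Hom C B D)"
    using rs * by (simp_all add: C_def Pf_simps pointwise_group_def)
  ultimately show ?rhs using *(1-3) by blast
next
  assume ?rhs
  then obtain r s where *: "A \<in> Ob C" "B \<in> Ob C" "D \<in> Ob C" "i \<in> linear_maps E A B" "p \<in> linear_maps E B D"
    "r \<in> linear_maps E B A" "s \<in> linear_maps E D B" "\<And>x. x \<in> carrier A \<Longrightarrow> r (i x) = x"
    "\<And>x. x \<in> carrier D \<Longrightarrow> p (s x) = x" "\<And>x. x \<in> carrier B \<Longrightarrow> i (r x) \<oplus>\<^bsub>B\<^esub> s (p x) = x"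
    by (auto simp: C_def Pf_simps pointwise_group_def compose_def restrict_eq_iff)
  then have "right_module E A" "right_module E B" "right_module E D" by (simp_all add: C_def Pf_simps)
  note split_short_exact[OF this *(4-7) *(8) *(9) *(10)]
  then show "Confl C A i B p D" using * by (simp add: C_def Pf_def)
qed

context self_absorbing_ring
begin

text \<open>\<open>X\<close> is a copy of the right ideal \<open>aE\<close>, the image of left
  multiplication by \<open>a\<close>. It is generated by \<open>a\<close>, and since
  \<open>a y = y\<close> on it, the inclusion into \<open>E\<close> is the one coordinate of a dual
  basis.\<close>

lemma summand_of_regular:
  assumes \<iota>: "inj_on \<iota> (carrier E)" and a: "a \<in> carrier E" "a \<otimes> a = a"
  defines "X \<equiv> transport_module \<iota> ((regular_module E)\<lparr>carrier := {x \<in> carrier E. a \<otimes> x = x}\<rparr>)"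
  shows "X \<in> Ob (Pf E)" "(\<lambda>x\<in>carrier E. \<iota> (a \<otimes> x)) \<in> linear_maps E (regular_module E) X"
    "(\<lambda>x\<in>carrier X. inv_into {x \<in> carrier E. a \<otimes> x = x} \<iota> x) \<in> linear_maps E X (regular_module E)"
proof -
  let ?A = "{x \<in> carrier E. a \<otimes> x = x}"
  interpret Reg: right_module E "regular_module E" by (rule right_module_regular)
  let ?S = "(regular_module E)\<lparr>carrier := ?A\<rparr>"
  have "submodule ?A E (regular_module E)"
    by (rule Reg.submoduleI') (use a in \<open>auto simp: r_distr m_assoc[symmetric]\<close>)
  then interpret S: right_module E ?S by (rule Reg.submodule_right_module)
  have inj: "inj_on \<iota> (carrier ?S)" using \<iota> by (rule inj_on_subset) auto
  note [simp] = inv_into_f_f[OF inj[simplified]]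
  interpret X: right_module E X unfolding X_def by (rule S.right_module_transport[OF inj])
  have aA: "a \<in> ?A" using a by simp
  have c: "(\<lambda>x\<in>carrier X. \<lambda>i\<in>{()}. inv_into ?A \<iota> x) \<in> linear_maps E X (free_right_module E {()})"
    by (rule X.restrict_linear) (auto simp: X_def fun_eq_iff m_assoc[symmetric] r_distr a)
  have lin: "lincomb E X (\<lambda>_. \<iota> a) {()} (\<lambda>i\<in>{()}. inv_into ?A \<iota> x) = x" if "x \<in> carrier X" for x
  proof -
    have "x \<in> \<iota> ` ?A" using that by (simp add: X_def)
    then obtain y where y: "y \<in> ?A" "x = \<iota> y" by blast
    have "lincomb E X (\<lambda>_. \<iota> a) {()} (\<lambda>i\<in>{()}. inv_into ?A \<iota> x) = y \<odot>\<^bsub>X\<^esub> \<iota> a"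
      using y aA by (subst X.lincomb_single) (auto simp: X_def)
    then show ?thesis using y aA by (simp add: X_def)
  qed
  have m: "(\<lambda>_. \<iota> a) \<in> {()} \<rightarrow> carrier X" using aA by (auto simp: X_def)
  have "projective E X"
    by (rule projectiveI[OF X.right_module_axioms m _ c]) (simp_all only: restrict_apply' lin inj_on_def, auto)
  moreover have "finitely_generated E X"
    unfolding finitely_generated_def
  proof (intro exI conjI)
    show "submodule_generated E X ((\<lambda>_. \<iota> a) ` {()}) = carrier X"
    proof (rule X.generated_by_lincomb[OF m])
      fix x assume x: "x \<in> carrier X"
      then show "\<exists>f\<in>{()} \<rightarrow> carrier E. lincomb E X (\<lambda>_. \<iota> a) {()} f = x"
        using inv_into_into[of x \<iota> ?A] lin[OF x]
        by (intro bexI[of _ "\<lambda>i\<in>{()}. inv_into ?A \<iota> x"]) (auto simp: X_def)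
    qed
  qed (use aA in \<open>auto simp: X_def\<close>)
  ultimately show "X \<in> Ob (Pf E)" using X.right_module_axioms by (simp add: Pf_simps)
  show "(\<lambda>x\<in>carrier E. \<iota> (a \<otimes> x)) \<in> linear_maps E (regular_module E) X"
    using a by (intro Reg.restrict_linear[simplified]) (auto simp: X_def m_assoc[symmetric] r_distr)
  show "(\<lambda>x\<in>carrier X. inv_into ?A \<iota> x) \<in> linear_maps E X (regular_module E)"
    using S.transport_inverse_linear[OF inj] unfolding X_def by (auto simp: linear_maps_def)
qed

text \<open>A linear map from \<open>E\<close> to itself is left multiplication by its value at one.
  With \<open>M\<close> a retract of \<open>E\<close> by \<open>\<phi>\<close> and
  \<open>\<psi>\<close>, a morphism \<open>f\<close> becomes the endomorphism
  \<open>\<phi> f \<psi>\<close> of \<open>E\<close>, and \<open>\<theta>\<close> records its value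
  at one.\<close>

theorem Pf_presentation:
  assumes large: "\<exists>\<iota> :: 'e \<Rightarrow> 'n. inj_on \<iota> (carrier E)"
  shows "\<exists>e \<theta>. idempotent_presentation (Pf E :: (('e, 'n) module, 'n \<Rightarrow> 'n) exact_cat) E e \<theta>"
proof -
  let ?C = "Pf E :: (('e, 'n) module, 'n \<Rightarrow> 'n) exact_cat" and ?E = "regular_module E"
  have "\<forall>M\<in>Ob ?C. \<exists>\<phi> \<psi>. \<phi> \<in> linear_maps E M ?E \<and> \<psi> \<in> linear_maps E ?E M \<and> (\<forall>x\<in>carrier M. \<psi> (\<phi> x) = x)"
    using retract_of_regular by (auto simp: Pf_simps) blast
  then obtain \<phi> \<psi> where \<phi>: "\<And>M. M \<in> Ob ?C \<Longrightarrow> \<phi> M \<in> linear_maps E M ?E"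
    and \<psi>: "\<And>M. M \<in> Ob ?C \<Longrightarrow> \<psi> M \<in> linear_maps E ?E M"
    and \<psi>\<phi>: "\<And>M x. M \<in> Ob ?C \<Longrightarrow> x \<in> carrier M \<Longrightarrow> \<psi> M (\<phi> M x) = x"
    by metis
  have \<phi>_closed: "\<phi> M x \<in> carrier E" if "M \<in> Ob ?C" "x \<in> carrier M" for M x
    using linear_mapsD(1)[OF \<phi>[OF that(1)] that(2)] by simp
  have \<psi>_closed: "\<psi> M x \<in> carrier M" if "M \<in> Ob ?C" "x \<in> carrier E" for M x
    using linear_mapsD(1)[OF \<psi>[OF that(1)], of x] that by simp
  have \<psi>_one: "\<psi> M x = x \<odot>\<^bsub>M\<^esub> \<psi> M \<one>" if "M \<in> Ob ?C" "x \<in> carrier E" for M x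
    using linear_mapsD(3)[OF \<psi>[OF that(1)] that(2), of \<one>] that by simp
  have \<phi>_smult: "\<phi> M (a \<odot>\<^bsub>M\<^esub> x) = \<phi> M x \<otimes> a" if "M \<in> Ob ?C" "x \<in> carrier M" "a \<in> carrier E" for M x a
    using linear_mapsD(3)[OF \<phi>[OF that(1)] that(3,2)] by simp
  note [simp] = \<phi>_closed \<psi>_closed \<psi>\<phi>
  define e where "e M = \<phi> M (\<psi> M \<one>)" for M
  define \<theta> where "\<theta> M N f = \<phi> N (f (\<psi> M \<one>))" for M N :: "('e, 'n) module" and f
  have hom: "f \<in> linear_maps E M N" if "f \<in> carrier (Hom ?C M N)" for f M N
    using that by (simp add: Pf_simps pointwise_group_def)
  \<comment> \<open>Every element is the image under \<open>\<psi>\<close> of a ring element, hence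
    a multiple of \<open>\<psi> M \<one>\<close>; so the value there determines
    \<open>f\<close>.\<close>
  have f_expand: "f x = \<phi> M x \<odot>\<^bsub>N\<^esub> f (\<psi> M \<one>)"
    if "M \<in> Ob ?C" "f \<in> linear_maps E M N" "x \<in> carrier M" for f M N x
  proof -
    have "x = \<phi> M x \<odot>\<^bsub>M\<^esub> \<psi> M \<one>" using \<psi>_one[OF that(1), of "\<phi> M x"] that by simp
    then have "f x = f (\<phi> M x \<odot>\<^bsub>M\<^esub> \<psi> M \<one>)" by simp
    also have "\<dots> = \<phi> M x \<odot>\<^bsub>N\<^esub> f (\<psi> M \<one>)" using linear_mapsD(3)[OF that(2)] that by simp
    finally show ?thesis .
  qed
  have "idempotent_presentation ?C E e \<theta>"
  proof (intro idempotent_presentation.intro idempotent_presentation_axioms.intro)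
    show "preadditive_category ?C" by (rule preadditive_Pf)
    show "ring E" by (rule ring_axioms)
    show "Confl ?C A i B p D \<longleftrightarrow> A \<in> Ob ?C \<and> B \<in> Ob ?C \<and> D \<in> Ob ?C \<and>
      i \<in> carrier (Hom ?C A B) \<and> p \<in> carrier (Hom ?C B D) \<and>
      (\<exists>r\<in>carrier (Hom ?C B A). \<exists>s\<in>carrier (Hom ?C D B).
         Cmp ?C A B A r i = Idn ?C A \<and> Cmp ?C D B D p s = Idn ?C D \<and>
         Cmp ?C B A B i r \<otimes>\<^bsub>Hom ?C B B\<^esub> Cmp ?C B D B s p = Idn ?C B)" for A i B p D
      by (rule Pf_confl_iff)
  next
    fix A assume "A \<in> Ob ?C"
    then show "\<theta> A A (Idn ?C A) = e A" by (simp add: \<theta>_def e_def Pf_simps(4))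
  next
    fix A B f g assume A: "A \<in> Ob ?C" and B: "B \<in> Ob ?C"
      and "f \<in> carrier (Hom ?C A B)" "g \<in> carrier (Hom ?C A B)"
    then have f: "f \<in> linear_maps E A B" and g: "g \<in> linear_maps E A B" by (auto intro: hom)
    show "\<theta> A B (f \<otimes>\<^bsub>Hom ?C A B\<^esub> g) = \<theta> A B f \<oplus> \<theta> A B g"
      using A B linear_mapsD(1)[OF f] linear_mapsD(1)[OF g] linear_mapsD(2)[OF \<phi>[OF B]]
      by (simp add: \<theta>_def Pf_simps(2) pointwise_group_def)
  next
    fix A B D f g assume A: "A \<in> Ob ?C" and B: "B \<in> Ob ?C" and D: "D \<in> Ob ?C"
      and "f \<in> carrier (Hom ?C A B)" "g \<in> carrier (Hom ?C B D)"
    then have f: "f \<in> linear_maps E A B" and g: "g \<in> linear_maps E B D" by (auto intro: hom)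
    have "\<theta> A D (Cmp ?C A B D g f) = \<phi> D (g (f (\<psi> A \<one>)))"
      using A by (simp add: \<theta>_def Pf_simps(3) compose_def)
    also have "\<dots> = \<phi> D (\<phi> B (f (\<psi> A \<one>)) \<odot>\<^bsub>D\<^esub> g (\<psi> B \<one>))"
      using f_expand[OF B g, of "f (\<psi> A \<one>)"] linear_mapsD(1)[OF f] A by simp
    also have "\<dots> = \<theta> B D g \<otimes> \<theta> A B f"
      unfolding \<theta>_def using A B D linear_mapsD(1)[OF f] linear_mapsD(1)[OF g] by (simp add: \<phi>_smult)
    finally show "\<theta> A D (Cmp ?C A B D g f) = \<theta> B D g \<otimes> \<theta> A B f" .
  next
    fix A B assume A: "A \<in> Ob ?C" and B: "B \<in> Ob ?C"
    interpret A: right_module E A using A by (simp add: Pf_simps)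
    interpret B: right_module E B using B by (simp add: Pf_simps)
    show "bij_betw (\<theta> A B) (carrier (Hom ?C A B)) {x \<in> carrier E. e B \<otimes> x = x \<and> x \<otimes> e A = x}"
    proof (intro bij_betw_imageI inj_onI equalityI subsetI)
      fix f g assume "f \<in> carrier (Hom ?C A B)" "g \<in> carrier (Hom ?C A B)" and eq: "\<theta> A B f = \<theta> A B g"
      then have f: "f \<in> linear_maps E A B" and g: "g \<in> linear_maps E A B" by (auto intro: hom)
      have "\<psi> B (\<theta> A B f) = \<psi> B (\<theta> A B g)" using eq by simp
      then have "f (\<psi> A \<one>) = g (\<psi> A \<one>)"
        using A B linear_mapsD(1)[OF f] linear_mapsD(1)[OF g] by (simp add: \<theta>_def)
      then show "f = g" by (intro linear_maps_eqI[OF f g]) (simp add: f_expand[OF A f] f_expand[OF A g])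
    next
      fix x assume "x \<in> \<theta> A B ` carrier (Hom ?C A B)"
      then obtain f where f: "f \<in> linear_maps E A B" and x: "x = \<theta> A B f" by (auto dest: hom)
      note [simp] = linear_mapsD(1)[OF f]
      have "x = \<phi> B (\<theta> A B f \<odot>\<^bsub>B\<^esub> \<psi> B \<one>)"
        using A B \<psi>_one[OF B, of "\<theta> A B f"] by (simp add: x \<theta>_def)
      then have 1: "e B \<otimes> x = x" using A B by (simp add: \<phi>_smult e_def x \<theta>_def)
      have "f (\<psi> A \<one>) = e A \<odot>\<^bsub>B\<^esub> f (\<psi> A \<one>)" using f_expand[OF A f, of "\<psi> A \<one>"] A by (simp add: e_def)
      then have "x = x \<otimes> e A"
        using A B \<phi>_smult[OF B, of "f (\<psi> A \<one>)" "e A"] by (simp add: x \<theta>_def e_def)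
      with 1 show "x \<in> {x \<in> carrier E. e B \<otimes> x = x \<and> x \<otimes> e A = x}" using A B by (simp add: x \<theta>_def)
    next
      fix x assume x: "x \<in> {x \<in> carrier E. e B \<otimes> x = x \<and> x \<otimes> e A = x}"
      \<comment> \<open>The preimage of \<open>x\<close> under \<open>\<theta>\<close>: left
        multiplication by \<open>x\<close>, seen from \<open>A\<close> to \<open>B\<close> through
        the retractions.\<close>
      define f where "f = compose (carrier A) (compose (carrier ?E) (\<psi> B) (\<lambda>y\<in>carrier ?E. x \<otimes> y)) (\<phi> A)"
      interpret Reg: right_module E ?E by (rule right_module_regular)
      have "f \<in> linear_maps E A B"
        unfolding f_def using x
        by (intro A.compose_linear[OF \<phi>[OF A]] Reg.compose_linear[OF _ \<psi>[OF B]] Reg.restrict_linear)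
          (auto simp: r_distr m_assoc)
      moreover have "\<theta> A B f = x"
      proof -
        have "\<theta> A B f = \<phi> B (\<psi> B (x \<otimes> e A))" using A B by (simp add: f_def compose_def \<theta>_def e_def)
        also have "\<dots> = \<phi> B (x \<odot>\<^bsub>B\<^esub> \<psi> B \<one>)" using x \<psi>_one[OF B, of x] by simp
        also have "\<dots> = x" using x B by (simp add: \<phi>_smult e_def)
        finally show ?thesis .
      qed
      ultimately show "x \<in> \<theta> A B ` carrier (Hom ?C A B)"
        by (intro image_eqI[of _ _ f]) (simp_all add: Pf_simps pointwise_group_def)
    qed
  next
    fix a assume a: "a \<in> carrier E" "a \<otimes> a = a"
    obtain \<iota> :: "'e \<Rightarrow> 'n" where \<iota>: "inj_on \<iota> (carrier E)" using large by blast
    let ?A = "{x \<in> carrier E. a \<otimes> x = x}"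
    define X where "X = transport_module \<iota> (?E\<lparr>carrier := ?A\<rparr>)"
    note X = summand_of_regular[OF \<iota> a, folded X_def]
    have [simp]: "inv_into ?A \<iota> (\<iota> x) = x" if "x \<in> ?A" for x
      using \<iota> that by (intro inv_into_f_f) (auto intro: inj_on_subset)
    let ?k = "inv_into ?A \<iota>"
    have a': "\<iota> a \<in> carrier X" using a by (simp add: X_def)
    have k: "?k x \<in> ?A" if "x \<in> carrier X" for x using that inv_into_into[of x \<iota> ?A] by (simp add: X_def)
    have k\<iota>: "\<iota> (?k x) = x" if "x \<in> carrier X" for x using that by (simp add: X_def f_inv_into_f)
    have gen: "?k x \<odot>\<^bsub>X\<^esub> \<iota> a = x" if "x \<in> carrier X" for x
      using k[OF that] k\<iota>[OF that] a by (simp add: X_def)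
    \<comment> \<open>\<open>?u\<close> stands for the projection onto the copy of \<open>aE\<close>
      followed by \<open>\<phi> X\<close>, and \<open>?v\<close> for \<open>\<psi> X\<close>
      followed by the inclusion of \<open>aE\<close>; each is recorded by its value at one.\<close>
    let ?u = "\<phi> X (\<iota> a)" and ?v = "?k (\<psi> X \<one>)"
    have \<psi>1: "\<psi> X \<one> \<in> carrier X" using X(1) by simp
    have "?u \<otimes> ?v = \<phi> X (?v \<odot>\<^bsub>X\<^esub> \<iota> a)" using \<phi>_smult[OF X(1) a'] k[OF \<psi>1] by simp
    then have 1: "?u \<otimes> ?v = e X" by (simp add: gen[OF \<psi>1] e_def)
    have "?v \<otimes> ?u = ?k (?u \<odot>\<^bsub>X\<^esub> \<psi> X \<one>)"
      using linear_mapsD(3)[OF X(3), of ?u "\<psi> X \<one>"] \<psi>1 X(1) a' right_module.closed[of E X ?u "\<psi> X \<one>"]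
      by (simp add: Pf_simps)
    also have "?u \<odot>\<^bsub>X\<^esub> \<psi> X \<one> = \<iota> a" using \<psi>_one[OF X(1), of ?u] X(1) a' by simp
    also have "?k (\<iota> a) = a" using a by simp
    finally have 2: "?v \<otimes> ?u = a" .
    show "\<exists>X\<in>Ob ?C. \<exists>u\<in>carrier E. \<exists>v\<in>carrier E. u \<otimes> v = e X \<and> v \<otimes> u = a"
      using X(1) 1 2 k[OF \<psi>1] a' by (intro bexI[of _ X] bexI[of _ ?u] bexI[of _ ?v]) simp_all
  qed
  then show ?thesis by blast
qed

end

section \<open>Topological modules\<close>

lemma with_topology_simps [simp]:
  "carrier (with_topology M T) = carrier M" "zero (with_topology M T) = zero M"
  "add (with_topology M T) = add M" "smult (with_topology M T) = smult M" "topo (with_topology M T) = T"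
  by (simp_all add: with_topology_def tmodule.defs module.defs)

lemma tdsum_simps [simp]:
  "carrier (tdsum M N) = carrier M \<times> carrier N" "zero (tdsum M N) = (\<zero>\<^bsub>M\<^esub>, \<zero>\<^bsub>N\<^esub>)"
  "add (tdsum M N) = (\<lambda>u v. (fst u \<oplus>\<^bsub>M\<^esub> fst v, snd u \<oplus>\<^bsub>N\<^esub> snd v))"
  "smult (tdsum M N) = (\<lambda>a u. (a \<odot>\<^bsub>M\<^esub> fst u, a \<odot>\<^bsub>N\<^esub> snd u))"
  "topo (tdsum M N) = prod_topology (topo M) (topo N)"
  by (simp_all add: tdsum_def)

text \<open>Only the module fields are compared, so a \<open>tmodule\<close> inherits its structure
  from the \<open>module\<close> it is built on.\<close>

lemma right_module_cong:
  assumes "right_module E M" "carrier N = carrier M" "zero N = zero M" "add N = add M" "smult N = smult M"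
  shows "right_module E N"
proof -
  interpret M: right_module E M by fact
  have "abelian_group N"
    by (rule abelian_groupI) (auto simp: assms M.M.a_ac intro: bexI[of _ "\<ominus>\<^bsub>M\<^esub> _"] M.M.l_neg)
  then show ?thesis
    by (intro right_module.intro right_module_axioms.intro M.E.ring_axioms)
      (auto simp: assms M.closed M.l_distr M.r_distr M.assoc M.one)
qed

lemma right_module_tdsum: "right_module E M \<Longrightarrow> right_module E N \<Longrightarrow> right_module E (tdsum M N)"
  by (rule right_module_cong[OF right_module_dsum[of E M N]]) simp_all

lemma topological_module_right: "topological_module R M \<Longrightarrow> right_module R M"
  using right_module_iff_module[of R M] by (auto simp: topological_module_def module_def)

lemma topological_moduleI:
  assumes "cring R" "right_module R M" "topspace (topo M) = carrier M"
    "continuous_map (prod_topology (topo M) (topo M)) (topo M) (\<lambda>u. fst u \<oplus>\<^bsub>M\<^esub> snd u)"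
    "\<And>a. a \<in> carrier R \<Longrightarrow> continuous_map (topo M) (topo M) (\<lambda>x. a \<odot>\<^bsub>M\<^esub> x)"
  shows "topological_module R M"
  using assms right_module_iff_module[of R M] by (auto simp: topological_module_def)

lemma topological_module_topspace: "topological_module R M \<Longrightarrow> topspace (topo M) = carrier M"
  by (simp add: topological_module_def)

lemma topological_module_add:
  assumes "topological_module R M" "continuous_map X (topo M) f" "continuous_map X (topo M) g"
  shows "continuous_map X (topo M) (\<lambda>x. f x \<oplus>\<^bsub>M\<^esub> g x)"
proof -
  have "continuous_map X (topo M) ((\<lambda>u. fst u \<oplus>\<^bsub>M\<^esub> snd u) \<circ> (\<lambda>x. (f x, g x)))"
    using assms by (intro continuous_map_compose[of X "prod_topology (topo M) (topo M)"])
      (auto simp: topological_module_def continuous_map_pairwise o_def)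
  then show ?thesis by (simp add: o_def)
qed

lemma topological_module_smult:
  assumes "topological_module R M" "continuous_map X (topo M) f" "a \<in> carrier R"
  shows "continuous_map X (topo M) (\<lambda>x. a \<odot>\<^bsub>M\<^esub> f x)"
  using continuous_map_compose[OF assms(2), of "topo M" "\<lambda>x. a \<odot>\<^bsub>M\<^esub> x"] assms
  by (auto simp: topological_module_def o_def)

lemma clm_linear: "f \<in> continuous_linear_maps R M N \<Longrightarrow> f \<in> linear_maps R M N"
  and clm_continuous: "f \<in> continuous_linear_maps R M N \<Longrightarrow> continuous_map (topo M) (topo N) f"
  by (simp_all add: continuous_linear_maps_def)

lemmas clmD = linear_mapsD[OF clm_linear]

lemma clm_restrictI:
  assumes "right_module R M" "topspace (topo M) = carrier M"
    "\<And>x. x \<in> carrier M \<Longrightarrow> g x \<in> carrier N"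
    "\<And>x y. \<lbrakk>x \<in> carrier M; y \<in> carrier M\<rbrakk> \<Longrightarrow> g (x \<oplus>\<^bsub>M\<^esub> y) = g x \<oplus>\<^bsub>N\<^esub> g y"
    "\<And>a x. \<lbrakk>a \<in> carrier R; x \<in> carrier M\<rbrakk> \<Longrightarrow> g (a \<odot>\<^bsub>M\<^esub> x) = a \<odot>\<^bsub>N\<^esub> g x"
    "continuous_map (topo M) (topo N) g"
  shows "(\<lambda>x\<in>carrier M. g x) \<in> continuous_linear_maps R M N"
  unfolding continuous_linear_maps_def
proof (intro CollectI conjI)
  show "(\<lambda>x\<in>carrier M. g x) \<in> linear_maps R M N"
    by (rule right_module.restrict_linear) (use assms in auto)
  show "continuous_map (topo M) (topo N) (\<lambda>x\<in>carrier M. g x)"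
    by (rule continuous_map_eq[OF assms(6)]) (simp add: assms)
qed

lemma clm_compose:
  assumes "right_module R M" "topspace (topo M) = carrier M"
    "f \<in> continuous_linear_maps R M N" "g \<in> continuous_linear_maps R N K"
  shows "compose (carrier M) g f \<in> continuous_linear_maps R M K"
  unfolding compose_def
proof (rule clm_restrictI[OF assms(1,2)])
  show "continuous_map (topo M) (topo K) (\<lambda>x. g (f x))"
    using continuous_map_compose[OF clm_continuous[OF assms(3)] clm_continuous[OF assms(4)]] by (simp add: o_def)
qed (simp_all add: clmD[OF assms(3)] clmD[OF assms(4)])

lemma clm_id:
  assumes "right_module R M" "topspace (topo M) = carrier M"
  shows "(\<lambda>x\<in>carrier M. x) \<in> continuous_linear_maps R M M"
  by (rule clm_restrictI[OF assms]) auto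

lemma clm_zero:
  assumes "topological_module R M" "topological_module R N"
  shows "(\<lambda>x\<in>carrier M. \<zero>\<^bsub>N\<^esub>) \<in> continuous_linear_maps R M N"
proof -
  interpret N: right_module R N by (rule topological_module_right[OF assms(2)])
  show ?thesis
    using assms by (intro clm_restrictI)
      (auto simp: topological_module_right topological_module_topspace N.smult_zero_right)
qed

lemma clm_add:
  assumes "topological_module R M" "topological_module R N"
    "f \<in> continuous_linear_maps R M N" "g \<in> continuous_linear_maps R M N"
  shows "(\<lambda>x\<in>carrier M. f x \<oplus>\<^bsub>N\<^esub> g x) \<in> continuous_linear_maps R M N"
proof -
  interpret N: right_module R N by (rule topological_module_right[OF assms(2)])
  show ?thesis
    using assms(1,2)
    by (intro clm_restrictI topological_module_add[OF assms(2) clm_continuous[OF assms(3)] clm_continuous[OF assms(4)]])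
      (auto simp: topological_module_right topological_module_topspace N.M.a_ac N.r_distr clmD[OF assms(3)] clmD[OF assms(4)])
qed

lemma clm_smult:
  assumes "cring R" "topological_module R M" "topological_module R N" "a \<in> carrier R"
    "f \<in> continuous_linear_maps R M N"
  shows "(\<lambda>x\<in>carrier M. a \<odot>\<^bsub>N\<^esub> f x) \<in> continuous_linear_maps R M N"
proof -
  interpret R: cring R by fact
  interpret N: right_module R N by (rule topological_module_right[OF assms(3)])
  show ?thesis
  proof (intro clm_restrictI topological_module_smult[OF assms(3) clm_continuous[OF assms(5)] assms(4)])
    fix b x assume *: "b \<in> carrier R" "x \<in> carrier M"
    then show "a \<odot>\<^bsub>N\<^esub> f (b \<odot>\<^bsub>M\<^esub> x) = b \<odot>\<^bsub>N\<^esub> (a \<odot>\<^bsub>N\<^esub> f x)"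
      using assms(4) N.assoc[of a b "f x"] N.assoc[of b a "f x"] R.m_comm[of a b] by (simp add: clmD[OF assms(5)])
  qed (use assms in \<open>auto simp: topological_module_right topological_module_topspace N.r_distr N.closed clmD[OF assms(5)]\<close>)
qed

lemma (in right_module) neg_eq_smult: "x \<in> carrier M \<Longrightarrow> (\<ominus>\<^bsub>E\<^esub> \<one>\<^bsub>E\<^esub>) \<odot>\<^bsub>M\<^esub> x = \<ominus>\<^bsub>M\<^esub> x"
  using l_distr[of "\<ominus>\<^bsub>E\<^esub> \<one>\<^bsub>E\<^esub>" "\<one>\<^bsub>E\<^esub>" x]
  by (intro M.minus_equality[symmetric]) (auto simp: one E.l_neg smult_zero_left closed)

text \<open>Negation is the action of the scalar -1, and scalars act continuously.\<close>

lemma clm_neg: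
  assumes "topological_module R M" "topological_module R N" "f \<in> continuous_linear_maps R M N"
  shows "(\<lambda>x\<in>carrier M. \<ominus>\<^bsub>N\<^esub> f x) \<in> continuous_linear_maps R M N"
proof -
  interpret N: right_module R N by (rule topological_module_right[OF assms(2)])
  have R: "cring R" using assms(1) by (simp add: topological_module_def module_def)
  have "(\<lambda>x\<in>carrier M. (\<ominus>\<^bsub>R\<^esub> \<one>\<^bsub>R\<^esub>) \<odot>\<^bsub>N\<^esub> f x) \<in> continuous_linear_maps R M N"
    by (rule clm_smult[OF R assms(1,2) _ assms(3)]) simp
  also have "(\<lambda>x\<in>carrier M. (\<ominus>\<^bsub>R\<^esub> \<one>\<^bsub>R\<^esub>) \<odot>\<^bsub>N\<^esub> f x) = (\<lambda>x\<in>carrier M. \<ominus>\<^bsub>N\<^esub> f x)"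
    by (rule restrict_ext) (simp add: N.neg_eq_smult clmD[OF assms(3)])
  finally show ?thesis .
qed

lemma topological_isomorphismI:
  assumes M: "topspace (topo M) = carrier M" and N: "topspace (topo N) = carrier N"
    and f: "f \<in> continuous_linear_maps R M N" and g: "g \<in> continuous_linear_maps R N M"
    and "\<And>x. x \<in> carrier M \<Longrightarrow> g (f x) = x" "\<And>y. y \<in> carrier N \<Longrightarrow> f (g y) = y"
  shows "topological_isomorphism R M N f"
  unfolding topological_isomorphism_def
proof (intro conjI)
  show "f \<in> linear_maps R M N" by (rule clm_linear[OF f])
  show "bij_betw f (carrier M) (carrier N)"
    by (rule bij_betw_byWitness[where f' = g]) (use assms clmD(1)[OF f] clmD(1)[OF g] in auto)
  show "homeomorphic_map (topo M) (topo N) f"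
    unfolding homeomorphic_map_maps homeomorphic_maps_def
    using assms clm_continuous[OF f] clm_continuous[OF g] by auto
qed

lemma topological_isomorphismE:
  assumes M: "right_module R M" "topspace (topo M) = carrier M" and N: "right_module R N" "topspace (topo N) = carrier N"
    and f: "topological_isomorphism R M N f"
  obtains g where "f \<in> continuous_linear_maps R M N" "g \<in> continuous_linear_maps R N M"
    "\<And>x. x \<in> carrier M \<Longrightarrow> g (f x) = x" "\<And>y. y \<in> carrier N \<Longrightarrow> f (g y) = y"
proof -
  have f': "f \<in> linear_maps R M N" "bij_betw f (carrier M) (carrier N)" "homeomorphic_map (topo M) (topo N) f"
    using f by (auto simp: topological_isomorphism_def)
  obtain g where g: "g \<in> linear_maps R N M" "\<And>x. x \<in> carrier M \<Longrightarrow> g (f x) = x"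
    "\<And>y. y \<in> carrier N \<Longrightarrow> f (g y) = y"
    using linear_map_inverse[OF M(1) N(1) f'(1,2)] by blast
  obtain h where h: "continuous_map (topo M) (topo N) f" "continuous_map (topo N) (topo M) h"
    "\<And>x. x \<in> carrier M \<Longrightarrow> h (f x) = x"
    using f'(3) unfolding homeomorphic_map_maps homeomorphic_maps_def M N by blast
  \<comment> \<open>The linear inverse and the inverse of the homeomorphism agree on the carrier,
    which makes the former continuous.\<close>
  have "g y = h y" if "y \<in> carrier N" for y using g(3)[OF that] h(3)[of "g y"] linear_mapsD(1)[OF g(1) that] by simp
  then have "continuous_map (topo N) (topo M) g" using continuous_map_eq[OF h(2), of g] N(2) by simp
  then show ?thesis using that f' g h(1) by (simp add: continuous_linear_maps_def)
qed

lemma topologically_isomorphic_sym: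
  assumes "right_module R M" "topspace (topo M) = carrier M" "right_module R N" "topspace (topo N) = carrier N"
    "topologically_isomorphic R M N"
  shows "topologically_isomorphic R N M"
proof -
  obtain f where "topological_isomorphism R M N f" using assms(5) unfolding topologically_isomorphic_def by blast
  then obtain g where "f \<in> continuous_linear_maps R M N" "g \<in> continuous_linear_maps R N M"
    "\<And>x. x \<in> carrier M \<Longrightarrow> g (f x) = x" "\<And>y. y \<in> carrier N \<Longrightarrow> f (g y) = y"
    using topological_isomorphismE[OF assms(1-4)] by blast
  then show ?thesis
    unfolding topologically_isomorphic_def using topological_isomorphismI[OF assms(4,2), of g R f] by blast
qed

lemma topologically_isomorphic_trans:
  assumes "right_module R M" "topspace (topo M) = carrier M" "right_module R N" "topspace (topo N) = carrier N"
    "right_module R K" "topspace (topo K) = carrier K"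
    "topologically_isomorphic R M N" "topologically_isomorphic R N K"
  shows "topologically_isomorphic R M K"
proof -
  obtain f f' where f: "f \<in> continuous_linear_maps R M N" "f' \<in> continuous_linear_maps R N M"
    "\<And>x. x \<in> carrier M \<Longrightarrow> f' (f x) = x" "\<And>y. y \<in> carrier N \<Longrightarrow> f (f' y) = y"
    using assms(7) unfolding topologically_isomorphic_def by (metis topological_isomorphismE[OF assms(1-4)])
  obtain g g' where g: "g \<in> continuous_linear_maps R N K" "g' \<in> continuous_linear_maps R K N"
    "\<And>x. x \<in> carrier N \<Longrightarrow> g' (g x) = x" "\<And>y. y \<in> carrier K \<Longrightarrow> g (g' y) = y"
    using assms(8) unfolding topologically_isomorphic_def by (metis topological_isomorphismE[OF assms(3-6)])
  have "topological_isomorphism R M K (compose (carrier M) g f)"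
    by (rule topological_isomorphismI[OF assms(2,6) clm_compose[OF assms(1,2) f(1) g(1)] clm_compose[OF assms(5,6) g(2) f(2)]])
      (simp_all add: compose_def f g clmD(1)[OF f(1)] clmD(1)[OF f(2)] clmD(1)[OF g(1)] clmD(1)[OF g(2)])
  then show ?thesis unfolding topologically_isomorphic_def by blast
qed

section \<open>Biproducts and split sequences of topological modules\<close>

lemma clm_pair:
  assumes "right_module R X" "topspace (topo X) = carrier X"
    "p \<in> continuous_linear_maps R X Y" "p' \<in> continuous_linear_maps R X Y'"
  shows "(\<lambda>x\<in>carrier X. (p x, p' x)) \<in> continuous_linear_maps R X (tdsum Y Y')"
  using assms(1,2)
  by (rule clm_restrictI)
    (auto simp: clmD[OF assms(3)] clmD[OF assms(4)] clm_continuous[OF assms(3)] clm_continuous[OF assms(4)] intro: continuous_map_pairedI)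

lemma clm_copair:
  assumes "topological_module R X" "right_module R Y" "topspace (topo Y) = carrier Y"
    "right_module R Y'" "topspace (topo Y') = carrier Y'"
    "i \<in> continuous_linear_maps R Y X" "i' \<in> continuous_linear_maps R Y' X"
  shows "(\<lambda>u\<in>carrier (tdsum Y Y'). i (fst u) \<oplus>\<^bsub>X\<^esub> i' (snd u)) \<in> continuous_linear_maps R (tdsum Y Y') X"
proof -
  interpret X: right_module R X by (rule topological_module_right[OF assms(1)])
  note [simp] = clmD[OF assms(6)] clmD[OF assms(7)]
  have "continuous_map (topo (tdsum Y Y')) (topo X) (\<lambda>u. i (fst u))"
    "continuous_map (topo (tdsum Y Y')) (topo X) (\<lambda>u. i' (snd u))"
    using continuous_map_compose[OF continuous_map_fst clm_continuous[OF assms(6)], of "topo Y'"]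
      continuous_map_compose[OF continuous_map_snd clm_continuous[OF assms(7)], of "topo Y"] by (simp_all add: o_def)
  then have "continuous_map (topo (tdsum Y Y')) (topo X) (\<lambda>u. i (fst u) \<oplus>\<^bsub>X\<^esub> i' (snd u))"
    by (rule topological_module_add[OF assms(1)])
  then show ?thesis
    by (intro clm_restrictI right_module_tdsum assms) (auto simp: X.M.a_ac X.r_distr assms(3,5))
qed

text \<open>The inverse is \<open>(y, y') \<mapsto> i y + i' y'\<close>. The cross terms vanish by
  \<open>split_short_exact\<close>, and both maps are continuous, one as a pairing and the other as
  a sum.\<close>

lemma biproduct_isomorphism:
  assumes X: "topological_module R X" and Y: "right_module R Y" "topspace (topo Y) = carrier Y"
    and Y': "right_module R Y'" "topspace (topo Y') = carrier Y'"
    and i: "i \<in> continuous_linear_maps R Y X" and p: "p \<in> continuous_linear_maps R X Y"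
    and i': "i' \<in> continuous_linear_maps R Y' X" and p': "p' \<in> continuous_linear_maps R X Y'"
    and pi: "\<And>y. y \<in> carrier Y \<Longrightarrow> p (i y) = y" and pi': "\<And>y. y \<in> carrier Y' \<Longrightarrow> p' (i' y) = y"
    and ip: "\<And>x. x \<in> carrier X \<Longrightarrow> i (p x) \<oplus>\<^bsub>X\<^esub> i' (p' x) = x"
  shows "topological_isomorphism R X (tdsum Y Y') (\<lambda>x\<in>carrier X. (p x, p' x))"
proof -
  note XR = topological_module_right[OF X] and XT = topological_module_topspace[OF X]
  note s = split_short_exact(1,2)[OF Y(1) XR Y'(1) clm_linear[OF i] clm_linear[OF p'] clm_linear[OF p] clm_linear[OF i']]
  interpret X: right_module R X by (rule XR)
  interpret Y: right_module R Y by (rule Y(1))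
  interpret Y': right_module R Y' by (rule Y'(1))
  have "p' (i y) = \<zero>\<^bsub>Y'\<^esub>" if "y \<in> carrier Y" for y using that by (intro s) (simp_all add: pi pi' ip)
  moreover have "p (i' y) = \<zero>\<^bsub>Y\<^esub>" if "y \<in> carrier Y'" for y using that by (intro s) (simp_all add: pi pi' ip)
  ultimately show ?thesis
    by (intro topological_isomorphismI[OF XT _ clm_pair[OF XR XT p p'] clm_copair[OF X Y Y' i i']])
      (auto simp: Y(2) Y'(2) ip pi pi' clmD[OF i] clmD[OF i'] clmD[OF p] clmD[OF p'])
qed

text \<open>Trades the isomorphism \<open>\<phi>\<close> of the definition for equations, the form
  that functors preserve. Given \<open>\<phi>\<close>, the map \<open>r\<close> is its first
  component and \<open>s\<close> its inverse restricted to pairs with first entry zero; conversely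
  \<open>\<phi>\<close> is the pair of \<open>r\<close> and \<open>p\<close>.\<close>

lemma split_exact_iff:
  assumes A: "topological_module R A" and B: "topological_module R B" and D: "topological_module R D"
  shows "split_exact R A i B p D \<longleftrightarrow>
    i \<in> continuous_linear_maps R A B \<and> p \<in> continuous_linear_maps R B D \<and>
    (\<exists>r\<in>continuous_linear_maps R B A. \<exists>s\<in>continuous_linear_maps R D B.
      (\<forall>x\<in>carrier A. r (i x) = x) \<and> (\<forall>x\<in>carrier D. p (s x) = x) \<and>
      (\<forall>x\<in>carrier B. i (r x) \<oplus>\<^bsub>B\<^esub> s (p x) = x))"
proof
  note AR = topological_module_right[OF A] and AT = topological_module_topspace[OF A]
  note BR = topological_module_right[OF B] and BT = topological_module_topspace[OF B]
  note DR = topological_module_right[OF D] and DT = topological_module_topspace[OF D]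
  interpret A: right_module R A by (rule AR)
  interpret B: right_module R B by (rule BR)
  interpret D: right_module R D by (rule DR)
  have AD: "right_module R (tdsum A D)" "topspace (topo (tdsum A D)) = carrier (tdsum A D)"
    using AR DR AT DT by (simp_all add: right_module_tdsum)
  {
    assume "split_exact R A i B p D"
    then obtain \<phi> where i: "i \<in> continuous_linear_maps R A B" and p: "p \<in> continuous_linear_maps R B D"
      and \<phi>: "topological_isomorphism R B (tdsum A D) \<phi>"
      and \<phi>i: "\<And>a. a \<in> carrier A \<Longrightarrow> \<phi> (i a) = (a, \<zero>\<^bsub>D\<^esub>)" and \<phi>p: "\<And>b. b \<in> carrier B \<Longrightarrow> p b = snd (\<phi> b)"
      by (auto simp: split_exact_def)
    obtain \<psi> where \<phi>: "\<phi> \<in> continuous_linear_maps R B (tdsum A D)" and \<psi>: "\<psi> \<in> continuous_linear_maps R (tdsum A D) B"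
      and \<psi>\<phi>: "\<And>x. x \<in> carrier B \<Longrightarrow> \<psi> (\<phi> x) = x" and \<phi>\<psi>: "\<And>y. y \<in> carrier (tdsum A D) \<Longrightarrow> \<phi> (\<psi> y) = y"
      using topological_isomorphismE[OF BR BT AD \<phi>] by blast
    let ?fst = "\<lambda>u\<in>carrier (tdsum A D). fst u" and ?in = "\<lambda>d\<in>carrier D. (\<zero>\<^bsub>A\<^esub>, d)"
    have r: "compose (carrier B) ?fst \<phi> \<in> continuous_linear_maps R B A"
      by (rule clm_compose[OF BR BT \<phi> clm_restrictI[OF AD]]) (auto intro: continuous_map_fst)
    have s: "compose (carrier D) \<psi> ?in \<in> continuous_linear_maps R D B"
      by (rule clm_compose[OF DR DT clm_restrictI[OF DR DT] \<psi>])
        (auto simp: A.smult_zero_right AT intro!: continuous_map_pairedI)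
    have \<phi>_mem: "fst (\<phi> b) \<in> carrier A" "snd (\<phi> b) \<in> carrier D" "\<phi> b = (fst (\<phi> b), snd (\<phi> b))" if "b \<in> carrier B" for b
      using clmD(1)[OF \<phi> that] by auto
    have "i (compose (carrier B) ?fst \<phi> x) \<oplus>\<^bsub>B\<^esub> compose (carrier D) \<psi> ?in (p x) = x" if x: "x \<in> carrier B" for x
    proof -
      have "i (fst (\<phi> x)) = \<psi> (fst (\<phi> x), \<zero>\<^bsub>D\<^esub>)"
        using \<phi>_mem[OF x] \<psi>\<phi>[of "i (fst (\<phi> x))"] by (simp add: \<phi>i clmD[OF i])
      moreover have "\<psi> (fst (\<phi> x), \<zero>\<^bsub>D\<^esub>) \<oplus>\<^bsub>B\<^esub> \<psi> (\<zero>\<^bsub>A\<^esub>, snd (\<phi> x)) = \<psi> (\<phi> x)"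
        using clmD(2)[OF \<psi>, of "(fst (\<phi> x), \<zero>\<^bsub>D\<^esub>)" "(\<zero>\<^bsub>A\<^esub>, snd (\<phi> x))"] \<phi>_mem[OF x] by simp
      ultimately show ?thesis using x \<phi>_mem[OF x] clmD(1)[OF \<phi> x] by (simp add: compose_def \<phi>p \<psi>\<phi>)
    qed
    moreover have "\<forall>x\<in>carrier D. p (compose (carrier D) \<psi> ?in x) = x"
      by (simp add: compose_def \<phi>p \<phi>\<psi> clmD(1)[OF \<psi>])
    moreover have "\<forall>x\<in>carrier A. compose (carrier B) ?fst \<phi> (i x) = x"
      by (simp add: compose_def \<phi>i clmD(1)[OF i])
    ultimately show "i \<in> continuous_linear_maps R A B \<and> p \<in> continuous_linear_maps R B D \<and>
      (\<exists>r\<in>continuous_linear_maps R B A. \<exists>s\<in>continuous_linear_maps R D B.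
      (\<forall>x\<in>carrier A. r (i x) = x) \<and> (\<forall>x\<in>carrier D. p (s x) = x) \<and>
      (\<forall>x\<in>carrier B. i (r x) \<oplus>\<^bsub>B\<^esub> s (p x) = x))"
      using i p r s by blast
  next
    assume "i \<in> continuous_linear_maps R A B \<and> p \<in> continuous_linear_maps R B D \<and>
      (\<exists>r\<in>continuous_linear_maps R B A. \<exists>s\<in>continuous_linear_maps R D B.
      (\<forall>x\<in>carrier A. r (i x) = x) \<and> (\<forall>x\<in>carrier D. p (s x) = x) \<and>
      (\<forall>x\<in>carrier B. i (r x) \<oplus>\<^bsub>B\<^esub> s (p x) = x))"
    then obtain r s where i: "i \<in> continuous_linear_maps R A B" and p: "p \<in> continuous_linear_maps R B D"
      and r: "r \<in> continuous_linear_maps R B A" and s: "s \<in> continuous_linear_maps R D B"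
      and eq: "\<And>x. x \<in> carrier A \<Longrightarrow> r (i x) = x" "\<And>x. x \<in> carrier D \<Longrightarrow> p (s x) = x"
        "\<And>x. x \<in> carrier B \<Longrightarrow> i (r x) \<oplus>\<^bsub>B\<^esub> s (p x) = x" by blast
    have "p (i x) = \<zero>\<^bsub>D\<^esub>" if "x \<in> carrier A" for x
      using that by (intro split_short_exact(1)[OF AR BR DR clm_linear[OF i] clm_linear[OF p] clm_linear[OF r] clm_linear[OF s]])
        (simp_all add: eq)
    then show "split_exact R A i B p D"
      unfolding split_exact_def
      using i p eq biproduct_isomorphism[OF B AR AT DR DT i r s p]
      by (intro conjI exI[of _ "\<lambda>x\<in>carrier B. (r x, p x)"]) (auto simp: clmD(1)[OF i])
  }
qed

section \<open>Submodules and copies of topological modules\<close>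

lemma topological_module_sub:
  assumes M: "topological_module R M" and L: "submodule L R M"
  shows "topological_module R (sub_tmodule M L)" "(\<lambda>x\<in>L. x) \<in> continuous_linear_maps R (sub_tmodule M L) M"
    "\<And>N f. f \<in> continuous_linear_maps R N M \<Longrightarrow> topspace (topo N) = carrier N \<Longrightarrow> (\<And>x. x \<in> carrier N \<Longrightarrow> f x \<in> L) \<Longrightarrow>
      f \<in> continuous_linear_maps R N (sub_tmodule M L)"
proof -
  interpret M: right_module R M by (rule topological_module_right[OF M])
  interpret L: submodule L R M by (rule L)
  have sub: "L \<subseteq> carrier M" using L.subset by simp
  have simps: "carrier (sub_tmodule M L) = L" "add (sub_tmodule M L) = add M" "smult (sub_tmodule M L) = smult M"
    "zero (sub_tmodule M L) = zero M" "topo (sub_tmodule M L) = subtopology (topo M) L"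
    by (simp_all add: sub_tmodule_def)
  have R: "right_module R (sub_tmodule M L)"
    by (rule right_module_cong[OF M.submodule_right_module[OF L]]) (simp_all add: simps)
  have T: "topspace (subtopology (topo M) L) = L"
    using sub topological_module_topspace[OF M] by auto
  show "topological_module R (sub_tmodule M L)"
  proof (rule topological_moduleI[OF _ R])
    show "cring R" using M by (simp add: topological_module_def module_def)
    let ?T = "topo (sub_tmodule M L)"
    have fs: "continuous_map (prod_topology ?T ?T) (topo M) fst" "continuous_map (prod_topology ?T ?T) (topo M) snd"
      by (simp_all add: simps continuous_map_fst[THEN continuous_map_into_fulltopology]
          continuous_map_snd[THEN continuous_map_into_fulltopology])
    show "continuous_map (prod_topology ?T ?T) ?T (\<lambda>u. fst u \<oplus>\<^bsub>sub_tmodule M L\<^esub> snd u)"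
      using topological_module_add[OF M fs] L.m_closed T
      by (auto simp: simps continuous_map_in_subtopology)
    show "continuous_map ?T ?T (\<lambda>x. a \<odot>\<^bsub>sub_tmodule M L\<^esub> x)" if a: "a \<in> carrier R" for a
      using topological_module_smult[OF M continuous_map_from_subtopology[OF continuous_map_id] a, of L] L.smult_closed[OF a] T
      by (auto simp: simps continuous_map_in_subtopology)
  qed (use sub topological_module_topspace[OF M] in \<open>auto simp: simps\<close>)
  show "(\<lambda>x\<in>L. x) \<in> continuous_linear_maps R (sub_tmodule M L) M"
    using clm_restrictI[OF R, of "\<lambda>x. x" M] sub topological_module_topspace[OF M]
    by (auto simp: simps continuous_map_from_subtopology)
  fix N f assume f: "f \<in> continuous_linear_maps R N M" and N: "topspace (topo N) = carrier N" and fL: "\<And>x. x \<in> carrier N \<Longrightarrow> f x \<in> L"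
  show "f \<in> continuous_linear_maps R N (sub_tmodule M L)"
    using clm_linear[OF f] clm_continuous[OF f] N fL
    by (auto simp: continuous_linear_maps_def linear_maps_def simps continuous_map_in_subtopology PiE_iff)
qed

text \<open>For injective \<open>g\<close>, the pullback along its inverse makes \<open>g\<close> a
  homeomorphism onto its image.\<close>

definition transport_tmodule :: "('b \<Rightarrow> 'c) \<Rightarrow> ('a, 'b) tmodule \<Rightarrow> ('a, 'c) tmodule" where
  "transport_tmodule g M = with_topology (transport_module g M)
     (pullback_topology (g ` carrier M) (inv_into (carrier M) g) (topo M))"

lemma transport_tmodule:
  assumes M: "topological_module R M" and g: "inj_on g (carrier M)"
  shows "topological_module R (transport_tmodule g M)"
    "(\<lambda>x\<in>carrier M. g x) \<in> continuous_linear_maps R M (transport_tmodule g M)"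
    "(\<lambda>x\<in>g ` carrier M. inv_into (carrier M) g x) \<in> continuous_linear_maps R (transport_tmodule g M) M"
proof -
  let ?N = "transport_tmodule g M" and ?h = "inv_into (carrier M) g"
  interpret M: right_module R M by (rule topological_module_right[OF M])
  have simps: "carrier ?N = g ` carrier M" "zero ?N = g \<zero>\<^bsub>M\<^esub>" "add ?N = (\<lambda>x y. g (?h x \<oplus>\<^bsub>M\<^esub> ?h y))"
    "smult ?N = (\<lambda>a x. g (a \<odot>\<^bsub>M\<^esub> ?h x))" "topo ?N = pullback_topology (g ` carrier M) ?h (topo M)"
    by (simp_all add: transport_tmodule_def)
  note hg = inv_into_f_f[OF g]
  have R: "right_module R ?N"
    by (rule right_module_cong[OF M.right_module_transport[OF g]]) (simp_all add: simps)
  have T: "topspace (topo ?N) = carrier ?N"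
    using topological_module_topspace[OF M] by (auto simp: simps topspace_pullback_topology hg)
  have h: "continuous_map (topo ?N) (topo M) ?h"
    using continuous_map_pullback[OF continuous_map_id, of "g ` carrier M" ?h "topo M"] by (simp add: simps o_def id_def)
  \<comment> \<open>Universal property of the pullback: continuity into the copy is tested after
    going back to \<open>M\<close>.\<close>
  have pull: "continuous_map X (topo ?N) (\<lambda>x. g (f x))"
    if f: "continuous_map X (topo M) f" for X :: "'z topology" and f
  proof -
    have fx: "f x \<in> carrier M" if "x \<in> topspace X" for x
      using f that topological_module_topspace[OF M] by (auto simp: continuous_map_def)
    have "continuous_map X (topo M) (?h \<circ> (\<lambda>x. g (f x)))"
      by (rule continuous_map_eq[OF f]) (simp add: fx hg)
    then show ?thesis unfolding simps by (rule continuous_map_pullback') (use fx in auto)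
  qed
  show "topological_module R ?N"
  proof (rule topological_moduleI[OF _ R T])
    show "cring R" using M by (simp add: topological_module_def module_def)
    have fs: "continuous_map (prod_topology (topo ?N) (topo ?N)) (topo M) (\<lambda>u. ?h (fst u))"
      "continuous_map (prod_topology (topo ?N) (topo ?N)) (topo M) (\<lambda>u. ?h (snd u))"
      using continuous_map_compose[OF continuous_map_fst h, of "topo ?N"]
        continuous_map_compose[OF continuous_map_snd h, of "topo ?N"] by (simp_all add: o_def)
    show "continuous_map (prod_topology (topo ?N) (topo ?N)) (topo ?N) (\<lambda>u. fst u \<oplus>\<^bsub>?N\<^esub> snd u)"
      using pull[OF topological_module_add[OF M fs]] by (simp add: simps(3))
    show "continuous_map (topo ?N) (topo ?N) (\<lambda>x. a \<odot>\<^bsub>?N\<^esub> x)" if a: "a \<in> carrier R" for a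
      using pull[OF topological_module_smult[OF M h a]] by (simp add: simps(4))
  qed
  show "(\<lambda>x\<in>carrier M. g x) \<in> continuous_linear_maps R M ?N"
    using pull[OF continuous_map_id] topological_module_topspace[OF M]
    by (intro clm_restrictI M.right_module_axioms) (auto simp: simps(1-4) hg)
  have "(\<lambda>x\<in>carrier ?N. ?h x) \<in> continuous_linear_maps R ?N M"
    by (rule clm_restrictI[OF R T _ _ _ h]) (auto simp: simps(1-4) hg M.closed)
  then show "(\<lambda>x\<in>g ` carrier M. ?h x) \<in> continuous_linear_maps R ?N M" by (simp add: simps)
qed


section \<open>The category of countable Tate modules\<close>

lemma End_algebra_simps [simp]:
  "carrier (End_algebra R X) = continuous_linear_maps R X X"
  "mult (End_algebra R X) = (\<lambda>g f. compose (carrier X) g f)"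
  "one (End_algebra R X) = (\<lambda>x\<in>carrier X. x)" "zero (End_algebra R X) = (\<lambda>x\<in>carrier X. \<zero>\<^bsub>X\<^esub>)"
  "add (End_algebra R X) = (\<lambda>f g. \<lambda>x\<in>carrier X. f x \<oplus>\<^bsub>X\<^esub> g x)"
  "smult (End_algebra R X) = (\<lambda>a f. \<lambda>x\<in>carrier X. a \<odot>\<^bsub>X\<^esub> f x)"
  by (simp_all add: End_algebra_def)

lemma clm_extend: "f \<in> continuous_linear_maps R M N \<Longrightarrow> (\<lambda>x\<in>carrier M. f x) = f"
  by (rule extensional_restrict) (rule clmD(4))

lemma associative_algebra_End:
  assumes R: "cring R" and X: "topological_module R X"
  shows "associative_algebra R (End_algebra R X)"
proof -
  interpret R: cring R by (rule R)
  note XR = topological_module_right[OF X] and XT = topological_module_topspace[OF X]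
  interpret X: right_module R X by (rule XR)
  let ?E = "End_algebra R X"
  have abel: "abelian_group ?E"
  proof (rule abelian_groupI)
    fix f assume "f \<in> carrier ?E"
    then show "\<exists>g\<in>carrier ?E. g \<oplus>\<^bsub>?E\<^esub> f = \<zero>\<^bsub>?E\<^esub>"
      by (intro bexI[of _ "\<lambda>x\<in>carrier X. \<ominus>\<^bsub>X\<^esub> f x"])
        (auto simp: restrict_eq_iff clmD X.M.l_neg clm_neg[OF X X])
  qed (auto simp: restrict_eq_iff clmD X.M.a_ac clm_add[OF X X] clm_zero[OF X X] clm_extend cong: restrict_cong)
  have ring: "ring ?E"
  proof (rule ringI[OF abel])
    show "Group.monoid ?E"
      by (rule monoidI)
        (auto simp: compose_def restrict_eq_iff clmD clm_extend clm_id[OF XR XT] clm_compose[OF XR XT, unfolded compose_def]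
          cong: restrict_cong)
  qed (auto simp: compose_def restrict_eq_iff clmD)
  have "right_module R ?E"
  proof (intro right_module.intro right_module_axioms.intro abel R.ring_axioms)
    fix a b f assume ab: "a \<in> carrier R" "b \<in> carrier R" and f: "f \<in> carrier ?E"
    show "a \<odot>\<^bsub>?E\<^esub> f \<in> carrier ?E" using clm_smult[OF R X X ab(1)] f by simp
    show "(a \<otimes>\<^bsub>R\<^esub> b) \<odot>\<^bsub>?E\<^esub> f = b \<odot>\<^bsub>?E\<^esub> (a \<odot>\<^bsub>?E\<^esub> f)"
      using ab f by (auto simp: restrict_eq_iff clmD X.assoc)
  qed (auto simp: restrict_eq_iff clmD X.l_distr X.r_distr X.one clm_extend cong: restrict_cong)
  then have "module R ?E" using right_module_iff_module[OF R] by blast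
  moreover have "(a \<odot>\<^bsub>?E\<^esub> f) \<otimes>\<^bsub>?E\<^esub> g = a \<odot>\<^bsub>?E\<^esub> (f \<otimes>\<^bsub>?E\<^esub> g) \<and> f \<otimes>\<^bsub>?E\<^esub> (a \<odot>\<^bsub>?E\<^esub> g) = a \<odot>\<^bsub>?E\<^esub> (f \<otimes>\<^bsub>?E\<^esub> g)"
    if "a \<in> carrier R" "f \<in> carrier ?E" "g \<in> carrier ?E" for a f g
    using that by (auto simp: compose_def restrict_eq_iff clmD)
  ultimately show ?thesis using ring by (auto simp: associative_algebra_def)
qed

lemma Tate_simps:
  "M \<in> Ob (Tate_Dr R) \<longleftrightarrow> countable_tate_module R M"
  "Hom (Tate_Dr R) M N = pointwise_group (continuous_linear_maps R M N) (carrier M) N"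
  "Cmp (Tate_Dr R) A B D g f = compose (carrier A) g f"
  "Idn (Tate_Dr R) A = (\<lambda>x\<in>carrier A. x)"
  by (simp_all add: Tate_Dr_def)

lemma Tate_topological: "M \<in> Ob (Tate_Dr R) \<Longrightarrow> topological_module R M"
  by (simp add: Tate_simps countable_tate_module_def)

lemma preadditive_Tate: "preadditive_category (Tate_Dr R)"
proof (rule preadditive_concrete[where H = "continuous_linear_maps R"])
  fix A assume "A \<in> Ob (Tate_Dr R)"
  then show "abelian_group A" using Tate_topological topological_module_right by (metis right_module_def)
next
  fix A B D f g assume "A \<in> Ob (Tate_Dr R)" "f \<in> continuous_linear_maps R A B" "g \<in> continuous_linear_maps R B D"
  then show "compose (carrier A) g f \<in> continuous_linear_maps R A D"
    using clm_compose[OF topological_module_right topological_module_topspace, OF Tate_topological Tate_topological]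
    by blast
qed (auto simp: Tate_simps(2-4) clmD
  intro: clm_zero clm_add clm_neg Tate_topological
    clm_id[OF topological_module_right topological_module_topspace, OF Tate_topological Tate_topological])

lemma Tate_confl_iff:
  fixes R C defines "C \<equiv> Tate_Dr R"
  shows "Confl C A i B p D \<longleftrightarrow>
      A \<in> Ob C \<and> B \<in> Ob C \<and> D \<in> Ob C \<and> i \<in> carrier (Hom C A B) \<and> p \<in> carrier (Hom C B D) \<and>
      (\<exists>r\<in>carrier (Hom C B A). \<exists>s\<in>carrier (Hom C D B).
         Cmp C A B A r i = Idn C A \<and> Cmp C D B D p s = Idn C D \<and>
         Cmp C B A B i r \<otimes>\<^bsub>Hom C B B\<^esub> Cmp C B D B s p = Idn C B)"
\<comment> \<open>\<open>split_exact_iff\<close> speaks of topological modules only; if one of the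
  three terms is not an object, both sides are false.\<close>
proof (cases "A \<in> Ob C \<and> B \<in> Ob C \<and> D \<in> Ob C")
  case True
  then have *: "topological_module R A" "topological_module R B" "topological_module R D"
    by (auto simp: C_def Tate_topological)
  have "Confl C A i B p D \<longleftrightarrow> split_exact R A i B p D" using True by (simp add: C_def Tate_Dr_def)
  then show ?thesis
    using True unfolding split_exact_iff[OF *] C_def Tate_simps(2-4)
    by (simp add: pointwise_group_def compose_def restrict_eq_iff)
next
  case False
  then show ?thesis by (auto simp: C_def Tate_Dr_def)
qed

text \<open>Two properties of \<open>X\<close> carry the proof: every object is a retract of it, and
  its idempotents split in the category. A morphism \<open>f\<close> is recorded as the endomorphism
  \<open>i N f p M\<close> of \<open>X\<close>, and an element \<open>x\<close> of the corner is
  read back as \<open>p B x i A\<close>.\<close>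

theorem Tate_presentation:
  fixes X :: "('a, 'x) tmodule" and R :: "('a, 'y) ring_scheme"
  defines "C \<equiv> Tate_Dr R :: (('a, 'm) tmodule, 'm \<Rightarrow> 'm) exact_cat"
  assumes R: "cring R" and X: "topological_module R X"
    and retract: "\<And>M. M \<in> Ob C \<Longrightarrow> \<exists>i\<in>continuous_linear_maps R M X. \<exists>p\<in>continuous_linear_maps R X M. \<forall>x\<in>carrier M. p (i x) = x"
    and split: "\<And>a. \<lbrakk>a \<in> continuous_linear_maps R X X; \<And>x. x \<in> carrier X \<Longrightarrow> a (a x) = a x\<rbrakk> \<Longrightarrow>
      \<exists>M\<in>Ob C. \<exists>i\<in>continuous_linear_maps R M X. \<exists>p\<in>continuous_linear_maps R X M.
        (\<forall>x\<in>carrier M. p (i x) = x) \<and> (\<forall>x\<in>carrier X. i (p x) = a x)"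
  shows "\<exists>e \<theta>. idempotent_presentation C (End_algebra R X) e \<theta>"
proof -
  let ?E = "End_algebra R X"
  note XR = topological_module_right[OF X] and XT = topological_module_topspace[OF X]
  have R': "right_module R M" and T: "topspace (topo M) = carrier M" if "M \<in> Ob C" for M
    using topological_module_right[OF Tate_topological] topological_module_topspace[OF Tate_topological] that
    by (simp_all add: C_def)
  obtain i p where i: "\<And>M. M \<in> Ob C \<Longrightarrow> i M \<in> continuous_linear_maps R M X"
    and p: "\<And>M. M \<in> Ob C \<Longrightarrow> p M \<in> continuous_linear_maps R X M"
    and pi: "\<And>M x. M \<in> Ob C \<Longrightarrow> x \<in> carrier M \<Longrightarrow> p M (i M x) = x"
    using retract by metis
  note [simp] = pi clmD(1-3)[OF i] clmD(1-3)[OF p]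
  define \<theta> where "\<theta> M N f = compose (carrier X) (i N) (compose (carrier X) f (p M))" for M N :: "('a, 'm) tmodule" and f
  define e where "e M = compose (carrier X) (i M) (p M)" for M
  have \<theta>_apply: "\<theta> M N f x = i N (f (p M x))" if "x \<in> carrier X" for M N f x
    using that by (simp add: \<theta>_def compose_def)
  have e_apply: "e M x = i M (p M x)" if "x \<in> carrier X" for M x using that by (simp add: e_def compose_def)
  have \<theta>_closed: "\<theta> M N f \<in> carrier ?E" if "M \<in> Ob C" "N \<in> Ob C" "f \<in> continuous_linear_maps R M N" for M N f
    unfolding \<theta>_def using that by (auto intro: clm_compose[OF XR XT] i p)
  have C_simps: "Hom C M N = pointwise_group (continuous_linear_maps R M N) (carrier M) N"
    "Cmp C A B D g f = compose (carrier A) g f" "Idn C A = (\<lambda>x\<in>carrier A. x)" for A B D M N f g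
    by (simp_all add: C_def Tate_simps)
  have hom: "carrier (Hom C M N) = continuous_linear_maps R M N" for M N
    by (simp add: C_simps pointwise_group_def)
  have E_ext: "f = g" if "f \<in> carrier ?E" "g \<in> carrier ?E" "\<And>x. x \<in> carrier X \<Longrightarrow> f x = g x" for f g
    using that by (auto intro: linear_maps_eqI clm_linear)
  have ring: "ring ?E" using associative_algebra_End[OF R X] by (simp add: associative_algebra_def)
  interpret E: ring ?E by (rule ring)
  have "idempotent_presentation C ?E e \<theta>"
  proof (intro idempotent_presentation.intro idempotent_presentation_axioms.intro ring)
    show "preadditive_category C" unfolding C_def by (rule preadditive_Tate)
    show "Confl C A i B p D \<longleftrightarrow>
      A \<in> Ob C \<and> B \<in> Ob C \<and> D \<in> Ob C \<and> i \<in> carrier (Hom C A B) \<and> p \<in> carrier (Hom C B D) \<and>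
      (\<exists>r\<in>carrier (Hom C B A). \<exists>s\<in>carrier (Hom C D B).
         Cmp C A B A r i = Idn C A \<and> Cmp C D B D p s = Idn C D \<and>
         Cmp C B A B i r \<otimes>\<^bsub>Hom C B B\<^esub> Cmp C B D B s p = Idn C B)" for A i B p D
      unfolding C_def by (rule Tate_confl_iff)
  next
    fix A assume "A \<in> Ob C"
    then show "\<theta> A A (Idn C A) = e A"
      by (auto simp: C_simps \<theta>_def e_def compose_def restrict_eq_iff)
  next
    fix A B f g assume A: "A \<in> Ob C" and B: "B \<in> Ob C"
      and "f \<in> carrier (Hom C A B)" "g \<in> carrier (Hom C A B)"
    then have f: "f \<in> continuous_linear_maps R A B" and g: "g \<in> continuous_linear_maps R A B" by (auto simp: hom)
    show "\<theta> A B (f \<otimes>\<^bsub>Hom C A B\<^esub> g) = \<theta> A B f \<oplus>\<^bsub>?E\<^esub> \<theta> A B g"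
      using A B clmD[OF f] clmD[OF g]
      by (simp add: C_simps pointwise_group_def \<theta>_def compose_def restrict_eq_iff)
  next
    fix A B D f g assume A: "A \<in> Ob C" and B: "B \<in> Ob C" and D: "D \<in> Ob C"
      and "f \<in> carrier (Hom C A B)" "g \<in> carrier (Hom C B D)"
    then have f: "f \<in> continuous_linear_maps R A B" and g: "g \<in> continuous_linear_maps R B D" by (auto simp: hom)
    show "\<theta> A D (Cmp C A B D g f) = \<theta> B D g \<otimes>\<^bsub>?E\<^esub> \<theta> A B f"
      using A B D clmD[OF f] clmD[OF g]
      by (simp add: C_simps \<theta>_def compose_def restrict_eq_iff)
  next
    fix A B assume A: "A \<in> Ob C" and B: "B \<in> Ob C"
    show "bij_betw (\<theta> A B) (carrier (Hom C A B)) {x \<in> carrier ?E. e B \<otimes>\<^bsub>?E\<^esub> x = x \<and> x \<otimes>\<^bsub>?E\<^esub> e A = x}"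
    proof (intro bij_betw_imageI inj_onI equalityI subsetI)
      fix f g assume "f \<in> carrier (Hom C A B)" "g \<in> carrier (Hom C A B)" and eq: "\<theta> A B f = \<theta> A B g"
      then have f: "f \<in> continuous_linear_maps R A B" and g: "g \<in> continuous_linear_maps R A B" by (auto simp: hom)
      show "f = g"
      proof (rule linear_maps_eqI[OF clm_linear[OF f] clm_linear[OF g]])
        fix x assume x: "x \<in> carrier A"
        then have "p B (\<theta> A B f (i A x)) = p B (\<theta> A B g (i A x))" using eq by simp
        then show "f x = g x" using x A B by (simp add: \<theta>_apply clmD(1)[OF f] clmD(1)[OF g])
      qed
    next
      fix x assume "x \<in> \<theta> A B ` carrier (Hom C A B)"
      then obtain f where f: "f \<in> continuous_linear_maps R A B" and x: "x = \<theta> A B f" by (auto simp: hom)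
      show "x \<in> {x \<in> carrier ?E. e B \<otimes>\<^bsub>?E\<^esub> x = x \<and> x \<otimes>\<^bsub>?E\<^esub> e A = x}"
        using A B \<theta>_closed[OF A B f]
        by (auto simp: x \<theta>_def e_def compose_def restrict_eq_iff clmD(1)[OF f])
    next
      fix x assume x: "x \<in> {x \<in> carrier ?E. e B \<otimes>\<^bsub>?E\<^esub> x = x \<and> x \<otimes>\<^bsub>?E\<^esub> e A = x}"
      then have xE: "x \<in> continuous_linear_maps R X X" by simp
      have eq: "i B (p B (x y)) = x y" "x (i A (p A y)) = x y" if y: "y \<in> carrier X" for y
      proof -
        have "(e B \<otimes>\<^bsub>?E\<^esub> x) y = x y" "(x \<otimes>\<^bsub>?E\<^esub> e A) y = x y" using x by auto
        then show "i B (p B (x y)) = x y" "x (i A (p A y)) = x y"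
          using y by (simp_all add: compose_def e_apply clmD(1)[OF xE])
      qed
      define f where "f = compose (carrier A) (compose (carrier X) (p B) x) (i A)"
      have f: "f \<in> continuous_linear_maps R A B"
        unfolding f_def by (intro clm_compose[OF R'[OF A] T[OF A] i[OF A]] clm_compose[OF XR XT xE p[OF B]])
      moreover have "\<theta> A B f = x"
        by (rule E_ext[OF \<theta>_closed[OF A B f]])
          (use xE A B in \<open>auto simp: \<theta>_apply f_def compose_def eq clmD(1)[OF xE]\<close>)
      ultimately show "x \<in> \<theta> A B ` carrier (Hom C A B)" by (auto simp: hom)
    qed
  next
    fix a assume a: "a \<in> carrier ?E" "a \<otimes>\<^bsub>?E\<^esub> a = a"
    then have a': "a \<in> continuous_linear_maps R X X" by simp
    have "a (a x) = a x" if "x \<in> carrier X" for x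
      using fun_cong[OF a(2), of x] that by (simp add: compose_def)
    then obtain M j q where M: "M \<in> Ob C" and j: "j \<in> continuous_linear_maps R M X"
      and q: "q \<in> continuous_linear_maps R X M"
      and qj: "\<And>x. x \<in> carrier M \<Longrightarrow> q (j x) = x" and jq: "\<And>x. x \<in> carrier X \<Longrightarrow> j (q x) = a x"
      using split[OF a'] by blast
    \<comment> \<open>The idempotents \<open>a\<close> and \<open>e M\<close> split through the same
      object \<open>M\<close>, so crossing the two splittings gives their equivalence.\<close>
    let ?u = "compose (carrier X) (i M) q" and ?v = "compose (carrier X) j (p M)"
    have uv: "?u \<in> carrier ?E" "?v \<in> carrier ?E"
      using clm_compose[OF XR XT q i[OF M]] clm_compose[OF XR XT p[OF M] j] by auto
    note [simp] = clmD(1)[OF q] clmD(1)[OF j]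
    have "?u \<otimes>\<^bsub>?E\<^esub> ?v = e M" using M by (simp add: compose_def restrict_eq_iff qj e_def)
    moreover have "?v \<otimes>\<^bsub>?E\<^esub> ?u = a"
      by (rule E_ext[OF E.m_closed[OF uv(2,1)] a(1)]) (use M in \<open>simp add: compose_def jq\<close>)
    ultimately show "\<exists>M\<in>Ob C. \<exists>u\<in>carrier ?E. \<exists>v\<in>carrier ?E. u \<otimes>\<^bsub>?E\<^esub> v = e M \<and> v \<otimes>\<^bsub>?E\<^esub> u = a"
      using uv M by blast
  qed
  then show ?thesis by blast
qed


section \<open>Linear topologies\<close>

text \<open>A property rather than a construction, so that the discrete, dual and Laurent topologies
  fall under the same lemmas.\<close>

definition basis_at_zero :: "('a, 'b) tmodule \<Rightarrow> 'b set set \<Rightarrow> bool" where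
  "basis_at_zero M B \<longleftrightarrow> (\<forall>U. openin (topo M) U \<longleftrightarrow>
     U \<subseteq> carrier M \<and> (\<forall>x\<in>U. \<exists>V\<in>B. (\<lambda>v. x \<oplus>\<^bsub>M\<^esub> v) ` V \<subseteq> U))"

lemma basis_at_zeroD:
  "basis_at_zero M B \<Longrightarrow> openin (topo M) U \<longleftrightarrow> U \<subseteq> carrier M \<and> (\<forall>x\<in>U. \<exists>V\<in>B. (\<lambda>v. x \<oplus>\<^bsub>M\<^esub> v) ` V \<subseteq> U)"
  by (simp add: basis_at_zero_def)

lemma basis_at_zero_discrete:
  assumes "right_module R M" "topo M = discrete_topology (carrier M)"
  shows "basis_at_zero M {{\<zero>\<^bsub>M\<^esub>}}"
proof -
  interpret M: right_module R M by fact
  show ?thesis using assms(2) by (auto simp: basis_at_zero_def subset_iff)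
qed

context
  fixes R :: "('r, 'x) ring_scheme" and M :: "('r, 'm) tmodule" and B
  assumes M: "right_module R M" and B: "basis_at_zero M B"
    and sub: "\<And>V. V \<in> B \<Longrightarrow> submodule V R M"
begin

interpretation M: right_module R M by (rule M)

lemma basis_sub: "V \<in> B \<Longrightarrow> x \<in> V \<Longrightarrow> x \<in> carrier M"
  using subgroup.subset[OF submodule.axioms(1)[OF sub]] by auto

lemma basis_topspace: "B \<noteq> {} \<Longrightarrow> topspace (topo M) = carrier M"
proof
  assume "B \<noteq> {}"
  then obtain V where V: "V \<in> B" by blast
  have "(\<lambda>v. x \<oplus>\<^bsub>M\<^esub> v) ` V \<subseteq> carrier M" if "x \<in> carrier M" for x
    using that basis_sub[OF V] by auto
  then have "openin (topo M) (carrier M)" using V unfolding basis_at_zeroD[OF B] by blast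
  then show "carrier M \<subseteq> topspace (topo M)" by (rule openin_subset)
  show "topspace (topo M) \<subseteq> carrier M" using basis_at_zeroD[OF B, of "topspace (topo M)"] by simp
qed

lemma basis_coset_open:
  assumes V: "V \<in> B" and x: "x \<in> carrier M"
  shows "openin (topo M) ((\<lambda>v. x \<oplus>\<^bsub>M\<^esub> v) ` V)" "x \<in> (\<lambda>v. x \<oplus>\<^bsub>M\<^esub> v) ` V"
proof -
  interpret V: submodule V R M by (rule sub[OF V])
  show "x \<in> (\<lambda>v. x \<oplus>\<^bsub>M\<^esub> v) ` V" using V.one_closed x by (intro image_eqI[of _ _ "\<zero>\<^bsub>M\<^esub>"]) auto
  show "openin (topo M) ((\<lambda>v. x \<oplus>\<^bsub>M\<^esub> v) ` V)"
    unfolding basis_at_zeroD[OF B]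
  proof (intro conjI ballI)
    show "(\<lambda>v. x \<oplus>\<^bsub>M\<^esub> v) ` V \<subseteq> carrier M" using x basis_sub[OF V] by auto
    fix y assume "y \<in> (\<lambda>v. x \<oplus>\<^bsub>M\<^esub> v) ` V"
    then obtain v where v: "v \<in> V" "y = x \<oplus>\<^bsub>M\<^esub> v" by blast
    have "(\<lambda>w. y \<oplus>\<^bsub>M\<^esub> w) ` V \<subseteq> (\<lambda>v. x \<oplus>\<^bsub>M\<^esub> v) ` V"
    proof safe
      fix w assume w: "w \<in> V"
      then show "y \<oplus>\<^bsub>M\<^esub> w \<in> (\<lambda>v. x \<oplus>\<^bsub>M\<^esub> v) ` V"
        using v x basis_sub[OF V] V.m_closed[OF v(1) w] by (intro image_eqI[of _ _ "v \<oplus>\<^bsub>M\<^esub> w"]) (auto simp: M.M.a_assoc)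
    qed
    then show "\<exists>W\<in>B. (\<lambda>v. y \<oplus>\<^bsub>M\<^esub> v) ` W \<subseteq> (\<lambda>v. x \<oplus>\<^bsub>M\<^esub> v) ` V" using V by blast
  qed
qed

lemma basis_open: "V \<in> B \<Longrightarrow> openin (topo M) V"
proof -
  assume V: "V \<in> B"
  have "(\<lambda>v. \<zero>\<^bsub>M\<^esub> \<oplus>\<^bsub>M\<^esub> v) ` V = V"
    using basis_sub[OF V] by (auto simp: image_iff)
  then show "openin (topo M) V" using basis_coset_open(1)[OF V M.M.zero_closed] by simp
qed

text \<open>For a submodule \<open>V\<close> the cosets of \<open>x\<close> and \<open>y\<close> add
  up to the coset of \<open>x + y\<close>, and a scalar maps the coset of \<open>x\<close> into the
  coset of the multiple.\<close>

lemma topological_module_basis: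
  assumes R: "cring R" and ne: "B \<noteq> {}"
  shows "topological_module R M"
proof (rule topological_moduleI[OF R M basis_topspace[OF ne]])
  show "continuous_map (prod_topology (topo M) (topo M)) (topo M) (\<lambda>u. fst u \<oplus>\<^bsub>M\<^esub> snd u)"
    unfolding continuous_map_def
  proof (intro conjI allI impI)
    show "(\<lambda>u. fst u \<oplus>\<^bsub>M\<^esub> snd u) \<in> topspace (prod_topology (topo M) (topo M)) \<rightarrow> topspace (topo M)"
      by (auto simp: basis_topspace[OF ne])
    fix U assume U: "openin (topo M) U"
    show "openin (prod_topology (topo M) (topo M)) {u \<in> topspace (prod_topology (topo M) (topo M)). fst u \<oplus>\<^bsub>M\<^esub> snd u \<in> U}"
      unfolding openin_prod_topology_alt
    proof (intro allI impI)
      fix x y assume "(x, y) \<in> {u \<in> topspace (prod_topology (topo M) (topo M)). fst u \<oplus>\<^bsub>M\<^esub> snd u \<in> U}"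
      then have xy: "x \<in> carrier M" "y \<in> carrier M" "x \<oplus>\<^bsub>M\<^esub> y \<in> U" by (auto simp: basis_topspace[OF ne])
      then obtain V where V: "V \<in> B" "(\<lambda>v. x \<oplus>\<^bsub>M\<^esub> y \<oplus>\<^bsub>M\<^esub> v) ` V \<subseteq> U"
        using U by (auto simp: basis_at_zeroD[OF B])
      interpret V: submodule V R M by (rule sub[OF V(1)])
      have "(x \<oplus>\<^bsub>M\<^esub> v) \<oplus>\<^bsub>M\<^esub> (y \<oplus>\<^bsub>M\<^esub> w) \<in> U" if vw: "v \<in> V" "w \<in> V" for v w
      proof -
        have "(x \<oplus>\<^bsub>M\<^esub> v) \<oplus>\<^bsub>M\<^esub> (y \<oplus>\<^bsub>M\<^esub> w) = x \<oplus>\<^bsub>M\<^esub> y \<oplus>\<^bsub>M\<^esub> (v \<oplus>\<^bsub>M\<^esub> w)"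
          using xy vw basis_sub[OF V(1)] by (simp add: M.M.a_ac)
        then show ?thesis using V(2) V.m_closed[OF vw] by auto
      qed
      then have "(\<lambda>v. x \<oplus>\<^bsub>M\<^esub> v) ` V \<times> (\<lambda>v. y \<oplus>\<^bsub>M\<^esub> v) ` V \<subseteq>
          {u \<in> topspace (prod_topology (topo M) (topo M)). fst u \<oplus>\<^bsub>M\<^esub> snd u \<in> U}"
        using xy basis_sub[OF V(1)] by (auto simp: basis_topspace[OF ne])
      then show "\<exists>U' V'. openin (topo M) U' \<and> openin (topo M) V' \<and> x \<in> U' \<and> y \<in> V' \<and>
          U' \<times> V' \<subseteq> {u \<in> topspace (prod_topology (topo M) (topo M)). fst u \<oplus>\<^bsub>M\<^esub> snd u \<in> U}"
        using basis_coset_open[OF V(1) xy(1)] basis_coset_open[OF V(1) xy(2)] by blast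
    qed
  qed
  fix a assume a: "a \<in> carrier R"
  show "continuous_map (topo M) (topo M) (\<lambda>x. a \<odot>\<^bsub>M\<^esub> x)"
    unfolding continuous_map_def
  proof (intro conjI allI impI)
    show "(\<lambda>x. a \<odot>\<^bsub>M\<^esub> x) \<in> topspace (topo M) \<rightarrow> topspace (topo M)"
      using a by (auto simp: basis_topspace[OF ne] M.closed)
    fix U assume U: "openin (topo M) U"
    show "openin (topo M) {x \<in> topspace (topo M). a \<odot>\<^bsub>M\<^esub> x \<in> U}"
      unfolding basis_at_zeroD[OF B] basis_topspace[OF ne]
    proof (intro conjI ballI)
      fix x assume x: "x \<in> {x \<in> carrier M. a \<odot>\<^bsub>M\<^esub> x \<in> U}"
      then obtain V where V: "V \<in> B" "(\<lambda>v. a \<odot>\<^bsub>M\<^esub> x \<oplus>\<^bsub>M\<^esub> v) ` V \<subseteq> U"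
        using U by (auto simp: basis_at_zeroD[OF B])
      interpret V: submodule V R M by (rule sub[OF V(1)])
      have "(\<lambda>v. x \<oplus>\<^bsub>M\<^esub> v) ` V \<subseteq> {x \<in> carrier M. a \<odot>\<^bsub>M\<^esub> x \<in> U}"
        using x a V basis_sub[OF V(1)] V.smult_closed[OF a] by (auto simp: M.r_distr)
      then show "\<exists>V\<in>B. (\<lambda>v. x \<oplus>\<^bsub>M\<^esub> v) ` V \<subseteq> {x \<in> carrier M. a \<odot>\<^bsub>M\<^esub> x \<in> U}" using V(1) by blast
    qed auto
  qed
qed

text \<open>If \<open>f\<close> maps \<open>V\<close> into \<open>W\<close>, then by linearity it
  maps \<open>x + V\<close> into \<open>f x + W\<close>; so continuity at zero is enough.\<close>

lemma clm_basisI: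
  assumes ne: "B \<noteq> {}" and N: "right_module R N" "topspace (topo N) = carrier N" "basis_at_zero N B'"
    and f: "f \<in> linear_maps R M N" and le: "\<And>W. W \<in> B' \<Longrightarrow> \<exists>V\<in>B. \<forall>x\<in>V. f x \<in> W"
  shows "f \<in> continuous_linear_maps R M N"
  unfolding continuous_linear_maps_def continuous_map_def
proof (intro CollectI conjI f allI impI)
  show "f \<in> topspace (topo M) \<rightarrow> topspace (topo N)"
    using linear_mapsD(1)[OF f] by (auto simp: basis_topspace[OF ne] N)
  fix U assume U: "openin (topo N) U"
  show "openin (topo M) {x \<in> topspace (topo M). f x \<in> U}"
    unfolding basis_at_zeroD[OF B] basis_topspace[OF ne]
  proof (intro conjI ballI)
    fix x assume x: "x \<in> {x \<in> carrier M. f x \<in> U}"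
    then obtain W where W: "W \<in> B'" "(\<lambda>v. f x \<oplus>\<^bsub>N\<^esub> v) ` W \<subseteq> U"
      using U by (auto simp: basis_at_zeroD[OF N(3)])
    then obtain V where V: "V \<in> B" "\<forall>x\<in>V. f x \<in> W" using le by blast
    have "(\<lambda>v. x \<oplus>\<^bsub>M\<^esub> v) ` V \<subseteq> {x \<in> carrier M. f x \<in> U}"
      using x V W(2) basis_sub[OF V(1)] by (auto simp: linear_mapsD[OF f])
    then show "\<exists>V\<in>B. (\<lambda>v. x \<oplus>\<^bsub>M\<^esub> v) ` V \<subseteq> {x \<in> carrier M. f x \<in> U}" using V(1) by blast
  qed auto
qed

text \<open>\<open>W\<close> may be any open neighbourhood of zero, for instance the zero submodule
  of a discrete target.\<close>

lemma clm_basisD: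
  assumes N: "right_module R N" and f: "f \<in> continuous_linear_maps R M N" and W: "openin (topo N) W" "\<zero>\<^bsub>N\<^esub> \<in> W"
    and ne: "B \<noteq> {}"
  shows "\<exists>V\<in>B. \<forall>x\<in>V. f x \<in> W"
proof -
  have "openin (topo M) {x \<in> topspace (topo M). f x \<in> W}"
    using clm_continuous[OF f] W(1) by (auto simp: continuous_map_def)
  moreover have "\<zero>\<^bsub>M\<^esub> \<in> {x \<in> topspace (topo M). f x \<in> W}"
    using W(2) linear_map_zero[OF M N clm_linear[OF f]] by (simp add: basis_topspace[OF ne])
  ultimately obtain V where V: "V \<in> B" "(\<lambda>v. \<zero>\<^bsub>M\<^esub> \<oplus>\<^bsub>M\<^esub> v) ` V \<subseteq> {x \<in> topspace (topo M). f x \<in> W}"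
    by (auto simp: basis_at_zeroD[OF B])
  then have "f x \<in> W" if "x \<in> V" for x using that basis_sub[OF V(1) that] by (auto simp: image_subset_iff)
  then show ?thesis using V(1) by blast
qed

end

section \<open>Laurent series\<close>

lemma laurent_carrier:
  "f \<in> carrier (laurent R) \<longleftrightarrow> (\<forall>n. f n \<in> carrier R) \<and> (\<exists>N. \<forall>n<N. f n = \<zero>\<^bsub>R\<^esub>)"
  by (simp add: laurent_def laurent_module_def)

lemma laurent_simps [simp]:
  "zero (laurent R) = (\<lambda>n. \<zero>\<^bsub>R\<^esub>)" "add (laurent R) = (\<lambda>f g n. f n \<oplus>\<^bsub>R\<^esub> g n)"
  "smult (laurent R) = (\<lambda>a f n. a \<otimes>\<^bsub>R\<^esub> f n)"
  by (simp_all add: laurent_def laurent_module_def)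

text \<open>This is \<open>t^N R[[t]]\<close>, for an arbitrary integer \<open>N\<close>.\<close>

definition laurent_ball :: "('a, 'x) ring_scheme \<Rightarrow> int \<Rightarrow> (int \<Rightarrow> 'a) set" where
  "laurent_ball R N = {f \<in> carrier (laurent R). \<forall>n<N. f n = \<zero>\<^bsub>R\<^esub>}"

lemma laurent_in_ball: "f \<in> carrier (laurent R) \<Longrightarrow> \<exists>n. f \<in> laurent_ball R n"
  by (auto simp: laurent_ball_def laurent_carrier)

lemma laurent_ball_mono: "N \<le> N' \<Longrightarrow> laurent_ball R N' \<subseteq> laurent_ball R N"
  by (auto simp: laurent_ball_def)

lemma basis_laurent: "basis_at_zero (laurent R) (range (laurent_ball R))"
proof -
  have "carrier (laurent R) = carrier (laurent_module R)" "add (laurent R) = add (laurent_module R)"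
    by (simp_all add: laurent_def)
  then show ?thesis by (simp add: basis_at_zero_def openin_laurent laurent_ball_def)
qed

context cring
begin

lemma right_module_laurent: "right_module R (laurent R)"
proof -
  let ?L = "laurent R"
  have "abelian_group ?L"
  proof (rule abelian_groupI)
    fix f assume f: "f \<in> carrier ?L"
    then have "(\<lambda>n. \<ominus> f n) \<in> carrier ?L" by (force simp: laurent_carrier)
    then show "\<exists>g\<in>carrier ?L. g \<oplus>\<^bsub>?L\<^esub> f = \<zero>\<^bsub>?L\<^esub>"
      using f by (intro bexI[of _ "\<lambda>n. \<ominus> f n"]) (auto simp: laurent_carrier l_neg)
    fix g assume g: "g \<in> carrier ?L"
    obtain N N' where "\<forall>n<N. f n = \<zero>" "\<forall>n<N'. g n = \<zero>" using f g by (auto simp: laurent_carrier)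
    then have "\<forall>n<min N N'. f n \<oplus> g n = \<zero>" by simp
    then have "\<exists>N. \<forall>n<N. f n \<oplus> g n = \<zero>" by blast
    then show "f \<oplus>\<^bsub>?L\<^esub> g \<in> carrier ?L" using f g by (simp add: laurent_carrier)
  qed (auto simp: laurent_carrier fun_eq_iff a_ac)
  then show ?thesis
    by (intro right_module.intro right_module_axioms.intro ring_axioms)
      (auto simp: laurent_carrier fun_eq_iff l_distr r_distr m_ac, metis r_null)
qed

lemma submodule_laurent_ball: "submodule (laurent_ball R N) R (laurent R)"
proof -
  interpret L: right_module R "laurent R" by (rule right_module_laurent)
  show ?thesis
  proof (rule L.submoduleI')
    show "x \<oplus>\<^bsub>laurent R\<^esub> y \<in> laurent_ball R N" if "x \<in> laurent_ball R N" "y \<in> laurent_ball R N" for x y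
      using that L.M.a_closed[of x y] by (simp add: laurent_ball_def)
    show "a \<odot>\<^bsub>laurent R\<^esub> x \<in> laurent_ball R N" if "a \<in> carrier R" "x \<in> laurent_ball R N" for a x
      using that L.closed[of a x] by (simp add: laurent_ball_def)
    show "\<zero>\<^bsub>laurent R\<^esub> \<in> laurent_ball R N" using L.M.zero_closed by (simp add: laurent_ball_def)
  qed (auto simp: laurent_ball_def)
qed

lemma laurent_basis_sub: "V \<in> range (laurent_ball R) \<Longrightarrow> submodule V R (laurent R)"
  using submodule_laurent_ball by blast

lemmas laurent_topspace = basis_topspace[OF right_module_laurent basis_laurent laurent_basis_sub, simplified]
  and topological_module_laurent =
    topological_module_basis[OF right_module_laurent basis_laurent laurent_basis_sub cring_axioms, simplified]
  and laurent_ball_open = basis_open[OF right_module_laurent basis_laurent laurent_basis_sub, OF _ rangeI]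
  and laurent_clmI = clm_basisI[OF right_module_laurent basis_laurent laurent_basis_sub, simplified]
  and laurent_clmD = clm_basisD[OF right_module_laurent basis_laurent laurent_basis_sub, simplified]

text \<open>The first condition keeps orders bounded below, the second one gives continuity.\<close>

lemma laurent_reindex:
  assumes 1: "\<And>N. \<exists>N'. \<forall>n<N'. n \<in> D \<longrightarrow> \<sigma> n < N" and 2: "\<And>N. \<exists>N'. \<forall>n<N. n \<in> D \<longrightarrow> \<sigma> n < N'"
  shows "(\<lambda>f\<in>carrier (laurent R). \<lambda>n. if n \<in> D then f (\<sigma> n) else \<zero>) \<in>
    continuous_linear_maps R (laurent R) (laurent R)" (is "?T \<in> _")
proof (rule laurent_clmI[OF right_module_laurent laurent_topspace basis_laurent])
  interpret L: right_module R "laurent R" by (rule right_module_laurent)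
  have mem: "(\<lambda>n. if n \<in> D then f (\<sigma> n) else \<zero>) \<in> carrier (laurent R)" if f: "f \<in> carrier (laurent R)" for f
  proof -
    obtain N where N: "\<forall>n<N. f n = \<zero>" using f by (auto simp: laurent_carrier)
    obtain N' where "\<forall>n<N'. n \<in> D \<longrightarrow> \<sigma> n < N" using 1 by blast
    with N have "\<forall>n<N'. (if n \<in> D then f (\<sigma> n) else \<zero>) = \<zero>" by auto
    then have "\<exists>N. \<forall>n<N. (if n \<in> D then f (\<sigma> n) else \<zero>) = \<zero>" by blast
    moreover have "\<forall>n. (if n \<in> D then f (\<sigma> n) else \<zero>) \<in> carrier R" using f by (simp add: laurent_carrier)
    ultimately show ?thesis unfolding laurent_carrier by blast
  qed
  show "?T \<in> linear_maps R (laurent R) (laurent R)"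
    by (rule L.restrict_linear, erule mem) (auto simp: fun_eq_iff)
  fix W assume "W \<in> range (laurent_ball R)"
  then obtain N where W: "W = laurent_ball R N" by blast
  obtain N' where "\<forall>n<N. n \<in> D \<longrightarrow> \<sigma> n < N'" using 2 by blast
  then have "\<forall>f\<in>laurent_ball R N'. ?T f \<in> W" by (auto simp: W laurent_ball_def mem)
  then show "\<exists>V. \<forall>f\<in>laurent_ball R V. ?T f \<in> W" by blast
qed

end

lemma (in cring) laurent_neg: "f \<in> carrier (laurent R) \<Longrightarrow> (\<ominus>\<^bsub>laurent R\<^esub> f) n = \<ominus> f n"
proof -
  interpret L: right_module R "laurent R" by (rule right_module_laurent)
  assume f: "f \<in> carrier (laurent R)"
  have "(\<ominus>\<^bsub>laurent R\<^esub> f) n \<oplus> f n = \<zero>" using fun_cong[OF L.M.l_neg[OF f], of n] by simp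
  then show ?thesis
    using f L.M.a_inv_closed[OF f] by (intro minus_equality[symmetric]) (auto simp: laurent_carrier)
qed


section \<open>Retractions onto elementary Tate modules\<close>

context cring
begin

section \<open>The dual of a module with its topology\<close>

text \<open>Commutativity reconciles the scalars of \<open>dual_module\<close> with the right
  multiplication of \<open>regular_module\<close>; from here on functionals are handled as linear
  maps.\<close>

lemma carrier_dual: "carrier (dual R Q) = linear_maps R Q (regular_module R)"
proof -
  have "f x \<otimes> a = a \<otimes> f x"
    if "f \<in> carrier Q \<rightarrow>\<^sub>E carrier R" "x \<in> carrier Q" "a \<in> carrier R" for f a x
    using that by (metis PiE_mem m_comm)
  then show ?thesis by (auto simp: dual_def dual_module_def linear_maps_def)
qed

lemma dual_simps [simp]:
  "zero (dual R Q) = (\<lambda>x\<in>carrier Q. \<zero>)" "add (dual R Q) = (\<lambda>f g. \<lambda>x\<in>carrier Q. f x \<oplus> g x)"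
  "smult (dual R Q) = (\<lambda>a f. \<lambda>x\<in>carrier Q. a \<otimes> f x)"
  by (simp_all add: dual_def dual_module_def)

lemma right_module_dual:
  assumes Q: "right_module R Q"
  shows "right_module R (dual R Q)"
proof -
  interpret Q: right_module R Q by (rule Q)
  note reg = right_module_regular
  note D = linear_mapsD(1,4)[where N = "regular_module R", simplified]
  have ext: "(\<lambda>x\<in>carrier Q. f x) = f" if "f \<in> linear_maps R Q (regular_module R)" for f
    using D(2)[OF that] by (rule extensional_restrict)
  have "abelian_group (dual R Q)"
  proof (rule abelian_groupI)
    fix f assume f: "f \<in> carrier (dual R Q)"
    \<comment> \<open>Negation in \<open>regular_module R\<close> depends on the additive group
      alone, which is that of \<open>R\<close>.\<close>
    have "(\<lambda>x\<in>carrier Q. \<ominus>\<^bsub>regular_module R\<^esub> f x) = (\<lambda>x\<in>carrier Q. \<ominus> f x)"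
      by (simp add: a_inv_def m_inv_def)
    then have "(\<lambda>x\<in>carrier Q. \<ominus> f x) \<in> linear_maps R Q (regular_module R)"
      using linear_maps_neg[OF Q reg, of f] f by (simp add: carrier_dual)
    then show "\<exists>g\<in>carrier (dual R Q). g \<oplus>\<^bsub>dual R Q\<^esub> f = \<zero>\<^bsub>dual R Q\<^esub>"
      using f by (intro bexI[of _ "\<lambda>x\<in>carrier Q. \<ominus> f x"]) (auto simp: carrier_dual restrict_eq_iff l_neg D(1))
    show "\<zero>\<^bsub>dual R Q\<^esub> \<oplus>\<^bsub>dual R Q\<^esub> f = f"
      using ext[of f] f by (auto simp: carrier_dual D(1) cong: restrict_cong)
    fix g assume g: "g \<in> carrier (dual R Q)"
    show "f \<oplus>\<^bsub>dual R Q\<^esub> g \<in> carrier (dual R Q)"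
      using linear_maps_add[OF Q reg, of f g] f g by (simp add: carrier_dual)
    show "f \<oplus>\<^bsub>dual R Q\<^esub> g = g \<oplus>\<^bsub>dual R Q\<^esub> f"
      using f g by (auto simp: D(1) carrier_dual restrict_eq_iff a_comm)
    fix h assume h: "h \<in> carrier (dual R Q)"
    show "f \<oplus>\<^bsub>dual R Q\<^esub> g \<oplus>\<^bsub>dual R Q\<^esub> h = f \<oplus>\<^bsub>dual R Q\<^esub> (g \<oplus>\<^bsub>dual R Q\<^esub> h)"
      using f g h by (auto simp: D(1) carrier_dual restrict_eq_iff a_assoc)
  next
    show "\<zero>\<^bsub>dual R Q\<^esub> \<in> carrier (dual R Q)" using linear_maps_zero[OF Q reg] by (simp add: carrier_dual)
  qed
  then show ?thesis
  proof (intro right_module.intro right_module_axioms.intro ring_axioms)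
    fix a f assume af: "a \<in> carrier R" "f \<in> carrier (dual R Q)"
    then show "a \<odot>\<^bsub>dual R Q\<^esub> f \<in> carrier (dual R Q)"
      unfolding carrier_dual dual_simps
      by (intro Q.restrict_linear)
        (auto simp: r_distr m_ac linear_mapsD[where N = "regular_module R" and f = f and E = R and M = Q, simplified])
  next
    fix f assume "f \<in> carrier (dual R Q)"
    then show "\<one> \<odot>\<^bsub>dual R Q\<^esub> f = f"
      using ext[of f] by (auto simp: D(1) carrier_dual cong: restrict_cong)
  qed (auto simp: carrier_dual restrict_eq_iff D(1) l_distr r_distr m_ac)
qed

definition dual_basis_at_zero :: "('a, 'q) module \<Rightarrow> ('q \<Rightarrow> 'a) set set" where
  "dual_basis_at_zero Q = {annihilator R Q (submodule_generated R Q S) |S. S \<subseteq> carrier Q \<and> finite S}"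

lemma basis_dual: "basis_at_zero (dual R Q) (dual_basis_at_zero Q)"
proof -
  have "carrier (dual R Q) = carrier (dual_module R Q)" "add (dual R Q) = add (dual_module R Q)"
    by (simp_all add: dual_def)
  moreover have "(\<exists>V\<in>dual_basis_at_zero Q. X V) \<longleftrightarrow>
      (\<exists>S. S \<subseteq> carrier Q \<and> finite S \<and> X (annihilator R Q (submodule_generated R Q S)))" for X
    by (auto simp: dual_basis_at_zero_def)
  ultimately show ?thesis by (simp add: basis_at_zero_def openin_dual)
qed

text \<open>The kernel of a functional is a submodule, so vanishing on \<open>S\<close> extends to
  the submodule generated by \<open>S\<close>.\<close>

lemma annihilator_iff:
  assumes "right_module R Q" "S \<subseteq> carrier Q"
  shows "f \<in> annihilator R Q (submodule_generated R Q S) \<longleftrightarrow> f \<in> carrier (dual R Q) \<and> (\<forall>x\<in>S. f x = \<zero>)"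
proof -
  interpret Q: right_module R Q by fact
  have "S \<subseteq> submodule_generated R Q S" by (auto simp: submodule_generated_def)
  moreover have "submodule_generated R Q S \<subseteq> {x \<in> carrier Q. f x = \<zero>}"
    if "f \<in> carrier (dual R Q)" "\<forall>x\<in>S. f x = \<zero>"
    using Q.submodule_generated_in[OF Q.submodule_kernel[OF right_module_regular], of f S] that assms(2)
    by (auto simp: carrier_dual)
  moreover have "carrier (dual_module R Q) = carrier (dual R Q)" by (simp add: dual_def)
  ultimately show ?thesis by (auto simp: annihilator_def)
qed

lemma dual_basis_sub:
  assumes Q: "right_module R Q" and V: "V \<in> dual_basis_at_zero Q"
  shows "submodule V R (dual R Q)"
proof -
  obtain S where S: "S \<subseteq> carrier Q" "V = annihilator R Q (submodule_generated R Q S)"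
    using V by (auto simp: dual_basis_at_zero_def)
  have V_iff: "f \<in> V \<longleftrightarrow> f \<in> carrier (dual R Q) \<and> (\<forall>x\<in>S. f x = \<zero>)" for f
    using annihilator_iff[OF Q S(1)] S(2) by simp
  interpret D: right_module R "dual R Q" by (rule right_module_dual[OF Q])
  show ?thesis
  proof (rule D.submoduleI')
    show "f \<oplus>\<^bsub>dual R Q\<^esub> g \<in> V" if "f \<in> V" "g \<in> V" for f g
      using that D.M.a_closed[of f g] S(1) by (auto simp: V_iff)
    show "a \<odot>\<^bsub>dual R Q\<^esub> f \<in> V" if "a \<in> carrier R" "f \<in> V" for a f
      using that D.closed[of a f] S(1) by (auto simp: V_iff)
    show "\<zero>\<^bsub>dual R Q\<^esub> \<in> V" using D.M.zero_closed S(1) by (auto simp: V_iff)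
  qed (auto simp: V_iff)
qed

lemma dual_basis_nonempty: "dual_basis_at_zero Q \<noteq> {}"
  by (auto simp: dual_basis_at_zero_def)

lemma dual_topspace: "right_module R Q \<Longrightarrow> topspace (topo (dual R Q)) = carrier (dual R Q)"
  by (rule basis_topspace[OF right_module_dual basis_dual dual_basis_sub dual_basis_nonempty])

lemma discrete_tmodule_simps [simp]:
  "carrier (discrete_tmodule M) = carrier M" "zero (discrete_tmodule M) = zero M"
  "add (discrete_tmodule M) = add M" "smult (discrete_tmodule M) = smult M"
  "topo (discrete_tmodule M) = discrete_topology (carrier M)"
  by (simp_all add: discrete_tmodule_def)

lemma right_module_discrete: "right_module R M \<Longrightarrow> right_module R (discrete_tmodule M)"
  by (erule right_module_cong) simp_all

lemma clm_discreteI: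
  assumes "f \<in> linear_maps R M N" "topo M = discrete_topology (carrier M)" "topspace (topo N) = carrier N"
  shows "f \<in> continuous_linear_maps R M N"
  using assms linear_mapsD(1)[OF assms(1)] by (auto simp: continuous_linear_maps_def)

text \<open>The entry \<open>i\<close> is the coefficient of \<open>t^(-1-i)\<close>, so that the
  naturals number the negative exponents.\<close>

definition principal_part :: "(int \<Rightarrow> 'a) \<Rightarrow> nat \<Rightarrow> 'a" where
  "principal_part g = (\<lambda>i. g (-1 - int i))"

lemma principal_part_linear:
  "(\<lambda>g\<in>carrier (laurent R). principal_part g) \<in> linear_maps R (laurent R) (free_right_module R UNIV)"
proof (rule right_module.restrict_linear[OF right_module_laurent])
  fix g assume g: "g \<in> carrier (laurent R)"
  obtain N where N: "\<forall>n<N. g n = \<zero>" using g by (auto simp: laurent_carrier)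
  have "{i. g (-1 - int i) \<noteq> \<zero>} \<subseteq> {..nat (-N)}"
  proof
    fix i assume "i \<in> {i. g (-1 - int i) \<noteq> \<zero>}"
    then have "\<not> -1 - int i < N" using N by blast
    then show "i \<in> {..nat (-N)}" by simp
  qed
  then have "finite {i. g (-1 - int i) \<noteq> \<zero>}" by (rule finite_subset) simp
  then show "principal_part g \<in> carrier (free_right_module R UNIV)"
    using g by (simp add: principal_part_def laurent_carrier PiE_iff)
qed (auto simp: principal_part_def fun_eq_iff laurent_carrier m_comm)

text \<open>
  A dual basis \<open>(p, c)\<close> of \<open>P\<close> and \<open>(q, d)\<close> of \<open>Q\<close> turns \<open>P\<close> into a retract of the principal parts and
  \<open>Q\<^sup>*\<close> into a retract of the power series.
\<close>

context
  fixes P Q :: "('a, 'q) module" and p q :: "nat \<Rightarrow> 'q" and c d :: "'q \<Rightarrow> nat \<Rightarrow> 'a"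
  assumes P: "right_module R P" and Q: "right_module R Q"
    and p: "\<And>i. p i \<in> carrier P" and q: "\<And>i. q i \<in> carrier Q"
    and c: "c \<in> linear_maps R P (free_right_module R UNIV)"
    and d: "d \<in> linear_maps R Q (free_right_module R UNIV)"
begin

interpretation P: right_module R P by (rule P)
interpretation Q: right_module R Q by (rule Q)
interpretation L: right_module R "laurent R" by (rule right_module_laurent)
interpretation Reg: right_module R "regular_module R" by (rule right_module_regular)
interpretation D: right_module R "dual R Q" by (rule right_module_dual[OF Q])
interpretation DP: right_module R "discrete_tmodule P" by (rule right_module_discrete[OF P])

definition embed_discrete :: "'q \<Rightarrow> int \<Rightarrow> 'a" where
  "embed_discrete = (\<lambda>x\<in>carrier P. \<lambda>n. if n < 0 then c x (nat (-1 - n)) else \<zero>)"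

definition embed_dual :: "('q \<Rightarrow> 'a) \<Rightarrow> int \<Rightarrow> 'a" where
  "embed_dual = (\<lambda>f\<in>carrier (dual R Q). \<lambda>n. if n < 0 then \<zero> else f (q (nat n)))"

definition project_discrete :: "(int \<Rightarrow> 'a) \<Rightarrow> 'q" where
  "project_discrete = (\<lambda>g\<in>carrier (laurent R). lincomb R P p UNIV (principal_part g))"

text \<open>The coefficients of \<open>g\<close> at non-negative exponents are used as if they were
  values on the generators, and are extended to \<open>x\<close> by its coordinates
  \<open>d x\<close>, of which only finitely many are non-zero.\<close>

definition project_dual :: "(int \<Rightarrow> 'a) \<Rightarrow> 'q \<Rightarrow> 'a" where
  "project_dual = (\<lambda>g\<in>carrier (laurent R). \<lambda>x\<in>carrier Q. lincomb R (regular_module R) (\<lambda>i. g (int i)) UNIV (d x))"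

lemma c_closed: "x \<in> carrier P \<Longrightarrow> c x i \<in> carrier R" "x \<in> carrier P \<Longrightarrow> finite {i. c x i \<noteq> \<zero>}"
  using linear_mapsD(1)[OF c, of x] by (auto simp: PiE_iff)

lemma d_closed: "x \<in> carrier Q \<Longrightarrow> d x i \<in> carrier R" "x \<in> carrier Q \<Longrightarrow> finite {i. d x i \<noteq> \<zero>}"
  using linear_mapsD(1)[OF d, of x] by (auto simp: PiE_iff)

lemma embed_discrete: "embed_discrete \<in> continuous_linear_maps R (discrete_tmodule P) (laurent R)"
proof (rule clm_discreteI)
  have "(\<lambda>n. if n < 0 then c x (nat (-1 - n)) else \<zero>) \<in> carrier (laurent R)" if x: "x \<in> carrier P" for x
  proof -
    obtain k where k: "{i. c x i \<noteq> \<zero>} \<subseteq> {..<k}" using finite_nat_bounded[OF c_closed(2)[OF x]] by blast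
    \<comment> \<open>Exponents below \<open>-1 - k\<close> belong to indices above
      \<open>k\<close>, where the coordinates of \<open>x\<close> vanish.\<close>
    have "\<forall>n. n < -1 - int k \<longrightarrow> (if n < 0 then c x (nat (-1 - n)) else \<zero>) = \<zero>"
    proof safe
      fix n assume "n < -1 - int k"
      then have "nat (-1 - n) \<notin> {..<k}" by auto
      then show "(if n < 0 then c x (nat (-1 - n)) else \<zero>) = \<zero>" using k by auto
    qed
    then show ?thesis using c_closed(1)[OF x] unfolding laurent_carrier by (metis zero_closed)
  qed
  then have "(\<lambda>x\<in>carrier (discrete_tmodule P). \<lambda>n. if n < 0 then c x (nat (-1 - n)) else \<zero>) \<in>
    linear_maps R (discrete_tmodule P) (laurent R)"
    by (intro DP.restrict_linear) (auto simp: fun_eq_iff linear_mapsD(2,3)[OF c] m_comm c_closed)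
  then show "embed_discrete \<in> linear_maps R (discrete_tmodule P) (laurent R)" by (simp add: embed_discrete_def)
qed (simp_all add: laurent_topspace)

lemma embed_dual: "embed_dual \<in> continuous_linear_maps R (dual R Q) (laurent R)"
proof (rule clm_basisI[OF right_module_dual[OF Q] basis_dual dual_basis_sub[OF Q] dual_basis_nonempty
    right_module_laurent laurent_topspace basis_laurent])
  have mem: "(\<lambda>n. if n < 0 then \<zero> else f (q (nat n))) \<in> carrier (laurent R)" if "f \<in> carrier (dual R Q)" for f
    using linear_mapsD(1)[OF that[unfolded carrier_dual]] q by (auto simp: laurent_carrier)
  then show "embed_dual \<in> linear_maps R (dual R Q) (laurent R)"
    unfolding embed_dual_def by (intro D.restrict_linear) (auto simp: fun_eq_iff q)
  fix W assume "W \<in> range (laurent_ball R)"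
  then obtain N where W: "W = laurent_ball R N" by blast
  \<comment> \<open>A functional that vanishes on the first \<open>N\<close> generators has an image
    of order at least \<open>N\<close>; for \<open>N \<le> 0\<close> the set is empty.\<close>
  let ?S = "q ` {..<nat N}"
  have "embed_dual f \<in> W" if "f \<in> annihilator R Q (submodule_generated R Q ?S)" for f
    using that mem[of f] q by (subst (asm) annihilator_iff[OF Q]) (auto simp: embed_dual_def W laurent_ball_def)
  then show "\<exists>V\<in>dual_basis_at_zero Q. \<forall>x\<in>V. embed_dual x \<in> W"
    using q by (auto simp: dual_basis_at_zero_def intro!: exI[of _ ?S])
qed

lemma project_discrete: "project_discrete \<in> continuous_linear_maps R (laurent R) (discrete_tmodule P)"
proof (rule laurent_clmI[OF right_module_discrete[OF P] _ basis_at_zero_discrete[OF right_module_discrete[OF P]]])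
  have "compose (carrier (laurent R)) (\<lambda>f\<in>carrier (free_right_module R UNIV). lincomb R P p UNIV f)
      (\<lambda>g\<in>carrier (laurent R). principal_part g) \<in> linear_maps R (laurent R) P"
    by (rule L.compose_linear[OF principal_part_linear P.lincomb_linear]) (simp add: p)
  also have "compose (carrier (laurent R)) (\<lambda>f\<in>carrier (free_right_module R UNIV). lincomb R P p UNIV f)
      (\<lambda>g\<in>carrier (laurent R). principal_part g) = project_discrete"
    using linear_mapsD(1)[OF principal_part_linear] by (auto simp: project_discrete_def compose_def restrict_eq_iff)
  finally show "project_discrete \<in> linear_maps R (laurent R) (discrete_tmodule P)" by (simp add: linear_maps_def)
  fix W assume "W \<in> {{\<zero>\<^bsub>discrete_tmodule P\<^esub>}}"
  \<comment> \<open>Power series have no principal part, so the map kills \<open>R[[t]]\<close>,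
    which gives continuity into a discrete module.\<close>
  moreover have "project_discrete g = \<zero>\<^bsub>P\<^esub>" if "g \<in> laurent_ball R 0" for g
    using that by (auto simp: project_discrete_def laurent_ball_def lincomb_def principal_part_def)
  ultimately show "\<exists>V. \<forall>x\<in>laurent_ball R V. project_discrete x \<in> W" by auto
qed simp_all

lemma project_dual: "project_dual \<in> continuous_linear_maps R (laurent R) (dual R Q)"
proof (rule laurent_clmI[OF right_module_dual[OF Q] dual_topspace[OF Q] basis_dual])
  have dx: "d x \<in> carrier (free_right_module R UNIV)" if "x \<in> carrier Q" for x by (rule linear_mapsD(1)[OF d that])
  have g: "(\<lambda>i. g (int i)) \<in> UNIV \<rightarrow> carrier (regular_module R)" if "g \<in> carrier (laurent R)" for g
    using that by (simp add: laurent_carrier)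
  have mem: "(\<lambda>x\<in>carrier Q. lincomb R (regular_module R) (\<lambda>i. g (int i)) UNIV (d x)) \<in> carrier (dual R Q)"
    if "g \<in> carrier (laurent R)" for g
  proof -
    have "compose (carrier Q) (\<lambda>f\<in>carrier (free_right_module R UNIV). lincomb R (regular_module R) (\<lambda>i. g (int i)) UNIV f) d
      \<in> linear_maps R Q (regular_module R)"
      by (rule Q.compose_linear[OF d Reg.lincomb_linear[OF g[OF that]]])
    then show ?thesis unfolding carrier_dual compose_def using dx by (simp cong: restrict_cong del: free_right_module_simps)
  qed
  show "project_dual \<in> linear_maps R (laurent R) (dual R Q)"
    unfolding project_dual_def
  proof (rule L.restrict_linear)
    fix g assume gL: "g \<in> carrier (laurent R)"
    show "(\<lambda>x\<in>carrier Q. lincomb R (regular_module R) (\<lambda>i. g (int i)) UNIV (d x)) \<in> carrier (dual R Q)"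
      by (rule mem[OF gL])
    fix h assume hL: "h \<in> carrier (laurent R)"
    have "lincomb R (regular_module R) (\<lambda>i. g (int i) \<oplus> h (int i)) UNIV f =
      lincomb R (regular_module R) (\<lambda>i. g (int i)) UNIV f \<oplus> lincomb R (regular_module R) (\<lambda>i. h (int i)) UNIV f"
      if f: "f \<in> carrier (free_right_module R UNIV)" for f
    proof -
      have "lincomb R (regular_module R) (\<lambda>i. g (int i) \<oplus> h (int i)) UNIV f =
        finsum (regular_module R) (\<lambda>i. f i \<odot>\<^bsub>regular_module R\<^esub> g (int i) \<oplus>\<^bsub>regular_module R\<^esub> f i \<odot>\<^bsub>regular_module R\<^esub> h (int i))
          {i \<in> UNIV. f i \<noteq> \<zero>}"
        unfolding lincomb_def
        by (rule Reg.M.finsum_cong') (use f gL hL in \<open>auto simp: laurent_carrier l_distr PiE_iff\<close>)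
      also have "\<dots> = lincomb R (regular_module R) (\<lambda>i. g (int i)) UNIV f \<oplus>\<^bsub>regular_module R\<^esub> lincomb R (regular_module R) (\<lambda>i. h (int i)) UNIV f"
        unfolding lincomb_def
        by (rule Reg.M.finsum_addf) (use f gL hL in \<open>auto simp: laurent_carrier PiE_iff\<close>)
      finally show ?thesis by simp
    qed
    then show "(\<lambda>x\<in>carrier Q. lincomb R (regular_module R) (\<lambda>i. (g \<oplus>\<^bsub>laurent R\<^esub> h) (int i)) UNIV (d x)) =
      (\<lambda>x\<in>carrier Q. lincomb R (regular_module R) (\<lambda>i. g (int i)) UNIV (d x)) \<oplus>\<^bsub>dual R Q\<^esub>
      (\<lambda>x\<in>carrier Q. lincomb R (regular_module R) (\<lambda>i. h (int i)) UNIV (d x))"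
      using dx by (auto simp: restrict_eq_iff)
  next
    fix a g assume a: "a \<in> carrier R" and gL: "g \<in> carrier (laurent R)"
    have a_lin: "(\<lambda>y\<in>carrier (regular_module R). a \<otimes> y) \<in> linear_maps R (regular_module R) (regular_module R)"
      using a by (intro Reg.restrict_linear) (auto simp: r_distr m_assoc)
    have "lincomb R (regular_module R) (\<lambda>i. a \<otimes> g (int i)) UNIV f = a \<otimes> lincomb R (regular_module R) (\<lambda>i. g (int i)) UNIV f"
      if f: "f \<in> carrier (free_right_module R UNIV)" for f
    proof -
      have "lincomb R (regular_module R) (\<lambda>i. g (int i)) UNIV f \<in> carrier (regular_module R)"
        using f by (intro Reg.lincomb_closed g[OF gL]) auto
      then show ?thesis
        using linear_map_lincomb[OF right_module_regular right_module_regular a_lin g[OF gL] f] gL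
        by (simp add: laurent_carrier)
    qed
    then show "(\<lambda>x\<in>carrier Q. lincomb R (regular_module R) (\<lambda>i. (a \<odot>\<^bsub>laurent R\<^esub> g) (int i)) UNIV (d x)) =
      a \<odot>\<^bsub>dual R Q\<^esub> (\<lambda>x\<in>carrier Q. lincomb R (regular_module R) (\<lambda>i. g (int i)) UNIV (d x))"
      using dx by (auto simp: restrict_eq_iff)
  qed
  fix W assume "W \<in> dual_basis_at_zero Q"
  then obtain S where S: "S \<subseteq> carrier Q" "finite S" "W = annihilator R Q (submodule_generated R Q S)"
    by (auto simp: dual_basis_at_zero_def)
  \<comment> \<open>From some \<open>k\<close> on the coordinates of all elements of the finite set
    \<open>S\<close> vanish, so a series in \<open>t^k R[[t]]\<close> gives a functional that is
    zero on \<open>S\<close>.\<close>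
  have "finite (\<Union>x\<in>S. {i. d x i \<noteq> \<zero>})" using S d_closed(2) by blast
  then obtain k where k: "(\<Union>x\<in>S. {i. d x i \<noteq> \<zero>}) \<subseteq> {..<k}" using finite_nat_bounded by blast
  have "project_dual f \<in> W" if f: "f \<in> laurent_ball R (int k)" for f
    unfolding S(3) annihilator_iff[OF Q S(1)]
  proof (intro conjI ballI)
    have fL: "f \<in> carrier (laurent R)" using f by (simp add: laurent_ball_def)
    then show "project_dual f \<in> carrier (dual R Q)" using mem by (simp add: project_dual_def)
    fix x assume x: "x \<in> S"
    then have xQ: "x \<in> carrier Q" using S(1) by auto
    have "d x i \<odot>\<^bsub>regular_module R\<^esub> f (int i) = \<zero>\<^bsub>regular_module R\<^esub>" if "d x i \<noteq> \<zero>" for i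
    proof -
      have "i < k" using k x that by blast
      then have "f (int i) = \<zero>" using f by (simp add: laurent_ball_def)
      then show ?thesis using d_closed(1)[OF xQ] by simp
    qed
    then have "lincomb R (regular_module R) (\<lambda>i. f (int i)) UNIV (d x) = \<zero>"
      unfolding lincomb_def by (subst Reg.M.add.finprod_one_eqI) auto
    then show "project_dual f x = \<zero>" using fL xQ by (simp add: project_dual_def)
  qed
  then show "\<exists>V. \<forall>x\<in>laurent_ball R V. project_dual x \<in> W" by blast
qed

lemma project_discrete_embed_discrete: "x \<in> carrier P \<Longrightarrow> project_discrete (embed_discrete x) = lincomb R P p UNIV (c x)"
  using clmD(1)[OF embed_discrete, of x] by (auto simp: project_discrete_def embed_discrete_def principal_part_def)

text \<open>Applying \<open>f\<close> to the expansion of \<open>x\<close> in the dual basis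
  expresses \<open>f x\<close> through the values \<open>f (q i)\<close>, and these are what
  \<open>embed_dual\<close> keeps.\<close>

lemma project_dual_embed_dual:
  assumes dual_basis: "\<And>x. x \<in> carrier Q \<Longrightarrow> lincomb R Q q UNIV (d x) = x" and f: "f \<in> carrier (dual R Q)"
  shows "project_dual (embed_dual f) = f"
proof -
  have f': "f \<in> linear_maps R Q (regular_module R)" using f by (simp add: carrier_dual)
  have "lincomb R (regular_module R) (\<lambda>i. f (q i)) UNIV (d x) = f x" if x: "x \<in> carrier Q" for x
    using linear_map_lincomb[OF Q right_module_regular f' _ linear_mapsD(1)[OF d x], of q] q dual_basis[OF x] by simp
  then have "project_dual (embed_dual f) = (\<lambda>x\<in>carrier Q. f x)"
    using clmD(1)[OF embed_dual f] f by (auto simp: project_dual_def restrict_eq_iff) (simp add: embed_dual_def)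
  then show ?thesis using extensional_restrict[OF linear_mapsD(4)[OF f']] by simp
qed

lemma project_discrete_embed_dual: "f \<in> carrier (dual R Q) \<Longrightarrow> project_discrete (embed_dual f) = \<zero>\<^bsub>P\<^esub>"
  using clmD(1)[OF embed_dual, of f] by (simp add: project_discrete_def) (simp add: embed_dual_def principal_part_def lincomb_def)

lemma project_dual_embed_discrete: "x \<in> carrier P \<Longrightarrow> project_dual (embed_discrete x) = \<zero>\<^bsub>dual R Q\<^esub>"
proof -
  assume x: "x \<in> carrier P"
  have "lincomb R (regular_module R) (\<lambda>i. \<zero>) UNIV (d y) = \<zero>" if "y \<in> carrier Q" for y
    unfolding lincomb_def using d_closed(1)[OF that] by (subst Reg.M.add.finprod_one_eqI) auto
  then show ?thesis
    using clmD(1)[OF embed_discrete, of x] x by (auto simp: project_dual_def restrict_eq_iff) (simp add: embed_discrete_def)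
qed

text \<open>The extra hypotheses say that the coefficients of \<open>g\<close> are recovered from
  the two projections. They hold for free modules with their unit vectors, where the retraction
  becomes an isomorphism.\<close>

lemma embed_project_sum:
  assumes g: "g \<in> carrier (laurent R)" and "c (project_discrete g) = principal_part g" "\<And>i. project_dual g (q i) = g (int i)"
  shows "embed_discrete (project_discrete g) \<oplus>\<^bsub>laurent R\<^esub> embed_dual (project_dual g) = g"
  using assms clmD(1)[OF project_discrete g] clmD(1)[OF project_dual g]
  by (auto simp: embed_discrete_def embed_dual_def fun_eq_iff principal_part_def laurent_carrier)

end


section \<open>Countable Tate modules as retracts of R((t))\<close>

lemma countable_dual_basis:
  assumes "projective R P" "countably_generated R P"
  obtains p :: "nat \<Rightarrow> 'q" and c where "\<And>i. p i \<in> carrier P" "c \<in> linear_maps R P (free_right_module R UNIV)"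
    "\<And>x. x \<in> carrier P \<Longrightarrow> lincomb R P p UNIV (c x) = x"
proof -
  interpret P: right_module R P using assms(1) by (simp add: projective_def)
  obtain S where S: "S \<subseteq> carrier P" "countable S" "submodule_generated R P S = carrier P"
    using assms(2) by (auto simp: countably_generated_def)
  \<comment> \<open>Adding zero makes the set non-empty, so that the naturals can enumerate it, with
    repetitions if it is finite.\<close>
  define p where "p = from_nat_into (insert \<zero>\<^bsub>P\<^esub> S)"
  have range: "p ` UNIV = insert \<zero>\<^bsub>P\<^esub> S" unfolding p_def by (rule range_from_nat_into) (use S in auto)
  have "submodule_generated R P S \<subseteq> submodule_generated R P (p ` UNIV)"
    unfolding range by (auto simp: submodule_generated_def)
  moreover have "submodule_generated R P (p ` UNIV) \<subseteq> carrier P"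
    by (rule P.submodule_generated_in[OF P.submodule_carrier]) (use S range in auto)
  ultimately have gen: "submodule_generated R P (p ` UNIV) = carrier P" using S(3) by simp
  have p: "p \<in> UNIV \<rightarrow> carrier P"
  proof
    fix i
    have "p i \<in> insert \<zero>\<^bsub>P\<^esub> S" unfolding range[symmetric] by simp
    then show "p i \<in> carrier P" using S(1) by auto
  qed
  show ?thesis
    by (rule dual_basis[OF assms(1) p gen], rule that[of p]) (use p in auto)
qed

text \<open>\<open>i\<close> is composed of the inclusion of \<open>M\<close> into its sum with
  \<open>N\<close>, the isomorphism \<open>\<phi>\<close> onto the elementary module, and the
  embedding \<open>J\<close> of the latter; \<open>p\<close> undoes these three steps.\<close>

lemma Tate_retract_of_laurent:
  assumes "countable_tate_module R M"
  shows "\<exists>i\<in>continuous_linear_maps R M (laurent R). \<exists>p\<in>continuous_linear_maps R (laurent R) M. \<forall>x\<in>carrier M. p (i x) = x"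
proof -
  obtain P Q :: "('a, nat \<Rightarrow> 'a) module" and N :: "('a, (nat \<Rightarrow> 'a) \<times> ((nat \<Rightarrow> 'a) \<Rightarrow> 'a)) tmodule"
    where M: "topological_module R M" and P: "projective R P" "countably_generated R P"
      and Q: "projective R Q" "countably_generated R Q" and N: "topological_module R N"
      and iso: "topologically_isomorphic R (tdsum M N) (tdsum (discrete_tmodule P) (dual R Q))"
    using assms by (auto simp: countable_tate_module_def)
  have PR: "right_module R P" and QR: "right_module R Q" using P Q by (auto simp: projective_def)
  obtain p :: "nat \<Rightarrow> nat \<Rightarrow> 'a" and c where p: "\<And>i. p i \<in> carrier P" and c: "c \<in> linear_maps R P (free_right_module R UNIV)"
    and pc: "\<And>x. x \<in> carrier P \<Longrightarrow> lincomb R P p UNIV (c x) = x"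
    using countable_dual_basis[OF P] by blast
  obtain q :: "nat \<Rightarrow> nat \<Rightarrow> 'a" and d where q: "\<And>i. q i \<in> carrier Q" and d: "d \<in> linear_maps R Q (free_right_module R UNIV)"
    and qd: "\<And>x. x \<in> carrier Q \<Longrightarrow> lincomb R Q q UNIV (d x) = x"
    using countable_dual_basis[OF Q] by blast
  note ctx = PR QR p q c d
  note j1 = embed_discrete[OF ctx] and j2 = embed_dual[OF ctx] and k1 = project_discrete[OF ctx] and k2 = project_dual[OF ctx]
  let ?L = "laurent R" and ?S = "tdsum (discrete_tmodule P) (dual R Q)"
  note DP = right_module_discrete[OF PR] and DQ = right_module_dual[OF QR]
  have DPT: "topspace (topo (discrete_tmodule P)) = carrier (discrete_tmodule P)" by simp
  note DQT = dual_topspace[OF QR]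
  interpret M: right_module R M by (rule topological_module_right[OF M])
  interpret N: right_module R N by (rule topological_module_right[OF N])
  interpret P: right_module R P by (rule PR)
  interpret DQ: right_module R "dual R Q" by (rule DQ)
  interpret L: right_module R ?L by (rule right_module_laurent)
  define J where "J = (\<lambda>u\<in>carrier ?S. embed_discrete P c (fst u) \<oplus>\<^bsub>?L\<^esub> embed_dual Q q (snd u))"
  define K where "K = (\<lambda>g\<in>carrier ?L. (project_discrete P p g, project_dual Q d g))"
  have J: "J \<in> continuous_linear_maps R ?S ?L"
    unfolding J_def by (rule clm_copair[OF topological_module_laurent DP DPT DQ DQT j1 j2])
  have K: "K \<in> continuous_linear_maps R ?L ?S"
    unfolding K_def by (rule clm_pair[OF right_module_laurent laurent_topspace k1 k2])
  \<comment> \<open>The mixed terms vanish: the image of a functional has no principal part, and the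
    image of \<open>P\<close> has no coefficients at non-negative exponents.\<close>
  have KJ: "K (J u) = u" if "u \<in> carrier ?S" for u
  proof -
    have u: "fst u \<in> carrier P" "snd u \<in> carrier (dual R Q)" "u = (fst u, snd u)" using that by auto
    have "project_discrete P p (embed_discrete P c (fst u) \<oplus>\<^bsub>?L\<^esub> embed_dual Q q (snd u)) = project_discrete P p (embed_discrete P c (fst u)) \<oplus>\<^bsub>P\<^esub> project_discrete P p (embed_dual Q q (snd u))"
      using clmD(2)[OF k1] clmD(1)[OF j1] clmD(1)[OF j2] u by (simp del: laurent_simps)
    moreover have "project_dual Q d (embed_discrete P c (fst u) \<oplus>\<^bsub>?L\<^esub> embed_dual Q q (snd u)) = project_dual Q d (embed_discrete P c (fst u)) \<oplus>\<^bsub>dual R Q\<^esub> project_dual Q d (embed_dual Q q (snd u))"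
      using clmD(2)[OF k2] clmD(1)[OF j1] clmD(1)[OF j2] u by (simp del: laurent_simps dual_simps)
    ultimately show ?thesis
      using u that clmD(1)[OF J that] project_discrete_embed_discrete[OF ctx u(1)] project_dual_embed_discrete[OF ctx u(1)] project_discrete_embed_dual[OF ctx u(2)] project_dual_embed_dual[OF ctx qd u(2)] pc[OF u(1)]
      by (simp add: K_def J_def del: laurent_simps dual_simps)
  qed
  have MN: "right_module R (tdsum M N)" "topspace (topo (tdsum M N)) = carrier (tdsum M N)"
    using topological_module_topspace[OF M] topological_module_topspace[OF N]
    by (simp_all add: right_module_tdsum M.right_module_axioms N.right_module_axioms)
  have S: "right_module R ?S" "topspace (topo ?S) = carrier ?S"
    using DQT by (simp_all add: right_module_tdsum DP DQ)
  obtain \<phi> \<psi> where \<phi>: "\<phi> \<in> continuous_linear_maps R (tdsum M N) ?S" and \<psi>: "\<psi> \<in> continuous_linear_maps R ?S (tdsum M N)"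
    and \<psi>\<phi>: "\<And>x. x \<in> carrier (tdsum M N) \<Longrightarrow> \<psi> (\<phi> x) = x"
    using iso topological_isomorphismE[OF MN S] unfolding topologically_isomorphic_def by metis
  let ?in = "\<lambda>x\<in>carrier M. (x, \<zero>\<^bsub>N\<^esub>)" and ?fst = "\<lambda>u\<in>carrier (tdsum M N). fst u"
  have inM: "?in \<in> continuous_linear_maps R M (tdsum M N)"
    using topological_module_topspace[OF M] topological_module_topspace[OF N]
    by (intro clm_restrictI M.right_module_axioms) (auto simp: N.smult_zero_right intro!: continuous_map_pairedI)
  have fstM: "?fst \<in> continuous_linear_maps R (tdsum M N) M"
    by (rule clm_restrictI[OF MN]) (auto intro: continuous_map_fst)
  note MR = M.right_module_axioms and MT = topological_module_topspace[OF M]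
  let ?i = "compose (carrier M) J (compose (carrier M) \<phi> ?in)"
  let ?p = "compose (carrier ?L) ?fst (compose (carrier ?L) \<psi> K)"
  have i: "?i \<in> continuous_linear_maps R M ?L"
    by (intro clm_compose[OF MR MT clm_compose[OF MR MT inM \<phi>] J])
  have p: "?p \<in> continuous_linear_maps R ?L M"
    by (intro clm_compose[OF right_module_laurent laurent_topspace clm_compose[OF right_module_laurent laurent_topspace K \<psi>] fstM])
  have "?p (?i x) = x" if x: "x \<in> carrier M" for x
  proof -
    have mem: "(x, \<zero>\<^bsub>N\<^esub>) \<in> carrier (tdsum M N)" using x by simp
    note \<phi>mem = clmD(1)[OF \<phi> mem]
    show ?thesis using x clmD(1)[OF J \<phi>mem] KJ[OF \<phi>mem] \<psi>\<phi>[OF mem] mem by (simp add: compose_def)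
  qed
  then show ?thesis using i p by blast
qed

text \<open>The unit vectors with their coordinates form a dual basis for which the retraction loses
  nothing. The resulting elementary module is the one used to recognise summands of R((t)) as Tate
  modules.\<close>

lemma laurent_elementary:
  defines "F \<equiv> free_right_module R (UNIV :: nat set)"
  shows "\<exists>\<psi>. topological_isomorphism R (laurent R) (tdsum (discrete_tmodule F) (dual R F)) \<psi>"
proof -
  have FR: "right_module R F" unfolding F_def by (rule right_module_free)
  let ?u = "unit_vector R (UNIV :: nat set)" and ?id = "\<lambda>x\<in>carrier F. x"
  have u: "?u i \<in> carrier F" for i unfolding F_def by (rule unit_vector_closed)
  have id: "?id \<in> linear_maps R F (free_right_module R UNIV)"
    using right_module.id_linear[OF FR] by (simp add: F_def)
  have uid: "lincomb R F ?u UNIV (?id x) = x" if "x \<in> carrier F" for x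
    using lincomb_unit_vectors[of x "UNIV :: nat set"] that unfolding F_def by simp
  note ctx = FR FR u u id id
  interpret Reg: right_module R "regular_module R" by (rule right_module_regular)
  have sum: "embed_discrete F ?id (project_discrete F ?u g) \<oplus>\<^bsub>laurent R\<^esub> embed_dual F ?u (project_dual F ?id g) = g" if g: "g \<in> carrier (laurent R)" for g
  proof (rule embed_project_sum[OF ctx g])
    have pp: "principal_part g \<in> carrier F"
      using linear_mapsD(1)[OF principal_part_linear g] g by (simp add: F_def)
    then show "?id (project_discrete F ?u g) = principal_part g"
      using g uid[OF pp] pp by (simp add: project_discrete_def[OF ctx])
    show "project_dual F ?id g (?u i) = g (int i)" for i
      using g u[of i] Reg.lincomb_unit_vector[of "\<lambda>i. g (int i)" UNIV i]
      by (simp add: project_dual_def[OF ctx] laurent_carrier)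
  qed
  have "topological_isomorphism R (laurent R) (tdsum (discrete_tmodule F) (dual R F))
      (\<lambda>x\<in>carrier (laurent R). (project_discrete F ?u x, project_dual F ?id x))"
    by (rule biproduct_isomorphism[OF topological_module_laurent right_module_discrete[OF FR] _ right_module_dual[OF FR]
          dual_topspace[OF FR] embed_discrete[where p = ?u and q = ?u, OF ctx] project_discrete[where p = ?u and q = ?u, OF ctx] embed_dual[where p = ?u and q = ?u, OF ctx] project_dual[where p = ?u and q = ?u, OF ctx]])
      (simp_all only: discrete_tmodule_simps topspace_discrete_topology project_discrete_embed_discrete[where p = ?u and q = ?u, OF ctx] uid project_dual_embed_dual[where p = ?u and q = ?u, OF ctx] sum)
  then show ?thesis by blast
qed

text \<open>The complement of \<open>Y\<close> is the kernel of \<open>p\<close>, onto which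
  \<open>b\<close>, the identity minus \<open>i p\<close>, projects.
  \<open>countable_tate_module\<close> wants it inside the type of the elementary module, so it is
  copied there along the isomorphism \<open>\<psi>\<close>.\<close>

lemma countable_tate_summand:
  assumes Y: "topological_module R Y" and i: "i \<in> continuous_linear_maps R Y (laurent R)"
    and p: "p \<in> continuous_linear_maps R (laurent R) Y" and pi: "\<And>y. y \<in> carrier Y \<Longrightarrow> p (i y) = y"
  shows "countable_tate_module R Y"
proof -
  let ?L = "laurent R"
  define F where "F = free_right_module R (UNIV :: nat set)"
  let ?S = "tdsum (discrete_tmodule F) (dual R F)"
  note LR = right_module_laurent and LT = laurent_topspace and LM = topological_module_laurent
  note YR = topological_module_right[OF Y] and YT = topological_module_topspace[OF Y]
  interpret L: right_module R ?L by (rule LR)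
  interpret Y: right_module R Y by (rule YR)
  have FR: "right_module R F" unfolding F_def by (rule right_module_free)
  have S: "right_module R ?S" "topspace (topo ?S) = carrier ?S"
    using dual_topspace[OF FR] by (simp_all add: right_module_tdsum right_module_discrete[OF FR] right_module_dual[OF FR])
  obtain \<psi> where iso: "topological_isomorphism R ?L ?S \<psi>" using laurent_elementary unfolding F_def by blast
  obtain \<psi>' where \<psi>: "\<psi> \<in> continuous_linear_maps R ?L ?S" "\<And>x. x \<in> carrier ?L \<Longrightarrow> \<psi>' (\<psi> x) = x"
    using topological_isomorphismE[OF LR LT S iso] by blast
  note [simp] = clmD(1-3)[OF i] clmD(1-3)[OF p] pi
  define b where "b = (\<lambda>x\<in>carrier ?L. x \<oplus>\<^bsub>?L\<^esub> \<ominus>\<^bsub>?L\<^esub> i (p x))"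
  have b: "b \<in> continuous_linear_maps R ?L ?L"
    using clm_add[OF LM LM clm_id[OF LR LT] clm_neg[OF LM LM clm_compose[OF LR LT p i]]]
    by (simp add: b_def compose_def cong: restrict_cong)
  let ?B = "{x \<in> carrier ?L. p x = \<zero>\<^bsub>Y\<^esub>}"
  have B: "submodule ?B R ?L" by (rule L.submodule_kernel[OF YR clm_linear[OF p]])
  let ?K = "sub_tmodule ?L ?B"
  note K = topological_module_sub[OF LM B]
  have K_simps: "carrier ?K = ?B" by (simp add: sub_tmodule_def)
  have bK: "b \<in> continuous_linear_maps R ?L ?K"
    by (rule K(3)[OF b LT])
      (simp add: b_def linear_map_neg[OF LR YR clm_linear[OF p]] Y.M.r_neg del: laurent_simps)
  have inj: "inj_on \<psi> (carrier ?K)" by (rule inj_on_inverseI[of _ \<psi>']) (simp add: K_simps \<psi>)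
  define N where "N = transport_tmodule \<psi> ?K"
  note N = transport_tmodule[OF K(1) inj, folded N_def]
  note NR = topological_module_right[OF N(1)] and NT = topological_module_topspace[OF N(1)]
  have N_carrier: "carrier N = \<psi> ` ?B" by (simp add: N_def transport_tmodule_def K_simps)
  let ?g = "\<lambda>x\<in>\<psi> ` carrier ?K. inv_into (carrier ?K) \<psi> x"
  let ?i' = "compose (carrier N) (\<lambda>x\<in>?B. x) ?g" and ?p' = "compose (carrier ?L) (\<lambda>x\<in>carrier ?K. \<psi> x) b"
  have i': "?i' \<in> continuous_linear_maps R N ?L" by (rule clm_compose[OF NR NT N(3) K(2)])
  have p': "?p' \<in> continuous_linear_maps R ?L N" by (rule clm_compose[OF LR LT bK N(2)])
  have b_id: "b x = x" if "x \<in> ?B" for x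
    using that linear_map_zero[OF YR LR clm_linear[OF i]] by (simp add: b_def del: laurent_simps)
  have gi: "inv_into ?B \<psi> (\<psi> x) = x" if "x \<in> ?B" for x
    using inj that unfolding K_simps by (rule inv_into_f_f)
  have bB: "b x \<in> ?B" if "x \<in> carrier ?L" for x using clmD(1)[OF bK that] by (simp add: K_simps)
  have "topological_isomorphism R ?L (tdsum Y N) (\<lambda>x\<in>carrier ?L. (p x, ?p' x))"
  proof (rule biproduct_isomorphism[OF LM YR YT NR NT i p i' p'])
    fix y assume "y \<in> carrier Y" then show "p (i y) = y" by (rule pi)
  next
    fix y assume "y \<in> carrier N"
    then obtain x where x: "x \<in> ?B" "y = \<psi> x" by (auto simp: N_carrier)
    then have "?i' y = x" using gi[OF x(1)] by (simp add: compose_def N_carrier K_simps)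
    then show "?p' (?i' y) = y" using x b_id[OF x(1)] by (simp add: compose_def K_simps)
  next
    fix x assume x: "x \<in> carrier ?L"
    have "?i' (?p' x) = b x"
      using x bB[OF x] gi[OF bB[OF x]] by (simp add: compose_def N_carrier K_simps)
    then show "i (p x) \<oplus>\<^bsub>?L\<^esub> ?i' (?p' x) = x"
      using x by (simp add: b_def L.M.a_ac L.M.r_neg1 L.M.r_neg2 L.M.r_neg del: laurent_simps)
  qed
  then have LYN: "topologically_isomorphic R ?L (tdsum Y N)" by (auto simp: topologically_isomorphic_def)
  have YN: "right_module R (tdsum Y N)" "topspace (topo (tdsum Y N)) = carrier (tdsum Y N)"
    by (simp_all add: right_module_tdsum YR NR YT NT)
  have "topologically_isomorphic R (tdsum Y N) ?S"
    by (rule topologically_isomorphic_trans[OF YN LR LT S topologically_isomorphic_sym[OF LR LT YN LYN]])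
      (use iso in \<open>auto simp: topologically_isomorphic_def\<close>)
  moreover have "projective R F" "countably_generated R F"
    unfolding F_def by (rule projective_free, rule countably_generated_free) simp
  moreover have "module R F" using FR right_module_iff_module[OF cring_axioms] by blast
  ultimately show ?thesis unfolding countable_tate_module_def using Y N(1) by blast
qed

lemma countable_tate_laurent: "countable_tate_module R (laurent R)"
  by (rule countable_tate_summand[OF topological_module_laurent clm_id[OF right_module_laurent laurent_topspace]
    clm_id[OF right_module_laurent laurent_topspace]]) simp

text \<open>The splitting goes through the image of \<open>a\<close>, which for an idempotent is the
  module of its fixed points; \<open>\<iota>\<close> copies it into the type
  \<open>'m\<close>.\<close>

lemma laurent_idempotent_splits:
  fixes \<iota> :: "(int \<Rightarrow> 'a) \<Rightarrow> 'm"
  assumes \<iota>: "inj_on \<iota> (carrier (laurent R))" and a: "a \<in> continuous_linear_maps R (laurent R) (laurent R)"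
    and aa: "\<And>x. x \<in> carrier (laurent R) \<Longrightarrow> a (a x) = a x"
  shows "\<exists>M :: ('a, 'm) tmodule. countable_tate_module R M \<and> (\<exists>i\<in>continuous_linear_maps R M (laurent R).
    \<exists>p\<in>continuous_linear_maps R (laurent R) M.
      (\<forall>x\<in>carrier M. p (i x) = x) \<and> (\<forall>x\<in>carrier (laurent R). i (p x) = a x))"
proof -
  let ?L = "laurent R"
  note LR = right_module_laurent and LT = laurent_topspace and LM = topological_module_laurent
  interpret L: right_module R ?L by (rule LR)
  let ?A = "{x \<in> carrier ?L. a x = x}"
  have A: "submodule ?A R ?L"
    by (rule L.submoduleI') (auto simp: clmD[OF a] L.closed linear_map_zero[OF LR LR clm_linear[OF a]] simp del: laurent_simps)
  let ?K = "sub_tmodule ?L ?A"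
  note K = topological_module_sub[OF LM A]
  have K_simps: "carrier ?K = ?A" by (simp add: sub_tmodule_def)
  have aK: "a \<in> continuous_linear_maps R ?L ?K" by (rule K(3)[OF a LT]) (simp add: aa clmD(1)[OF a])
  have inj: "inj_on \<iota> (carrier ?K)" using \<iota> by (rule inj_on_subset) (simp add: K_simps)
  define M where "M = transport_tmodule \<iota> ?K"
  note M = transport_tmodule[OF K(1) inj, folded M_def]
  note MR = topological_module_right[OF M(1)] and MT = topological_module_topspace[OF M(1)]
  have M_carrier: "carrier M = \<iota> ` ?A" by (simp add: M_def transport_tmodule_def K_simps)
  let ?i = "compose (carrier M) (\<lambda>x\<in>?A. x) (\<lambda>x\<in>\<iota> ` carrier ?K. inv_into (carrier ?K) \<iota> x)"
  let ?p = "compose (carrier ?L) (\<lambda>x\<in>carrier ?K. \<iota> x) a"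
  have i: "?i \<in> continuous_linear_maps R M ?L" by (rule clm_compose[OF MR MT M(3) K(2)])
  have p: "?p \<in> continuous_linear_maps R ?L M" by (rule clm_compose[OF LR LT aK M(2)])
  have gi: "inv_into ?A \<iota> (\<iota> x) = x" if "x \<in> ?A" for x
    using inj that unfolding K_simps by (rule inv_into_f_f)
  have pi: "?p (?i y) = y" if "y \<in> carrier M" for y
  proof -
    obtain x where x: "x \<in> ?A" "y = \<iota> x" using \<open>y \<in> carrier M\<close> unfolding M_carrier by blast
    then have "?i y = x" using gi[OF x(1)] by (simp add: compose_def M_carrier K_simps)
    then show ?thesis using x by (simp add: compose_def K_simps)
  qed
  have ip: "?i (?p x) = a x" if x: "x \<in> carrier ?L" for x
  proof -
    have "a x \<in> ?A" using x by (simp add: aa clmD(1)[OF a])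
    then show ?thesis using x gi[of "a x"] by (simp add: compose_def M_carrier K_simps)
  qed
  have tate: "countable_tate_module R M" using pi by (rule countable_tate_summand[OF M(1) i p])
  have fin: "(\<forall>x\<in>carrier M. ?p (?i x) = x) \<and> (\<forall>x\<in>carrier ?L. ?i (?p x) = a x)"
    by (intro conjI ballI pi ip)
  show ?thesis by (rule exI[of _ M], rule conjI[OF tate], rule bexI[OF _ i], rule bexI[OF _ p], rule fin)
qed

lemma End_laurent_self_absorbing: "self_absorbing_ring (End_algebra R (laurent R))"
proof (intro self_absorbing_ring.intro self_absorbing_ring_axioms.intro)
  let ?L = "laurent R"
  show "ring (End_algebra R ?L)"
    using associative_algebra_End[OF cring_axioms topological_module_laurent] by (simp add: associative_algebra_def)
  fix k :: nat
  txt \<open>\<open>a j\<close> spreads a series over the exponents congruent to \<open>j\<close> modulo \<open>k\<close>, and \<open>b j\<close> reads it off again.\<close>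
  define a where "a j = (\<lambda>f\<in>carrier ?L. \<lambda>n. if n \<in> {n. n mod int k = int j} then f (n div int k) else \<zero>)" for j
  define b where "b j = (\<lambda>f\<in>carrier ?L. \<lambda>n. if n \<in> UNIV then f (int k * n + int j) else \<zero>)" for j
  have a: "a j \<in> continuous_linear_maps R ?L ?L" if "j < k" for j
    unfolding a_def
  proof (rule laurent_reindex)
    have k: "int k > 0" using that by simp
    show "\<exists>N'. \<forall>n<N'. n \<in> {n. n mod int k = int j} \<longrightarrow> n div int k < N" for N
    \<comment> \<open>The quotient \<open>n div k\<close> is below \<open>N\<close> as soon as
      \<open>n\<close> is below \<open>k N\<close>.\<close>
    proof (intro exI[of _ "int k * N"] allI impI)
      fix n assume "n < int k * N"
      moreover have "int k * (n div int k) + n mod int k = n" "0 \<le> n mod int k" using k by simp_all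
      ultimately have "int k * (n div int k) < int k * N" by linarith
      then show "n div int k < N" using k by simp
    qed
    show "\<exists>N'. \<forall>n<N. n \<in> {n. n mod int k = int j} \<longrightarrow> n div int k < N'" for N
    proof (intro exI[of _ "N div int k + 1"] allI impI)
      fix n assume "n < N"
      then have "n div int k \<le> N div int k" using k by (intro zdiv_mono1) auto
      then show "n div int k < N div int k + 1" by simp
    qed
  qed
  have b: "b j \<in> continuous_linear_maps R ?L ?L" if "j < k" for j
    unfolding b_def
  proof (rule laurent_reindex)
    have k: "int k \<ge> 1" using that by simp
    show "\<exists>N'. \<forall>n<N'. n \<in> UNIV \<longrightarrow> int k * n + int j < N" for N
    \<comment> \<open>For negative \<open>n\<close> one has \<open>k n \<le> n\<close>, which is why
      the bound is cut off at 0.\<close>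
    proof (intro exI[of _ "min 0 (N - int j)"] allI impI)
      fix n :: int assume n: "n < min 0 (N - int j)"
      then have "int k * n \<le> 1 * n" using k by (intro mult_right_mono_neg) auto
      then show "int k * n + int j < N" using n by linarith
    qed
    show "\<exists>N'. \<forall>n<N. n \<in> UNIV \<longrightarrow> int k * n + int j < N'" for N
    proof (intro exI[of _ "int k * N + int j"] allI impI)
      fix n :: int assume "n < N"
      then show "int k * n + int j < int k * N + int j" using k by simp
    qed
  qed
  have ba: "b i \<otimes>\<^bsub>End_algebra R ?L\<^esub> a j = (if i = j then \<one>\<^bsub>End_algebra R ?L\<^esub> else \<zero>\<^bsub>End_algebra R ?L\<^esub>)"
    if ij: "i < k" "j < k" for i j
  proof -
    have "b i (a j f) = (if i = j then f else \<zero>\<^bsub>?L\<^esub>)" if f: "f \<in> carrier ?L" for f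
    proof
      fix n :: int
      have "int m mod int k = int m" "(int k * n + int m) div int k = n" if "m < k" for m
        using that by simp_all
      from this[OF ij(1)] this[OF ij(2)] show "b i (a j f) n = (if i = j then f else \<zero>\<^bsub>?L\<^esub>) n"
        using clmD(1)[OF a[OF ij(2)] f] f by (simp add: b_def) (simp add: a_def)
    qed
    then show ?thesis by (auto simp: compose_def restrict_eq_iff)
  qed
  show "\<exists>a b. \<forall>i<k. \<forall>j<k. a j \<in> carrier (End_algebra R ?L) \<and> b i \<in> carrier (End_algebra R ?L) \<and>
    b i \<otimes>\<^bsub>End_algebra R ?L\<^esub> a j = (if i = j then \<one>\<^bsub>End_algebra R ?L\<^esub> else \<zero>\<^bsub>End_algebra R ?L\<^esub>)"
    using a b ba by (intro exI[of _ a] exI[of _ b]) (simp del: End_algebra_simps(2-5) add: ba)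
qed

end

section \<open>Limits along countable directed sets\<close>

lemma countable_directedD:
  assumes "countable_directed I prec"
  shows "I \<noteq> {}" "i \<in> I \<Longrightarrow> prec i i"
    "\<lbrakk>i \<in> I; j \<in> I; l \<in> I; prec i j; prec j l\<rbrakk> \<Longrightarrow> prec i l"
    "\<lbrakk>i \<in> I; j \<in> I\<rbrakk> \<Longrightarrow> \<exists>l\<in>I. prec i l \<and> prec j l"
  using assms unfolding countable_directed_def by blast+

text \<open>Mittag-Leffler: a cofinal sequence in the index set lets one lift an element step by step.\<close>

lemma directed_limit_surj:
  fixes C :: "nat \<Rightarrow> 'c set"
  assumes dir: "countable_directed I prec" and k: "k \<in> I" and z: "z \<in> C k"
    and id: "\<And>i x. i \<in> I \<Longrightarrow> x \<in> C i \<Longrightarrow> t i i x = x"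
    and surj: "\<And>i j. \<lbrakk>i \<in> I; j \<in> I; prec i j\<rbrakk> \<Longrightarrow> t i j ` C j = C i"
    and comp: "\<And>i j l x. \<lbrakk>i \<in> I; j \<in> I; l \<in> I; prec i j; prec j l; x \<in> C l\<rbrakk> \<Longrightarrow> t i l x = t i j (t j l x)"
  obtains y where "y \<in> (\<Pi>\<^sub>E i\<in>I. C i)" "\<And>i j. \<lbrakk>i \<in> I; j \<in> I; prec i j\<rbrakk> \<Longrightarrow> t i j (y j) = y i" "y k = z"
proof -
  note refl = countable_directedD(2)[OF dir] and trans = countable_directedD(3)[OF dir]
    and dir2 = countable_directedD(4)[OF dir]
  \<comment> \<open>\<open>I\<close> is a non-empty set of naturals, so it can be enumerated,
    possibly with repetitions.\<close>
  define e where "e = from_nat_into I"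
  have e: "e n \<in> I" for n unfolding e_def using k by (intro from_nat_into) auto
  have e_surj: "\<exists>n. e n = i" if "i \<in> I" for i
    unfolding e_def using from_nat_into_surj[of I i] that by auto
  \<comment> \<open>The state is an index with an element over it, starting at
    \<open>(k, z)\<close>. Each step lifts the element to an index that also lies above
    \<open>e n\<close>, so that the indices become cofinal.\<close>
  let ?P = "\<lambda>(n :: nat) (w :: nat \<times> 'c). fst w \<in> I \<and> snd w \<in> C (fst w) \<and> (n = 0 \<longrightarrow> w = (k, z))"
  let ?Q = "\<lambda>(n :: nat) (w :: nat \<times> 'c) w'. prec (fst w) (fst w') \<and> prec (e n) (fst w') \<and> t (fst w) (fst w') (snd w') = snd w"
  have "\<exists>f. \<forall>n. ?P n (f n) \<and> ?Q n (f n) (f (Suc n))"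
  proof (rule dependent_nat_choice)
    show "\<exists>w. ?P 0 w" using k z by auto
    fix w n assume w: "?P n w"
    obtain l where l: "l \<in> I" "prec (fst w) l" "prec (e n) l" using dir2[of "fst w" "e n"] w e by blast
    then have "snd w \<in> t (fst w) l ` C l" using surj[of "fst w" l] w by simp
    then obtain x where "x \<in> C l" "snd w = t (fst w) l x" by blast
    then show "\<exists>w'. ?P (Suc n) w' \<and> ?Q n w w'" using l by (intro exI[of _ "(l, x)"]) simp
  qed
  then obtain f where f: "\<And>n. ?P n (f n)" "\<And>n. ?Q n (f n) (f (Suc n))" by blast
  define s where "s n = fst (f n)" for n
  define x where "x n = snd (f n)" for n
  have s: "s n \<in> I" "x n \<in> C (s n)" "s 0 = k" "x 0 = z" for n using f(1)[of n] f(1)[of 0] by (auto simp: s_def x_def)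
  have step: "prec (s n) (s (Suc n))" "prec (e n) (s (Suc n))" "t (s n) (s (Suc n)) (x (Suc n)) = x n" for n
    using f(2)[of n] by (auto simp: s_def x_def)
  have seq: "prec (s m) (s n) \<and> t (s m) (s n) (x n) = x m" if "m \<le> n" for m n
    using that
  proof (induction n rule: dec_induct)
    case base then show ?case by (simp add: refl s id)
  next
    case (step n)
    then have "t (s m) (s (Suc n)) (x (Suc n)) = x m"
      using comp[of "s m" "s n" "s (Suc n)" "x (Suc n)"] s \<open>\<And>n. prec (s n) (s (Suc n))\<close>
        \<open>\<And>n. t (s n) (s (Suc n)) (x (Suc n)) = x n\<close> by simp
    then show ?case
      using trans[of "s m" "s n" "s (Suc n)"] step s \<open>\<And>n. prec (s n) (s (Suc n))\<close> by simp
  qed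
  have cof: "\<exists>n. prec i (s n)" if "i \<in> I" for i using e_surj[OF that] step(2) by blast
  \<comment> \<open>Any member of the sequence above \<open>i\<close> may be used to compute the
    entry; \<open>indep\<close> shows that the choice does not matter.\<close>
  define y where "y = (\<lambda>i\<in>I. t i (s (SOME n. prec i (s n))) (x (SOME n. prec i (s n))))"
  have indep: "t i (s m) (x m) = t i (s n) (x n)" if "i \<in> I" "prec i (s m)" "prec i (s n)" "m \<le> n" for i m n
    using comp[of i "s m" "s n" "x n"] that s seq[OF that(4)] by simp
  have y: "y i = t i (s n) (x n)" if "i \<in> I" "prec i (s n)" for i n
  proof -
    define m where "m = (SOME n. prec i (s n))"
    have "prec i (s m)" unfolding m_def by (rule someI[of _ n]) (rule that)
    then have "t i (s m) (x m) = t i (s n) (x n)"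
      using indep[of i m n] indep[of i n m, symmetric] that nat_le_linear[of m n] by blast
    then show ?thesis using that by (simp add: y_def m_def)
  qed
  show ?thesis
  proof (rule that)
    show "y \<in> (\<Pi>\<^sub>E i\<in>I. C i)"
    proof (rule PiE_I)
      fix i assume i: "i \<in> I"
      obtain n where "prec i (s n)" using cof[OF i] by blast
      then show "y i \<in> C i" using y[OF i] surj[OF i s(1), of n] s(2)[of n] by auto
    qed (simp add: y_def)
    show "y k = z" using y[OF k, of 0] s id[OF k z] refl[OF k] by simp
    fix i j assume ij: "i \<in> I" "j \<in> I" "prec i j"
    obtain n where n: "prec j (s n)" using cof[OF ij(2)] by blast
    then have "prec i (s n)" using trans[OF ij(1,2) s(1)] ij by blast
    then show "t i j (y j) = y i" using y[OF ij(1)] y[OF ij(2) n] comp[OF ij(1,2) s(1) ij(3) n s(2)] by simp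
  qed
qed


section \<open>Lattices in the module of Laurent series\<close>

context cring
begin

section \<open>The powers of t as lattices\<close>

definition extend_by_zero :: "'i set \<Rightarrow> 'i set \<Rightarrow> ('i \<Rightarrow> 'a) \<Rightarrow> 'i \<Rightarrow> 'a" where
  "extend_by_zero I K = (\<lambda>f\<in>carrier (free_right_module R I). \<lambda>k\<in>K. if k \<in> I then f k else \<zero>)"

definition restrict_to :: "'i set \<Rightarrow> 'i set \<Rightarrow> ('i \<Rightarrow> 'a) \<Rightarrow> 'i \<Rightarrow> 'a" where
  "restrict_to K J = (\<lambda>f\<in>carrier (free_right_module R K). \<lambda>k\<in>J. f k)"

lemma free_in_Pf: "finite I \<Longrightarrow> free_right_module R I \<in> Ob (Pf R)"
  by (simp add: Pf_simps right_module_free finitely_generated_free projective_free)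

lemma extend_by_zero_linear:
  "finite K \<Longrightarrow> extend_by_zero I K \<in> linear_maps R (free_right_module R I) (free_right_module R K)"
  unfolding extend_by_zero_def
  by (rule right_module.restrict_linear[OF right_module_free]) (auto simp: fun_eq_iff)

lemma restrict_to_linear:
  "finite J \<Longrightarrow> J \<subseteq> K \<Longrightarrow> restrict_to K J \<in> linear_maps R (free_right_module R K) (free_right_module R J)"
  unfolding restrict_to_def
  by (rule right_module.restrict_linear[OF right_module_free]) (auto simp: fun_eq_iff)

text \<open>Restriction to \<open>I\<close> and extension from \<open>J\<close> split the sequence.
  It provides both the admissible monics and the admissible epics of the diagrams below.\<close>

lemma free_confl:
  assumes K: "finite K" and IJ: "I \<inter> J = {}" "I \<union> J = K"
  shows "Confl (Pf R) (free_right_module R I) (extend_by_zero I K) (free_right_module R K)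
    (restrict_to K J) (free_right_module R J)"
proof -
  have fin: "finite I" "finite J" "I \<subseteq> K" "J \<subseteq> K" using K IJ by auto
  note lin = extend_by_zero_linear[OF K, of I] restrict_to_linear[OF fin(2,4)]
    restrict_to_linear[OF fin(1,3)] extend_by_zero_linear[OF K, of J]
  note mem = linear_mapsD(1)[OF lin(1)] linear_mapsD(1)[OF lin(2)] linear_mapsD(1)[OF lin(3)] linear_mapsD(1)[OF lin(4)]
  have 1: "restrict_to K I (extend_by_zero I K f) = f" if "f \<in> carrier (free_right_module R I)" for f
    using mem(1)[OF that] that fin(3)
    by (auto simp: restrict_to_def extend_by_zero_def fun_eq_iff PiE_iff extensional_def)
  have 2: "restrict_to K J (extend_by_zero J K f) = f" if "f \<in> carrier (free_right_module R J)" for f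
    using mem(4)[OF that] that fin(4)
    by (auto simp: restrict_to_def extend_by_zero_def fun_eq_iff PiE_iff extensional_def)
  have 3: "extend_by_zero I K (restrict_to K I f) \<oplus>\<^bsub>free_right_module R K\<^esub> extend_by_zero J K (restrict_to K J f) = f"
    if "f \<in> carrier (free_right_module R K)" for f
    using mem(2)[OF that] mem(3)[OF that] that fin(3,4) IJ
    by (auto simp: restrict_to_def extend_by_zero_def fun_eq_iff PiE_iff extensional_def)
  show ?thesis
    unfolding Pf_confl_iff
  proof (intro conjI bexI)
    show "extend_by_zero I K \<in> carrier (Hom (Pf R) (free_right_module R I) (free_right_module R K))"
      "restrict_to K J \<in> carrier (Hom (Pf R) (free_right_module R K) (free_right_module R J))"
      "restrict_to K I \<in> carrier (Hom (Pf R) (free_right_module R K) (free_right_module R I))"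
      "extend_by_zero J K \<in> carrier (Hom (Pf R) (free_right_module R J) (free_right_module R K))"
      using lin by (simp_all add: Pf_simps pointwise_group_def)
  qed (use K fin in \<open>simp_all add: free_in_Pf Pf_simps(2-4) pointwise_group_def compose_def restrict_eq_iff 1 2 3 mem
        del: free_right_module_simps\<close>)
qed

lemma countable_directed_nat: "countable_directed UNIV ((\<le>) :: nat \<Rightarrow> nat \<Rightarrow> bool)"
  by (auto simp: countable_directed_def intro: order_trans) (meson linear order_refl)

text \<open>The colimit of this chain is free of countable rank, like the quotients of R((t)) by
  \<open>t^n R[[t]]\<close>.\<close>

lemma admissible_ind_diagram_free:
  "admissible_ind_diagram (Pf R) UNIV (\<le>) (\<lambda>j. free_right_module R {..<j}) (\<lambda>i j. extend_by_zero {..<i} {..<j})"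
  unfolding admissible_ind_diagram_def
proof (intro conjI ballI impI countable_directed_nat)
  fix i :: nat
  show "free_right_module R {..<i} \<in> Ob (Pf R)" by (simp add: free_in_Pf)
  show "extend_by_zero {..<i} {..<i} = Idn (Pf R) (free_right_module R {..<i})"
    by (auto simp: extend_by_zero_def Pf_simps(4) restrict_eq_iff fun_eq_iff PiE_iff extensional_def)
  fix j :: nat assume "i \<le> j"
  then show "admissible_monic (Pf R) (free_right_module R {..<i}) (free_right_module R {..<j}) (extend_by_zero {..<i} {..<j})"
    using free_confl[of "{..<j}" "{..<i}" "{i..<j}"] unfolding admissible_monic_def by (metis finite_lessThan ivl_disj_int_one(2) ivl_disj_un_one(2))
next
  fix i j l :: nat assume *: "i \<le> j \<and> j \<le> l"
  have "extend_by_zero {..<i} {..<j} f \<in> carrier (free_right_module R {..<j})"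
    if "f \<in> carrier (free_right_module R {..<i})" for f
    by (rule linear_mapsD(1)[OF extend_by_zero_linear that]) simp
  then show "extend_by_zero {..<i} {..<l} = Cmp (Pf R) (free_right_module R {..<i}) (free_right_module R {..<j})
      (free_right_module R {..<l}) (extend_by_zero {..<j} {..<l}) (extend_by_zero {..<i} {..<j})"
    using * by (auto simp: Pf_simps(3) extend_by_zero_def compose_def restrict_eq_iff fun_eq_iff)
qed

text \<open>This is the tower of the modules \<open>R[t]/t^j\<close>, with limit
  \<open>R[[t]]\<close>.\<close>

lemma admissible_pro_diagram_free:
  "admissible_pro_diagram (Pf R) UNIV (\<le>) (\<lambda>j. free_right_module R {..<j}) (\<lambda>i j. restrict_to {..<j} {..<i})"
  unfolding admissible_pro_diagram_def
proof (intro conjI ballI impI countable_directed_nat)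
  fix i :: nat
  show "free_right_module R {..<i} \<in> Ob (Pf R)" by (simp add: free_in_Pf)
  show "restrict_to {..<i} {..<i} = Idn (Pf R) (free_right_module R {..<i})"
    by (auto simp: restrict_to_def Pf_simps(4) restrict_eq_iff fun_eq_iff PiE_iff extensional_def)
  fix j :: nat assume "i \<le> j"
  then show "admissible_epic (Pf R) (free_right_module R {..<j}) (free_right_module R {..<i}) (restrict_to {..<j} {..<i})"
    using free_confl[of "{..<j}" "{i..<j}" "{..<i}"] unfolding admissible_epic_def
    by (metis finite_lessThan ivl_disj_int_one(2) ivl_disj_un_one(2) Int_commute Un_commute)
next
  fix i j l :: nat assume *: "i \<le> j \<and> j \<le> l"
  have "restrict_to {..<l} {..<j} f \<in> carrier (free_right_module R {..<j})"
    if "f \<in> carrier (free_right_module R {..<l})" for f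
    by (rule linear_mapsD(1)[OF restrict_to_linear that]) (use * in auto)
  then show "restrict_to {..<l} {..<i} = Cmp (Pf R) (free_right_module R {..<l}) (free_right_module R {..<j})
      (free_right_module R {..<i}) (restrict_to {..<j} {..<i}) (restrict_to {..<l} {..<j})"
    using * by (auto simp: Pf_simps(3) restrict_to_def compose_def restrict_eq_iff fun_eq_iff)
qed


lemma laurent_truncate:
  "(\<lambda>f\<in>carrier (laurent R). \<lambda>n. if n \<in> D then f n else \<zero>) \<in> continuous_linear_maps R (laurent R) (laurent R)"
  using laurent_reindex[of D "\<lambda>n. n"] by blast

text \<open>This is \<open>t^(n-1) R[t^(-1)]\<close>, the complement of
  \<open>t^n R[[t]]\<close>.\<close>

definition laurent_tail :: "int \<Rightarrow> (int \<Rightarrow> 'a) set" where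
  "laurent_tail n = {f \<in> carrier (laurent R). \<forall>k\<ge>n. f k = \<zero>}"

lemma submodule_laurent_tail: "submodule (laurent_tail n) R (laurent R)"
proof -
  interpret L: right_module R "laurent R" by (rule right_module_laurent)
  show ?thesis
  proof (rule L.submoduleI')
    show "x \<oplus>\<^bsub>laurent R\<^esub> y \<in> laurent_tail n" if "x \<in> laurent_tail n" "y \<in> laurent_tail n" for x y
      using that L.M.a_closed[of x y] by (simp add: laurent_tail_def)
    show "a \<odot>\<^bsub>laurent R\<^esub> x \<in> laurent_tail n" if "a \<in> carrier R" "x \<in> laurent_tail n" for a x
      using that L.closed[of a x] by (simp add: laurent_tail_def)
    show "\<zero>\<^bsub>laurent R\<^esub> \<in> laurent_tail n" using L.M.zero_closed by (simp add: laurent_tail_def)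
  qed (auto simp: laurent_tail_def)
qed

lemma sub_tmodule_simps [simp]:
  "carrier (sub_tmodule X A) = A" "zero (sub_tmodule X A) = zero X" "add (sub_tmodule X A) = add X"
  "smult (sub_tmodule X A) = smult X" "topo (sub_tmodule X A) = subtopology (topo X) A"
  by (simp_all add: sub_tmodule_def)

lemmas topological_laurent_sub = topological_module_sub[OF topological_module_laurent]

text \<open>The open coset \<open>x + t^n R[[t]]\<close> meets the tail in \<open>x\<close> alone,
  since two elements of the tail can differ only at exponents below \<open>n\<close>.\<close>

lemma laurent_tail_discrete:
  "subtopology (topo (laurent R)) (laurent_tail n) = discrete_topology (laurent_tail n)"
proof -
  interpret L: right_module R "laurent R" by (rule right_module_laurent)
  have sub: "laurent_tail n \<subseteq> carrier (laurent R)" by (auto simp: laurent_tail_def)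
  have "openin (subtopology (topo (laurent R)) (laurent_tail n)) {x}" if x: "x \<in> laurent_tail n" for x
  proof -
    let ?U = "(\<lambda>v. x \<oplus>\<^bsub>laurent R\<^esub> v) ` laurent_ball R n"
    have xL: "x \<in> carrier (laurent R)" using x sub by auto
    have U: "openin (topo (laurent R)) ?U" "x \<in> ?U"
      using basis_coset_open[OF right_module_laurent basis_laurent laurent_basis_sub, of "laurent_ball R n" x] xL by auto
    have "y = x" if y: "y \<in> ?U" "y \<in> laurent_tail n" for y
    proof
      fix k
      obtain v where v: "v \<in> laurent_ball R n" "y = x \<oplus>\<^bsub>laurent R\<^esub> v" using y(1) by blast
      show "y k = x k"
        using v x y(2) xL by (cases "k < n") (auto simp: laurent_tail_def laurent_ball_def laurent_carrier)
    qed
    then have "{x} = ?U \<inter> laurent_tail n" using U(2) x by blast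
    then show ?thesis using U(1) unfolding openin_subtopology by blast
  qed
  then show ?thesis
    using sub laurent_topspace by (intro discrete_topology_unique[THEN iffD2, symmetric]) auto
qed

lemma ind_object_laurent_tail: "ind_object R (sub_tmodule (laurent R) (laurent_tail n))"
  unfolding ind_object_def
proof (intro conjI exI)
  let ?C = "sub_tmodule (laurent R) (laurent_tail n)" and ?X = "\<lambda>j. free_right_module R {..<j :: nat}"
  \<comment> \<open>The entry \<open>i\<close> becomes the coefficient of \<open>t^(n-1-i)\<close>:
    counting runs downwards from the top exponent \<open>n - 1\<close>.\<close>
  define v where "v j f = (\<lambda>m. if m < n \<and> nat (n - 1 - m) < j then f (nat (n - 1 - m)) else \<zero>)" for j and f :: "nat \<Rightarrow> 'a"
  let ?u = "\<lambda>j. \<lambda>f\<in>carrier (?X j). v j f"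
  show "topological_module R ?C" by (rule topological_laurent_sub(1)[OF submodule_laurent_tail])
  show "topo ?C = discrete_topology (carrier ?C)" by (simp add: laurent_tail_discrete)
  show "admissible_ind_diagram (Pf R) UNIV (\<le>) ?X (\<lambda>i j. extend_by_zero {..<i} {..<j})"
    by (rule admissible_ind_diagram_free)
  have v: "v j f \<in> laurent_tail n" if "f \<in> carrier (?X j)" for j f
  proof -
    have "\<forall>m<n - int j. v j f m = \<zero>" by (auto simp: v_def)
    then have "\<exists>N. \<forall>m<N. v j f m = \<zero>" by blast
    moreover have "v j f m \<in> carrier R" for m using that by (auto simp: v_def PiE_iff)
    ultimately show ?thesis unfolding laurent_tail_def laurent_carrier by (auto simp: v_def)
  qed
  show "\<forall>j\<in>UNIV. ?u j \<in> linear_maps R (?X j) ?C \<and> inj_on (?u j) (carrier (?X j))"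
  proof (intro ballI conjI)
    fix j
    show "?u j \<in> linear_maps R (?X j) ?C"
      by (rule right_module.restrict_linear[OF right_module_free])
        (use v in \<open>auto simp: v_def fun_eq_iff PiE_iff m_comm\<close>)
    show "inj_on (?u j) (carrier (?X j))"
    proof (rule inj_onI)
      fix f g assume f: "f \<in> carrier (?X j)" and g: "g \<in> carrier (?X j)" and eq: "?u j f = ?u j g"
      show "f = g"
      proof (rule extensionalityI[of _ "{..<j}"])
        fix k assume "k \<in> {..<j}"
        then show "f k = g k" using fun_cong[OF eq, of "n - 1 - int k"] f g by (simp add: v_def)
      qed (use f g in \<open>auto simp: PiE_iff\<close>)
    qed
  qed
  show "\<forall>i\<in>UNIV. \<forall>j\<in>UNIV. i \<le> j \<longrightarrow> ?u i = compose (carrier (?X i)) (?u j) (extend_by_zero {..<i} {..<j})"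
  proof (intro ballI impI)
    fix i j :: nat assume ij: "i \<le> j"
    have "extend_by_zero {..<i} {..<j} f \<in> carrier (?X j)" if "f \<in> carrier (?X i)" for f
      by (rule linear_mapsD(1)[OF extend_by_zero_linear that]) simp
    then show "?u i = compose (carrier (?X i)) (?u j) (extend_by_zero {..<i} {..<j})"
      using ij by (auto simp: compose_def restrict_eq_iff v_def extend_by_zero_def fun_eq_iff)
  qed
  show "(\<Union>j\<in>UNIV. ?u j ` carrier (?X j)) = carrier ?C"
  proof (intro equalityI subsetI)
    fix f assume "f \<in> carrier ?C"
    then have f: "f \<in> laurent_tail n" by simp
    then obtain N where N: "\<forall>m<N. f m = \<zero>" by (auto simp: laurent_tail_def laurent_carrier)
    \<comment> \<open>The exponents that can occur are those from \<open>N\<close> to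
      \<open>n - 1\<close>; if \<open>n \<le> N\<close> there are none, and \<open>nat\<close>
      yields 0.\<close>
    define j where "j = nat (n - N)"
    define g where "g = (\<lambda>k\<in>{..<j}. f (n - 1 - int k))"
    have g: "g \<in> carrier (?X j)" using f by (auto simp: g_def laurent_tail_def laurent_carrier)
    have "f m = v j g m" for m
    proof (cases "m < n \<and> nat (n - 1 - m) < j")
      case True then show ?thesis by (simp add: v_def g_def)
    next
      case False
      then have "n \<le> m \<or> m < N" by (auto simp: j_def)
      then have "f m = \<zero>" using f N by (auto simp: laurent_tail_def)
      then show ?thesis using False by (auto simp: v_def)
    qed
    then have "f = ?u j g" using g by (simp add: fun_eq_iff)
    then show "f \<in> (\<Union>j\<in>UNIV. ?u j ` carrier (?X j))" using g by blast
  qed (use v in auto)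
qed

lemma limit_tmodule_simps [simp]:
  "carrier (limit_tmodule I prec X t) = {x \<in> \<Pi>\<^sub>E i\<in>I. carrier (X i). \<forall>i\<in>I. \<forall>j\<in>I. prec i j \<longrightarrow> t i j (x j) = x i}"
  "add (limit_tmodule I prec X t) = (\<lambda>x y. \<lambda>i\<in>I. x i \<oplus>\<^bsub>X i\<^esub> y i)"
  "smult (limit_tmodule I prec X t) = (\<lambda>a x. \<lambda>i\<in>I. a \<odot>\<^bsub>X i\<^esub> x i)"
  "topo (limit_tmodule I prec X t) = subtopology (product_topology (\<lambda>i. discrete_topology (carrier (X i))) I)
       (carrier (limit_tmodule I prec X t))"
  by (simp_all add: limit_tmodule_def limit_module_def)

text \<open>The \<open>j\<close> coefficients from exponent \<open>n\<close> on identify the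
  quotient of \<open>t^n R[[t]]\<close> by \<open>t^(n+j) R[[t]]\<close> with the free module of
  rank \<open>j\<close>, and these quotients recover \<open>t^n R[[t]]\<close> together with its
  topology.\<close>

lemma pro_object_laurent_ball: "pro_object R (sub_tmodule (laurent R) (laurent_ball R n))"
  unfolding pro_object_def
proof (intro conjI exI)
  let ?V = "laurent_ball R n" and ?X = "\<lambda>j. free_right_module R {..<j :: nat}"
  let ?M = "sub_tmodule (laurent R) ?V"
  let ?Y = "limit_tmodule UNIV (\<le>) ?X (\<lambda>i j. restrict_to {..<j} {..<i})"
  note M = topological_laurent_sub(1)[OF submodule_laurent_ball]
  interpret L: right_module R "laurent R" by (rule right_module_laurent)
  interpret M: right_module R ?M by (rule topological_module_right[OF M])
  show "topological_module R ?M" by (rule M)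
  show "admissible_pro_diagram (Pf R) UNIV (\<le>) ?X (\<lambda>i j. restrict_to {..<j} {..<i})"
    by (rule admissible_pro_diagram_free)
  have VL: "?V \<subseteq> carrier (laurent R)" by (auto simp: laurent_ball_def)
  define c where "c f j = (\<lambda>k\<in>{..<j}. f (n + int k))" for f :: "int \<Rightarrow> 'a" and j :: nat
  have c: "c f j \<in> carrier (?X j)" if "f \<in> carrier (laurent R)" for f j
    using that by (auto simp: c_def laurent_carrier)
  have cY: "c f \<in> carrier ?Y" if "f \<in> carrier (laurent R)" for f
    using c[OF that] that by (simp add: PiE_iff restrict_to_def del: free_right_module_simps)
      (auto simp: c_def fun_eq_iff)
  \<comment> \<open>The entry \<open>m - n\<close> is read in the first module of the tower that has
    it, hence the \<open>Suc\<close>; by \<open>x_eq\<close> all later ones show the same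
    entry.\<close>
  define g where "g x = (\<lambda>m. if m < n then \<zero> else x (Suc (nat (m - n))) (nat (m - n)))" for x :: "nat \<Rightarrow> nat \<Rightarrow> 'a"
  have g: "g x \<in> ?V" if x: "x \<in> carrier ?Y" for x
  proof -
    have "x j \<in> carrier (?X j)" for j using x by auto
    then have "x (Suc j) j \<in> carrier R" for j by (auto simp: PiE_iff)
    then show ?thesis by (auto simp: laurent_ball_def laurent_carrier g_def)
  qed
  have gc: "g (c f) = f" if "f \<in> ?V" for f
    using that by (auto simp: g_def c_def laurent_ball_def fun_eq_iff)
  have x_eq: "x j k = x (Suc k) k" if x: "x \<in> carrier ?Y" and k: "k < j" for x j k
  proof -
    have "restrict_to {..<j} {..<Suc k} (x j) = x (Suc k)" using x k by auto
    moreover have "x j \<in> carrier (?X j)" using x by auto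
    then have "restrict_to {..<j} {..<Suc k} (x j) k = x j k" by (simp add: restrict_to_def)
    ultimately show ?thesis by simp
  qed
  have cg: "c (g x) = x" if x: "x \<in> carrier ?Y" for x
  proof
    fix j
    show "c (g x) j = x j"
    proof (rule extensionalityI[of _ "{..<j}"])
      have "x j \<in> carrier (?X j)" using x by auto
      then show "x j \<in> extensional {..<j}" by (simp add: PiE_iff)
      fix k assume "k \<in> {..<j}"
      then show "c (g x) j k = x j k" using x_eq[OF x, of k j] by (simp add: c_def g_def)
    qed (simp add: c_def)
  qed
  have "topological_isomorphism R ?M ?Y (\<lambda>f\<in>?V. c f)"
    unfolding topological_isomorphism_def
  proof (intro conjI)
    have "(\<lambda>f\<in>carrier ?M. c f) \<in> linear_maps R ?M ?Y"
    proof (rule M.restrict_linear)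
      show "c f \<in> carrier ?Y" if "f \<in> carrier ?M" for f using cY that VL by auto
    qed (use VL in \<open>auto simp: c_def fun_eq_iff laurent_carrier m_comm subset_iff\<close>)
    then show "(\<lambda>f\<in>?V. c f) \<in> linear_maps R ?M ?Y" by simp
    show "bij_betw (\<lambda>f\<in>?V. c f) (carrier ?M) (carrier ?Y)"
      by (rule bij_betw_byWitness[where f' = g]) (use g gc cg cY VL in \<open>auto simp del: limit_tmodule_simps\<close>)
    have comp: "continuous_map (topo ?M) (discrete_topology (carrier (?X j))) (\<lambda>f. c f j)" for j
    proof -
      have D: "right_module R (discrete_tmodule (?X j))" by (rule right_module_discrete[OF right_module_free])
      have "(\<lambda>f\<in>carrier (laurent R). c f j) \<in> continuous_linear_maps R (laurent R) (discrete_tmodule (?X j))"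
      proof (rule laurent_clmI[OF D _ basis_at_zero_discrete[OF D]])
        show "(\<lambda>f\<in>carrier (laurent R). c f j) \<in> linear_maps R (laurent R) (discrete_tmodule (?X j))"
        proof (rule L.restrict_linear)
          show "c f j \<in> carrier (discrete_tmodule (?X j))" if "f \<in> carrier (laurent R)" for f using c[OF that] by simp
        qed (auto simp: c_def fun_eq_iff laurent_carrier m_comm)
        fix W assume "W \<in> {{\<zero>\<^bsub>discrete_tmodule (?X j)\<^esub>}}"
        then show "\<exists>V. \<forall>f\<in>laurent_ball R V. (\<lambda>f\<in>carrier (laurent R). c f j) f \<in> W"
          by (intro exI[of _ "n + int j"]) (auto simp: c_def laurent_ball_def fun_eq_iff)
      qed simp_all
      from continuous_map_from_subtopology[OF clm_continuous[OF this], of ?V]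
      have "continuous_map (topo ?M) (discrete_topology (carrier (?X j))) (\<lambda>f\<in>carrier (laurent R). c f j)"
        by (simp only: sub_tmodule_simps discrete_tmodule_simps)
      then show ?thesis
        by (rule continuous_map_eq) (use VL in \<open>auto simp: laurent_topspace\<close>)
    qed
    have c_cont: "continuous_map (topo ?M) (topo ?Y) (\<lambda>f\<in>?V. c f)"
    proof -
      have "continuous_map (topo ?M) (topo ?Y) c"
        unfolding limit_tmodule_simps(4)[of UNIV] continuous_map_in_subtopology continuous_map_componentwise
        using comp cY VL by (auto simp: laurent_topspace simp del: limit_tmodule_simps free_right_module_simps)
      then show ?thesis by (rule continuous_map_eq) (use VL in \<open>auto simp: laurent_topspace\<close>)
    qed
    have Y_top: "topspace (topo ?Y) = carrier ?Y" by (auto simp: PiE_iff)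
    have "continuous_map (topo ?Y) (topo (laurent R)) g"
      unfolding continuous_map_def
    proof (intro conjI allI impI)
      show "g \<in> topspace (topo ?Y) \<rightarrow> topspace (topo (laurent R))"
        unfolding Y_top laurent_topspace using g VL by blast
      fix U assume U: "openin (topo (laurent R)) U"
      show "openin (topo ?Y) {x \<in> topspace (topo ?Y). g x \<in> U}"
        unfolding Y_top
      proof (subst openin_subopen, intro ballI)
        fix x assume "x \<in> {x \<in> carrier ?Y. g x \<in> U}"
        then have x: "x \<in> carrier ?Y" "g x \<in> U" by auto
        then obtain N where N: "(\<lambda>v. g x \<oplus>\<^bsub>laurent R\<^esub> v) ` laurent_ball R N \<subseteq> U"
          using U unfolding basis_at_zeroD[OF basis_laurent] by blast
        \<comment> \<open>Coefficients below \<open>N\<close> are entries below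
          \<open>N - n\<close>, so fixing the coordinate \<open>?j\<close> of the limit fixes them
          all.\<close>
        let ?j = "nat (N - n)"
        let ?T = "{y \<in> topspace (topo ?Y). y ?j \<in> {x ?j}}"
        have "continuous_map (topo ?Y) (discrete_topology (carrier (?X ?j))) (\<lambda>y. y ?j)"
          unfolding limit_tmodule_simps(4)[of UNIV]
          by (rule continuous_map_from_subtopology, rule continuous_map_product_projection) simp
        moreover have "openin (discrete_topology (carrier (?X ?j))) {x ?j}" using x(1) by auto
        ultimately have T: "openin (topo ?Y) ?T" by (rule openin_continuous_map_preimage)
        have "g y \<in> U" if y: "y \<in> carrier ?Y" "y ?j = x ?j" for y
        proof -
          have gL: "g x \<in> carrier (laurent R)" "g y \<in> carrier (laurent R)" using g[OF x(1)] g[OF y(1)] VL by auto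
          have "g y m = g x m" if m: "m < N" for m
          proof (cases "m < n")
            case False
            then have k: "nat (m - n) < ?j" using m by auto
            show ?thesis using x_eq[OF x(1) k] x_eq[OF y(1) k] y(2) by (simp add: g_def)
          qed (simp add: g_def)
          then have "g y \<oplus>\<^bsub>laurent R\<^esub> \<ominus>\<^bsub>laurent R\<^esub> g x \<in> laurent_ball R N"
            using gL L.M.a_closed[OF gL(2) L.M.a_inv_closed[OF gL(1)]]
            by (simp add: laurent_ball_def laurent_neg) (auto simp: laurent_carrier r_neg)
          moreover have "g x \<oplus>\<^bsub>laurent R\<^esub> (g y \<oplus>\<^bsub>laurent R\<^esub> \<ominus>\<^bsub>laurent R\<^esub> g x) = g y"
            using gL by (subst L.M.a_lcomm) (simp_all add: L.M.r_neg del: laurent_simps)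
          ultimately show ?thesis using N by (metis image_subset_iff)
        qed
        then have "?T \<subseteq> {x \<in> carrier ?Y. g x \<in> U}" unfolding Y_top by blast
        moreover have "x \<in> ?T" unfolding Y_top using x by blast
        ultimately show "\<exists>T. openin (topo ?Y) T \<and> x \<in> T \<and> T \<subseteq> {x \<in> carrier ?Y. g x \<in> U}" using T by blast
      qed
    qed
    then have g_cont: "continuous_map (topo ?Y) (topo ?M) g"
      unfolding sub_tmodule_simps continuous_map_in_subtopology Y_top using g by blast
    have M_top: "topspace (topo ?M) = ?V" using VL by (auto simp: laurent_topspace)
    show "homeomorphic_map (topo ?M) (topo ?Y) (\<lambda>f\<in>?V. c f)"
      unfolding homeomorphic_map_maps homeomorphic_maps_def M_top Y_top
      using c_cont g_cont gc cg g by (intro exI[of _ g]) simp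
  qed
  then show "topologically_isomorphic R ?M ?Y" by (auto simp: topologically_isomorphic_def)
qed

text \<open>Truncation at \<open>n\<close> splits R((t)) into the exponents from \<open>n\<close> on
  and the tail below \<open>n\<close>, and both truncations are continuous.\<close>

lemma tate_lattice_laurent_ball: "tate_lattice R (laurent R) (laurent_ball R n)"
  unfolding tate_lattice_def
proof (intro conjI exI submodule_laurent_ball pro_object_laurent_ball)
  let ?V = "laurent_ball R n" and ?W = "laurent_tail n" and ?L = "laurent R"
  define T where "T D = (\<lambda>f\<in>carrier ?L. \<lambda>n. if n \<in> D then f n else \<zero>)" for D
  have T: "T D \<in> continuous_linear_maps R ?L ?L" for D unfolding T_def by (rule laurent_truncate)
  note V = topological_laurent_sub[OF submodule_laurent_ball[of n]]
  note W = topological_laurent_sub[OF submodule_laurent_tail[of n]]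
  have r: "T {n..} \<in> continuous_linear_maps R ?L (sub_tmodule ?L ?V)"
    by (rule V(3)[OF T laurent_topspace]) (simp add: laurent_ball_def clmD(1)[OF T], simp add: T_def)
  have p: "T {..<n} \<in> continuous_linear_maps R ?L (sub_tmodule ?L ?W)"
    by (rule W(3)[OF T laurent_topspace]) (simp add: laurent_tail_def clmD(1)[OF T], simp add: T_def)
  have *: "T {n..} x = x" if "x \<in> ?V" for x using that by (auto simp: T_def laurent_ball_def fun_eq_iff)
  have **: "T {..<n} x = x" if "x \<in> ?W" for x using that by (auto simp: T_def laurent_tail_def fun_eq_iff)
  have sum: "T {n..} x \<oplus>\<^bsub>?L\<^esub> T {..<n} x = x" if "x \<in> carrier ?L" for x
    using that by (auto simp: T_def fun_eq_iff laurent_carrier)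
  show "split_exact R (sub_tmodule ?L ?V) (\<lambda>x\<in>?V. x) ?L (T {..<n}) (sub_tmodule ?L ?W)"
    unfolding split_exact_iff[OF V(1) topological_module_laurent W(1)]
  proof (intro conjI V(2) p bexI[OF _ r] bexI[OF _ W(2)] ballI)
    fix x assume x: "x \<in> carrier ?L"
    show "(\<lambda>x\<in>?V. x) (T {n..} x) \<oplus>\<^bsub>?L\<^esub> (\<lambda>x\<in>?W. x) (T {..<n} x) = x"
      using clmD(1)[OF r x] clmD(1)[OF p x] sum[OF x] by simp
  qed (simp_all add: * **)
  show "ind_object R (sub_tmodule ?L ?W)" by (rule ind_object_laurent_tail)
qed


section \<open>Comparison of arbitrary lattices with the powers of t\<close>

text \<open>The quotient \<open>C\<close> is discrete, so \<open>p\<close> vanishes on some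
  \<open>t^n R[[t]]\<close>; there the splitting gives \<open>x = r x\<close>, an element of
  \<open>A\<close>.\<close>

lemma tate_lattice_contains_ball:
  assumes "tate_lattice R (laurent R) A"
  shows "\<exists>n. laurent_ball R n \<subseteq> A"
proof -
  obtain C :: "('a, int \<Rightarrow> 'a) tmodule" and p where A: "submodule A R (laurent R)" and se: "split_exact R (sub_tmodule (laurent R) A) (\<lambda>x\<in>A. x) (laurent R) p C"
    and C: "topological_module R C" "topo C = discrete_topology (carrier C)"
    using assms unfolding tate_lattice_def ind_object_def by blast
  note CR = topological_module_right[OF C(1)]
  interpret C: right_module R C by (rule CR)
  obtain r s where p: "p \<in> continuous_linear_maps R (laurent R) C"
    and r: "r \<in> continuous_linear_maps R (laurent R) (sub_tmodule (laurent R) A)" and s: "s \<in> continuous_linear_maps R C (laurent R)"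
    and sum: "\<And>x. x \<in> carrier (laurent R) \<Longrightarrow> (\<lambda>x\<in>A. x) (r x) \<oplus>\<^bsub>laurent R\<^esub> s (p x) = x"
    using se unfolding split_exact_iff[OF topological_laurent_sub(1)[OF A] topological_module_laurent C(1)] by blast
  obtain n where n: "\<forall>x\<in>laurent_ball R n. p x \<in> {\<zero>\<^bsub>C\<^esub>}"
    using laurent_clmD[OF CR p, of "{\<zero>\<^bsub>C\<^esub>}"] C(2) by auto
  have "laurent_ball R n \<subseteq> A"
  proof
    fix x assume x: "x \<in> laurent_ball R n"
    then have xL: "x \<in> carrier (laurent R)" by (simp add: laurent_ball_def)
    interpret L: right_module R "laurent R" by (rule right_module_laurent)
    have rA: "r x \<in> A" using clmD(1)[OF r xL] by simp
    then have "r x \<in> carrier (laurent R)" using subgroup.subset[OF submodule.axioms(1)[OF A]] by auto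
    then have "r x = x"
      using sum[OF xL] n x rA linear_map_zero[OF CR right_module_laurent clm_linear[OF s]] by (simp del: laurent_simps)
    then show "x \<in> A" using rA by simp
  qed
  then show ?thesis by blast
qed

text \<open>
  Surjectivity is where admissibility enters: otherwise the image of the projection would be an
  arbitrary submodule of a finitely generated module.
\<close>

lemma pro_object_projection:
  assumes M: "pro_object R M" and U: "openin (topo M) U" "\<zero>\<^bsub>M\<^esub> \<in> U"
  obtains X :: "('a, nat \<Rightarrow> 'a) module" and \<pi> where "right_module R X" "finitely_generated R X" "\<pi> \<in> linear_maps R M X"
    "\<pi> ` carrier M = carrier X" "\<And>x. x \<in> carrier M \<Longrightarrow> \<pi> x = \<zero>\<^bsub>X\<^esub> \<Longrightarrow> x \<in> U"
proof -
  obtain I prec t \<Phi> and X :: "nat \<Rightarrow> ('a, nat \<Rightarrow> 'a) module" where MT: "topological_module R M"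
    and diag: "admissible_pro_diagram (Pf R) I prec X t"
    and \<Phi>: "topological_isomorphism R M (limit_tmodule I prec X t) \<Phi>"
    using M unfolding pro_object_def topologically_isomorphic_def by blast
  let ?Y = "limit_tmodule I prec X t"
  interpret M: right_module R M by (rule topological_module_right[OF MT])
  have dir: "countable_directed I prec" using diag by (simp add: admissible_pro_diagram_def)
  have X: "right_module R (X i)" "finitely_generated R (X i)" and tid: "t i i = (\<lambda>x\<in>carrier (X i). x)" if "i \<in> I" for i
    using diag that by (auto simp: admissible_pro_diagram_def Pf_simps)
  have t: "t i j \<in> linear_maps R (X j) (X i)" "t i j ` carrier (X j) = carrier (X i)" if "i \<in> I" "j \<in> I" "prec i j" for i j
  proof -
    have "admissible_epic (Pf R) (X j) (X i) (t i j)" using diag that by (simp add: admissible_pro_diagram_def)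
    then obtain A f where "Confl (Pf R) A f (X j) (t i j) (X i)" by (auto simp: admissible_epic_def)
    then show "t i j \<in> linear_maps R (X j) (X i)" "t i j ` carrier (X j) = carrier (X i)" by (simp_all add: Pf_def)
  qed
  have tcomp: "t i l x = t i j (t j l x)"
    if "i \<in> I" "j \<in> I" "l \<in> I" "prec i j" "prec j l" "x \<in> carrier (X l)" for i j l x
  proof -
    have "t i l = compose (carrier (X l)) (t i j) (t j l)"
      using diag that(1-5) by (simp add: admissible_pro_diagram_def Pf_simps(3))
    then show ?thesis using that(6) by (simp add: compose_def)
  qed
  note \<Phi>_lin = linear_mapsD[where f = \<Phi> and E = R and M = M and N = ?Y]
  have \<Phi>': "\<Phi> \<in> linear_maps R M ?Y" "bij_betw \<Phi> (carrier M) (carrier ?Y)" "homeomorphic_map (topo M) (topo ?Y) \<Phi>"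
    using \<Phi> by (auto simp: topological_isomorphism_def)
  have \<pi>: "(\<lambda>x\<in>carrier M. \<Phi> x i) \<in> linear_maps R M (X i)" if i: "i \<in> I" for i
  proof (rule M.restrict_linear)
    show "\<Phi> x i \<in> carrier (X i)" if "x \<in> carrier M" for x using \<Phi>_lin(1)[OF \<Phi>'(1) that] i by auto
  qed (use \<Phi>_lin(2,3)[OF \<Phi>'(1)] i in auto)
  have \<Phi>_zero: "\<Phi> \<zero>\<^bsub>M\<^esub> i = \<zero>\<^bsub>X i\<^esub>" if "i \<in> I" for i
    using linear_map_zero[OF M.right_module_axioms X(1)[OF that] \<pi>[OF that]] by simp
  have "openin (topo ?Y) (\<Phi> ` U)"
    using homeomorphic_imp_open_map[OF \<Phi>'(3)] U(1) by (simp add: open_map_def)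
  then obtain T where T: "openin (product_topology (\<lambda>i. discrete_topology (carrier (X i))) I) T" "\<Phi> ` U = T \<inter> carrier ?Y"
    by (auto simp: openin_subtopology)
  then have "\<Phi> \<zero>\<^bsub>M\<^esub> \<in> T" using U(2) by blast
  \<comment> \<open>A basic neighbourhood of zero in the product, which constrains only finitely
    many coordinates.\<close>
  then obtain W where W: "finite {i \<in> I. W i \<noteq> carrier (X i)}" "\<Phi> \<zero>\<^bsub>M\<^esub> \<in> PiE I W" "PiE I W \<subseteq> T"
    using T(1) unfolding openin_product_topology_alt by (auto dest!: bspec)
  have upper: "\<exists>k\<in>I. \<forall>i\<in>F. prec i k" if "finite F" "F \<subseteq> I" for F
    using that
  proof (induction F rule: finite_induct)
    case empty then show ?case using countable_directedD(1)[OF dir] by auto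
  next
    case (insert i F)
    then obtain k where k: "k \<in> I" "\<forall>i\<in>F. prec i k" by auto
    obtain l where l: "l \<in> I" "prec i l" "prec k l"
      using countable_directedD(4)[OF dir, of i k] k(1) insert.prems by auto
    have "prec j l" if "j \<in> F" for j
      using countable_directedD(3)[OF dir, of j k l] that k l insert.prems by auto
    then show ?case using l by (intro bexI[of _ l]) auto
  qed
  \<comment> \<open>By directedness a single index \<open>k\<close> lies above all constrained ones,
    and where the coordinate \<open>k\<close> vanishes these vanish too.\<close>
  obtain k where k: "k \<in> I" "\<forall>i\<in>{i \<in> I. W i \<noteq> carrier (X i)}. prec i k" using upper[OF W(1)] by auto
  show ?thesis
  proof (rule that[OF X[OF k(1)] \<pi>[OF k(1)]])
    show "(\<lambda>x\<in>carrier M. \<Phi> x k) ` carrier M = carrier (X k)"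
    proof
      show "(\<lambda>x\<in>carrier M. \<Phi> x k) ` carrier M \<subseteq> carrier (X k)" using linear_mapsD(1)[OF \<pi>[OF k(1)]] by blast
      show "carrier (X k) \<subseteq> (\<lambda>x\<in>carrier M. \<Phi> x k) ` carrier M"
      proof
        fix z assume z: "z \<in> carrier (X k)"
        obtain y where y: "y \<in> (\<Pi>\<^sub>E i\<in>I. carrier (X i))" "\<And>i j. \<lbrakk>i \<in> I; j \<in> I; prec i j\<rbrakk> \<Longrightarrow> t i j (y j) = y i" "y k = z"
          by (rule directed_limit_surj[OF dir k(1), of z "\<lambda>i. carrier (X i)" t]) (use z tid t(2) tcomp in auto)
        then have "y \<in> carrier ?Y" by simp
        then have "y \<in> \<Phi> ` carrier M" using bij_betw_imp_surj_on[OF \<Phi>'(2)] by (simp only:)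
        then obtain x where "x \<in> carrier M" "\<Phi> x = y" by (elim imageE) simp
        then show "z \<in> (\<lambda>x\<in>carrier M. \<Phi> x k) ` carrier M" using y(3) by (intro image_eqI[of _ _ x]) auto
      qed
    qed
    fix x assume x: "x \<in> carrier M" and "(\<lambda>x\<in>carrier M. \<Phi> x k) x = \<zero>\<^bsub>X k\<^esub>"
    then have xk: "\<Phi> x k = \<zero>\<^bsub>X k\<^esub>" by simp
    have \<Phi>x: "\<Phi> x \<in> carrier ?Y" by (rule \<Phi>_lin(1)[OF \<Phi>'(1) x])
    have "\<Phi> x i \<in> W i" if i: "i \<in> I" for i
    proof (cases "W i = carrier (X i)")
      case True then show ?thesis using \<Phi>x i by auto
    next
      case False
      then have ik: "prec i k" using k(2) i by blast
      have "\<Phi> x i = t i k (\<Phi> x k)" using \<Phi>x i k(1) ik by auto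
      also have "\<dots> = \<Phi> \<zero>\<^bsub>M\<^esub> i"
        using linear_map_zero[OF X(1)[OF k(1)] X(1)[OF i] t(1)[OF i k(1) ik]] \<Phi>_zero[OF i] xk by simp
      finally show ?thesis using W(2) i by (auto simp: PiE_iff)
    qed
    then have "\<Phi> x \<in> PiE I W" using \<Phi>x by (auto simp: PiE_iff)
    then have "\<Phi> x \<in> \<Phi> ` U" using W(3) T(2) \<Phi>x by blast
    then obtain u where u: "u \<in> U" "\<Phi> x = \<Phi> u" by blast
    then have "u \<in> carrier M" using openin_subset[OF U(1)] topological_module_topspace[OF MT] by auto
    then have "x = u" using inj_onD[OF bij_betw_imp_inj_on[OF \<Phi>'(2)] u(2) x] by simp
    then show "x \<in> U" using u by simp
  qed
qed

text \<open>\<open>A\<close> has a finitely generated quotient \<open>X\<close> with kernel inside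
  \<open>R[[t]]\<close>. The generators of \<open>X\<close> lift to elements of \<open>A\<close> in
  a common \<open>t^n R[[t]]\<close>, so every element of \<open>A\<close> is the sum of an element
  of \<open>t^n R[[t]]\<close> and one of the kernel.\<close>

lemma tate_lattice_in_ball:
  assumes "tate_lattice R (laurent R) A"
  shows "\<exists>n. A \<subseteq> laurent_ball R n"
proof -
  let ?L = "laurent R" and ?M = "sub_tmodule (laurent R) A"
  have A: "submodule A R ?L" and pro: "pro_object R ?M" using assms by (auto simp: tate_lattice_def)
  interpret L: right_module R ?L by (rule right_module_laurent)
  interpret M: right_module R ?M by (rule topological_module_right[OF topological_laurent_sub(1)[OF A]])
  interpret A: submodule A R ?L by (rule A)
  have sub: "A \<subseteq> carrier ?L" using A.subset by auto
  have ball: "openin (topo ?M) (laurent_ball R 0 \<inter> A)" "\<zero>\<^bsub>?M\<^esub> \<in> laurent_ball R 0 \<inter> A"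
    using laurent_ball_open[of 0] A.one_closed sub by (auto simp: openin_subtopology_Int laurent_ball_def)
  obtain X :: "('a, nat \<Rightarrow> 'a) module" and \<pi> where X: "right_module R X" "finitely_generated R X"
    and \<pi>: "\<pi> \<in> linear_maps R ?M X" "\<pi> ` carrier ?M = carrier X"
    and ker: "\<And>x. x \<in> carrier ?M \<Longrightarrow> \<pi> x = \<zero>\<^bsub>X\<^esub> \<Longrightarrow> x \<in> laurent_ball R 0 \<inter> A"
    using pro_object_projection[OF pro ball] by blast
  interpret X: right_module R X by (rule X(1))
  obtain S where S: "S \<subseteq> carrier X" "finite S" "submodule_generated R X S = carrier X"
    using X(2) by (auto simp: finitely_generated_def)
  \<comment> \<open>The condition \<open>n \<le> 0\<close> keeps the kernel, which lies in
    \<open>R[[t]]\<close>, inside \<open>t^n R[[t]]\<close>.\<close>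
  have "\<exists>n\<le>0. \<forall>s\<in>S. \<exists>x\<in>A \<inter> laurent_ball R n. \<pi> x = s" using S(2,1)
  proof (induction S rule: finite_induct)
    case (insert s S)
    then obtain n where n: "n \<le> 0" "\<forall>s\<in>S. \<exists>x\<in>A \<inter> laurent_ball R n. \<pi> x = s" by auto
    have "s \<in> \<pi> ` carrier ?M" using insert.prems \<pi>(2) by simp
    then obtain x where x: "x \<in> A" "\<pi> x = s" by auto
    then obtain m where m: "x \<in> laurent_ball R m" using sub laurent_in_ball[of x R] by auto
    have "\<exists>y\<in>A \<inter> laurent_ball R (min m n). \<pi> y = w" if w: "w \<in> insert s S" for w
    proof (cases "w = s")
      case True
      then show ?thesis using x m laurent_ball_mono[of "min m n" m R] by (intro bexI[of _ x]) auto
    next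
      case False
      then obtain y where "y \<in> A \<inter> laurent_ball R n" "\<pi> y = w" using w n(2) by auto
      then show ?thesis using laurent_ball_mono[of "min m n" n R] by (intro bexI[of _ y]) auto
    qed
    then show ?case using n(1) by (intro exI[of _ "min m n"]) auto
  qed (use order_refl in auto)
  then obtain n where n: "n \<le> 0" "\<And>s. s \<in> S \<Longrightarrow> \<exists>x\<in>A \<inter> laurent_ball R n. \<pi> x = s" by auto
  interpret V: submodule "laurent_ball R n" R ?L by (rule submodule_laurent_ball)
  have H: "submodule (A \<inter> laurent_ball R n) R ?M"
    by (rule M.submoduleI')
      (use A.one_closed V.one_closed A.m_closed V.m_closed A.smult_closed V.smult_closed in \<open>auto simp del: laurent_simps\<close>)
  have "S \<subseteq> \<pi> ` (A \<inter> laurent_ball R n)" using n(2) by blast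
  \<comment> \<open>The image of a submodule is a submodule; containing the generators, it is all of
    \<open>X\<close>.\<close>
  then have "carrier X \<subseteq> \<pi> ` (A \<inter> laurent_ball R n)"
    using X.submodule_generated_in[OF submodule_image[OF M.right_module_axioms X(1) \<pi>(1) H]] S(3) by blast
  have "A \<subseteq> laurent_ball R n"
  proof
    fix x assume x: "x \<in> A"
    then have "\<pi> x \<in> carrier X" using linear_mapsD(1)[OF \<pi>(1)] by simp
    then obtain y where y: "y \<in> A" "y \<in> laurent_ball R n" "\<pi> x = \<pi> y"
      using \<open>carrier X \<subseteq> \<pi> ` (A \<inter> laurent_ball R n)\<close> by auto
    let ?z = "x \<oplus>\<^bsub>?M\<^esub> \<ominus>\<^bsub>?M\<^esub> y"
    have xM: "x \<in> carrier ?M" and yM: "y \<in> carrier ?M" using x y by auto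
    have "\<pi> ?z = \<zero>\<^bsub>X\<^esub>"
      using linear_mapsD(2)[OF \<pi>(1) xM M.M.a_inv_closed[OF yM]] linear_map_neg[OF M.right_module_axioms X(1) \<pi>(1) yM]
        y(3) linear_mapsD(1)[OF \<pi>(1) yM] by (simp add: X.M.r_neg del: sub_tmodule_simps)
    then have "?z \<in> laurent_ball R n"
      using ker[OF M.M.a_closed[OF xM M.M.a_inv_closed[OF yM]]] laurent_ball_mono[OF n(1)] by auto
    then have "?z \<oplus>\<^bsub>?L\<^esub> y \<in> laurent_ball R n" using V.m_closed y(2) by simp
    moreover have "?z \<oplus>\<^bsub>?M\<^esub> y = x" using xM yM by (simp add: M.M.a_assoc M.M.l_neg del: sub_tmodule_simps)
    ultimately show "x \<in> laurent_ball R n" by simp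
  qed
  then show ?thesis by blast
qed

section \<open>The ideals of bounded and discrete endomorphisms\<close>

lemma bounded_endos_laurent:
  "f \<in> bounded_endos R (laurent R) \<longleftrightarrow>
    f \<in> continuous_linear_maps R (laurent R) (laurent R) \<and> (\<exists>n. \<forall>x\<in>carrier (laurent R). f x \<in> laurent_ball R n)"
    (is "_ \<longleftrightarrow> ?rhs")
proof
  assume "f \<in> bounded_endos R (laurent R)"
  then obtain A g where f: "f \<in> continuous_linear_maps R (laurent R) (laurent R)" and A: "tate_lattice R (laurent R) A"
    and g: "g \<in> continuous_linear_maps R (laurent R) (sub_tmodule (laurent R) A)"
    and fg: "f = compose (carrier (laurent R)) (\<lambda>x\<in>A. x) g"
    by (auto simp: bounded_endos_def)
  obtain n where n: "A \<subseteq> laurent_ball R n" using tate_lattice_in_ball[OF A] by blast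
  have "f x \<in> laurent_ball R n" if x: "x \<in> carrier (laurent R)" for x
    using clmD(1)[OF g x] n x by (auto simp: fg compose_def)
  then show ?rhs using f by blast
next
  assume ?rhs
  then obtain n where f: "f \<in> continuous_linear_maps R (laurent R) (laurent R)"
    and n: "\<And>x. x \<in> carrier (laurent R) \<Longrightarrow> f x \<in> laurent_ball R n" by blast
  have "f \<in> continuous_linear_maps R (laurent R) (sub_tmodule (laurent R) (laurent_ball R n))"
    by (rule topological_laurent_sub(3)[OF submodule_laurent_ball f laurent_topspace n])
  moreover have "f = compose (carrier (laurent R)) (\<lambda>x\<in>laurent_ball R n. x) f"
    using clm_extend[OF f] n by (auto simp: compose_def cong: restrict_cong)
  ultimately show "f \<in> bounded_endos R (laurent R)"
    unfolding bounded_endos_def using f tate_lattice_laurent_ball by blast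
qed

lemma discrete_endos_laurent:
  "f \<in> discrete_endos R (laurent R) \<longleftrightarrow>
    f \<in> continuous_linear_maps R (laurent R) (laurent R) \<and> (\<exists>n. \<forall>x\<in>laurent_ball R n. f x = \<zero>\<^bsub>laurent R\<^esub>)"
  unfolding discrete_endos_def using tate_lattice_laurent_ball tate_lattice_contains_ball by blast

text \<open>Continuity bounds \<open>h\<close> on some \<open>t^m R[[t]]\<close>. If
  \<open>n < m\<close>, the finitely many exponents from \<open>n\<close> to \<open>m - 1\<close>
  are added one at a time, and each contributes only multiples of the value of \<open>h\<close> at
  one power of \<open>t\<close>.\<close>

lemma clm_laurent_bounded:
  assumes h: "h \<in> continuous_linear_maps R (laurent R) (laurent R)"
  shows "\<exists>N. \<forall>x\<in>laurent_ball R n. h x \<in> laurent_ball R N"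
proof -
  let ?L = "laurent R"
  interpret L: right_module R ?L by (rule right_module_laurent)
  have V_add: "x \<oplus>\<^bsub>?L\<^esub> y \<in> laurent_ball R N" if "x \<in> laurent_ball R N" "y \<in> laurent_ball R N" for x y N
    using subgroup.m_closed[OF submodule.axioms(1)[OF submodule_laurent_ball]] that by simp
  have V_smult: "a \<odot>\<^bsub>?L\<^esub> x \<in> laurent_ball R N" if "a \<in> carrier R" "x \<in> laurent_ball R N" for a x N
    using submodule.smult_closed[OF submodule_laurent_ball that] .
  obtain m where m: "\<forall>x\<in>laurent_ball R m. h x \<in> laurent_ball R 0"
    using laurent_clmD[OF right_module_laurent h laurent_ball_open[of 0]] L.M.zero_closed by (auto simp: laurent_ball_def)
  have "\<exists>N. \<forall>x\<in>laurent_ball R (m - int d). h x \<in> laurent_ball R N" for d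
  proof (induction d)
    case 0 then show ?case using m by auto
  next
    case (Suc d)
    then obtain N where N: "\<forall>x\<in>laurent_ball R (m - int d). h x \<in> laurent_ball R N" by blast
    let ?l = "m - int (Suc d)"
    \<comment> \<open>The monomial of exponent \<open>?l\<close>: an element of the larger module is
      a multiple of it plus an element \<open>y\<close> of the smaller one.\<close>
    define \<tau> where "\<tau> = (\<lambda>k. if k = ?l then \<one> else \<zero>)"
    have \<tau>: "\<tau> \<in> carrier ?L" by (auto simp: \<tau>_def laurent_carrier intro: exI[of _ ?l])
    then obtain N' where N': "h \<tau> \<in> laurent_ball R N'"
      using laurent_in_ball[OF clmD(1)[OF h \<tau>]] by blast
    let ?N = "min N N'"
    have "h x \<in> laurent_ball R ?N" if x: "x \<in> laurent_ball R ?l" for x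
    proof -
      define y where "y = (\<lambda>k. if k = ?l then \<zero> else x k)"
      have xl: "x ?l \<in> carrier R" "\<And>k. x k \<in> carrier R" using x by (auto simp: laurent_ball_def laurent_carrier)
      have y0: "\<forall>k<m - int d. y k = \<zero>" using x by (auto simp: y_def laurent_ball_def)
      moreover have "\<forall>k. y k \<in> carrier R" using xl(2) by (simp add: y_def)
      ultimately have y: "y \<in> laurent_ball R (m - int d)"
        unfolding laurent_ball_def laurent_carrier by blast
      then have yL: "y \<in> carrier ?L" by (simp add: laurent_ball_def)
      have "x = x ?l \<odot>\<^bsub>?L\<^esub> \<tau> \<oplus>\<^bsub>?L\<^esub> y" using xl by (auto simp: \<tau>_def y_def fun_eq_iff)
      then have "h x = h (x ?l \<odot>\<^bsub>?L\<^esub> \<tau> \<oplus>\<^bsub>?L\<^esub> y)" by (rule arg_cong)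
      also have "\<dots> = x ?l \<odot>\<^bsub>?L\<^esub> h \<tau> \<oplus>\<^bsub>?L\<^esub> h y"
        using clmD(2)[OF h L.closed[OF xl(1) \<tau>] yL] clmD(3)[OF h xl(1) \<tau>] by (simp del: laurent_simps)
      also have "\<dots> \<in> laurent_ball R ?N"
        using N y N' laurent_ball_mono[of ?N N R] laurent_ball_mono[of ?N N' R]
        by (intro V_add V_smult xl(1)) auto
      finally show ?thesis .
    qed
    then show ?case by blast
  qed
  from this[of "nat (m - n)"] obtain N where N: "\<forall>x\<in>laurent_ball R (m - int (nat (m - n))). h x \<in> laurent_ball R N" by blast
  have "laurent_ball R n \<subseteq> laurent_ball R (m - int (nat (m - n)))" by (rule laurent_ball_mono) auto
  then show ?thesis using N by blast
qed

lemma End_neg: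
  assumes X: "topological_module R X" and f: "f \<in> continuous_linear_maps R X X"
  shows "\<ominus>\<^bsub>End_algebra R X\<^esub> f = (\<lambda>x\<in>carrier X. \<ominus>\<^bsub>X\<^esub> f x)"
proof -
  interpret E: ring "End_algebra R X"
    using associative_algebra_End[OF cring_axioms X] by (simp add: associative_algebra_def)
  interpret X: right_module R X by (rule topological_module_right[OF X])
  show ?thesis
    using f clm_neg[OF X X f] by (intro E.minus_equality) (auto simp: restrict_eq_iff clmD X.M.l_neg)
qed

text \<open>For \<open>f\<close> bounded, \<open>h f\<close> is bounded by
  \<open>clm_laurent_bounded\<close> and \<open>f h\<close> trivially. For \<open>f\<close>
  discrete, \<open>h f\<close> is discrete by linearity of \<open>h\<close> and \<open>f h\<close>
  by its continuity at zero.\<close>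

theorem beilinson_End_laurent:
  "beilinson_cubical_algebra R (End_algebra R (laurent R)) (bounded_endos R (laurent R)) (discrete_endos R (laurent R))"
proof -
  let ?L = "laurent R" and ?E = "End_algebra R (laurent R)"
  note LM = topological_module_laurent and LR = right_module_laurent and LT = laurent_topspace
  have assoc: "associative_algebra R ?E" by (rule associative_algebra_End[OF cring_axioms LM])
  then interpret E: ring ?E by (simp add: associative_algebra_def)
  interpret L: right_module R ?L by (rule LR)
  note [simp del] = laurent_simps
  have V: "x \<oplus>\<^bsub>?L\<^esub> y \<in> laurent_ball R n" if "x \<in> laurent_ball R n" "y \<in> laurent_ball R n" for x y n
    using subgroup.m_closed[OF submodule.axioms(1)[OF submodule_laurent_ball]] that by simp
  have V_neg: "\<ominus>\<^bsub>?L\<^esub> x \<in> laurent_ball R n" if "x \<in> laurent_ball R n" for x n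
    using subgroup.m_inv_closed[OF submodule.axioms(1)[OF submodule_laurent_ball] that] by (simp add: a_inv_def)
  have V_zero: "\<zero>\<^bsub>?L\<^esub> \<in> laurent_ball R n" for n
    using subgroup.one_closed[OF submodule.axioms(1)[OF submodule_laurent_ball]] by simp
  have V_sub: "laurent_ball R n \<subseteq> carrier ?L" for n by (auto simp: laurent_ball_def)
  have neg: "inv\<^bsub>add_monoid ?E\<^esub> f = (\<lambda>x\<in>carrier ?L. \<ominus>\<^bsub>?L\<^esub> f x)" if "f \<in> continuous_linear_maps R ?L ?L" for f
    using End_neg[OF LM that] by (simp add: a_inv_def)
  have bI: "f \<in> bounded_endos R ?L"
    if "f \<in> continuous_linear_maps R ?L ?L" "\<And>x. x \<in> carrier ?L \<Longrightarrow> f x \<in> laurent_ball R n" for f n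
    unfolding bounded_endos_laurent using that by blast
  have dI: "f \<in> discrete_endos R ?L"
    if "f \<in> continuous_linear_maps R ?L ?L" "\<And>x. x \<in> laurent_ball R n \<Longrightarrow> f x = \<zero>\<^bsub>?L\<^esub>" for f n
    unfolding discrete_endos_laurent using that by blast
  have V_carrier: "x \<in> carrier ?L" if "x \<in> laurent_ball R n" for x n using V_sub that by blast
  have bounded: "ideal (bounded_endos R ?L) ?E"
  proof (rule idealI[OF E.ring_axioms])
    show "subgroup (bounded_endos R ?L) (add_monoid ?E)"
    proof
      show "bounded_endos R ?L \<subseteq> carrier (add_monoid ?E)" by (auto simp: bounded_endos_laurent)
      have "(\<lambda>x\<in>carrier ?L. \<zero>\<^bsub>?L\<^esub>) \<in> bounded_endos R ?L"
        by (rule bI[OF clm_zero[OF LM LM], of 0]) (simp add: V_zero)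
      then show "\<one>\<^bsub>add_monoid ?E\<^esub> \<in> bounded_endos R ?L" by simp
      fix f assume "f \<in> bounded_endos R ?L"
      then obtain m where f: "f \<in> continuous_linear_maps R ?L ?L" and m: "\<And>x. x \<in> carrier ?L \<Longrightarrow> f x \<in> laurent_ball R m"
        unfolding bounded_endos_laurent by blast
      have "(\<lambda>x\<in>carrier ?L. \<ominus>\<^bsub>?L\<^esub> f x) \<in> bounded_endos R ?L"
        by (rule bI[OF clm_neg[OF LM LM f], of m]) (simp add: V_neg m)
      then show "inv\<^bsub>add_monoid ?E\<^esub> f \<in> bounded_endos R ?L" by (simp only: neg[OF f])
      fix g assume "g \<in> bounded_endos R ?L"
      then obtain n where g: "g \<in> continuous_linear_maps R ?L ?L" and n: "\<And>x. x \<in> carrier ?L \<Longrightarrow> g x \<in> laurent_ball R n"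
        unfolding bounded_endos_laurent by blast
      have "f x \<oplus>\<^bsub>?L\<^esub> g x \<in> laurent_ball R (min m n)" if "x \<in> carrier ?L" for x
        using m[OF that] n[OF that] laurent_ball_mono[of "min m n" m R] laurent_ball_mono[of "min m n" n R]
        by (intro V) auto
      then have "(\<lambda>x\<in>carrier ?L. f x \<oplus>\<^bsub>?L\<^esub> g x) \<in> bounded_endos R ?L"
        by (intro bI[OF clm_add[OF LM LM f g], of "min m n"]) simp
      then show "f \<otimes>\<^bsub>add_monoid ?E\<^esub> g \<in> bounded_endos R ?L" by simp
    qed
    fix f h assume "f \<in> bounded_endos R ?L" and "h \<in> carrier ?E"
    then obtain n where f: "f \<in> continuous_linear_maps R ?L ?L" and n: "\<And>x. x \<in> carrier ?L \<Longrightarrow> f x \<in> laurent_ball R n"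
      and h: "h \<in> continuous_linear_maps R ?L ?L"
      unfolding bounded_endos_laurent End_algebra_simps by blast
    obtain N where N: "\<forall>x\<in>laurent_ball R n. h x \<in> laurent_ball R N" using clm_laurent_bounded[OF h] by blast
    have "compose (carrier ?L) h f \<in> bounded_endos R ?L"
      by (rule bI[OF clm_compose[OF LR LT f h], of N]) (simp add: compose_def n N)
    then show "h \<otimes>\<^bsub>?E\<^esub> f \<in> bounded_endos R ?L" by simp
    have "compose (carrier ?L) f h \<in> bounded_endos R ?L"
      by (rule bI[OF clm_compose[OF LR LT h f], of n]) (simp add: compose_def n clmD(1)[OF h])
    then show "f \<otimes>\<^bsub>?E\<^esub> h \<in> bounded_endos R ?L" by simp
  qed
  have discrete: "ideal (discrete_endos R ?L) ?E"
  proof (rule idealI[OF E.ring_axioms])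
    show "subgroup (discrete_endos R ?L) (add_monoid ?E)"
    proof
      show "discrete_endos R ?L \<subseteq> carrier (add_monoid ?E)" by (auto simp: discrete_endos_laurent)
      have "(\<lambda>x\<in>carrier ?L. \<zero>\<^bsub>?L\<^esub>) \<in> discrete_endos R ?L"
        by (rule dI[OF clm_zero[OF LM LM], of 0]) (simp add: V_carrier)
      then show "\<one>\<^bsub>add_monoid ?E\<^esub> \<in> discrete_endos R ?L" by simp
      fix f assume "f \<in> discrete_endos R ?L"
      then obtain m where f: "f \<in> continuous_linear_maps R ?L ?L" and m: "\<And>x. x \<in> laurent_ball R m \<Longrightarrow> f x = \<zero>\<^bsub>?L\<^esub>"
        unfolding discrete_endos_laurent by blast
      have "(\<lambda>x\<in>carrier ?L. \<ominus>\<^bsub>?L\<^esub> f x) \<in> discrete_endos R ?L"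
        by (rule dI[OF clm_neg[OF LM LM f], of m]) (simp add: V_carrier m)
      then show "inv\<^bsub>add_monoid ?E\<^esub> f \<in> discrete_endos R ?L" by (simp only: neg[OF f])
      fix g assume "g \<in> discrete_endos R ?L"
      then obtain n where g: "g \<in> continuous_linear_maps R ?L ?L" and n: "\<And>x. x \<in> laurent_ball R n \<Longrightarrow> g x = \<zero>\<^bsub>?L\<^esub>"
        unfolding discrete_endos_laurent by blast
      have "x \<in> laurent_ball R m" "x \<in> laurent_ball R n" if "x \<in> laurent_ball R (max m n)" for x
        using that laurent_ball_mono[of m "max m n" R] laurent_ball_mono[of n "max m n" R] by auto
      then have "(\<lambda>x\<in>carrier ?L. f x \<oplus>\<^bsub>?L\<^esub> g x) \<in> discrete_endos R ?L"
        by (intro dI[OF clm_add[OF LM LM f g], of "max m n"]) (simp add: V_carrier m n)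
      then show "f \<otimes>\<^bsub>add_monoid ?E\<^esub> g \<in> discrete_endos R ?L" by simp
    qed
    fix f h assume "f \<in> discrete_endos R ?L" and "h \<in> carrier ?E"
    then obtain n where f: "f \<in> continuous_linear_maps R ?L ?L" and n: "\<And>x. x \<in> laurent_ball R n \<Longrightarrow> f x = \<zero>\<^bsub>?L\<^esub>"
      and h: "h \<in> continuous_linear_maps R ?L ?L"
      unfolding discrete_endos_laurent End_algebra_simps by blast
    obtain N where N: "\<forall>x\<in>laurent_ball R N. h x \<in> laurent_ball R n"
      using laurent_clmD[OF LR h laurent_ball_open[of n] V_zero] by blast
    have "compose (carrier ?L) h f \<in> discrete_endos R ?L"
      by (rule dI[OF clm_compose[OF LR LT f h], of n])
        (simp add: compose_def V_carrier n linear_map_zero[OF LR LR clm_linear[OF h]])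
    then show "h \<otimes>\<^bsub>?E\<^esub> f \<in> discrete_endos R ?L" by simp
    have "compose (carrier ?L) f h \<in> discrete_endos R ?L"
      by (rule dI[OF clm_compose[OF LR LT h f], of N]) (simp add: compose_def V_carrier n N)
    then show "f \<otimes>\<^bsub>?E\<^esub> h \<in> discrete_endos R ?L" by simp
  qed
  have "bounded_endos R ?L <+>\<^bsub>?E\<^esub> discrete_endos R ?L = carrier ?E"
  proof (intro equalityI subsetI)
    fix f assume "f \<in> bounded_endos R ?L <+>\<^bsub>?E\<^esub> discrete_endos R ?L"
    then obtain g h where "g \<in> bounded_endos R ?L" "h \<in> discrete_endos R ?L" "f = g \<oplus>\<^bsub>?E\<^esub> h"
      unfolding set_add_def' by blast
    then show "f \<in> carrier ?E"
      using clm_add[OF LM LM, of g h] by (simp add: bounded_endos_laurent discrete_endos_laurent)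
  next
    fix f assume "f \<in> carrier ?E"
    then have f: "f \<in> continuous_linear_maps R ?L ?L" by simp
    define T where "T D = (\<lambda>f\<in>carrier ?L. \<lambda>n. if n \<in> D then f n else \<zero>)" for D :: "int set"
    have T: "T D \<in> continuous_linear_maps R ?L ?L" for D unfolding T_def by (rule laurent_truncate)
    have Tf: "compose (carrier ?L) (T D) f \<in> continuous_linear_maps R ?L ?L" for D
      by (rule clm_compose[OF LR LT f T])
    have "T {0..} x \<in> laurent_ball R 0" if "x \<in> carrier ?L" for x
      using clmD(1)[OF T that] that by (simp add: laurent_ball_def) (simp add: T_def)
    then have g: "compose (carrier ?L) (T {0..}) f \<in> bounded_endos R ?L"
      by (intro bI[OF Tf[of "{0..}"], of 0]) (simp add: compose_def clmD(1)[OF f])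
    \<comment> \<open>By continuity \<open>f\<close> maps some \<open>t^N R[[t]]\<close> into
      \<open>R[[t]]\<close>, which the truncation to negative exponents kills.\<close>
    obtain N where N: "\<forall>x\<in>laurent_ball R N. f x \<in> laurent_ball R 0"
      using laurent_clmD[OF LR f laurent_ball_open[of 0] V_zero] by blast
    have "T {..<0} x = \<zero>\<^bsub>?L\<^esub>" if "x \<in> laurent_ball R 0" for x
      using that by (auto simp: T_def laurent_ball_def laurent_simps)
    then have h: "compose (carrier ?L) (T {..<0}) f \<in> discrete_endos R ?L"
      using N by (intro dI[OF Tf[of "{..<0}"], of N]) (simp add: compose_def V_carrier)
    have "T {0..} x \<oplus>\<^bsub>?L\<^esub> T {..<0} x = x" if "x \<in> carrier ?L" for x
      using that by (auto simp: T_def fun_eq_iff laurent_carrier laurent_simps)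
    then have "compose (carrier ?L) (T {0..}) f \<oplus>\<^bsub>?E\<^esub> compose (carrier ?L) (T {..<0}) f = (\<lambda>x\<in>carrier ?L. f x)"
      using clmD(1)[OF f] by (auto simp: compose_def restrict_eq_iff)
    then have "f = compose (carrier ?L) (T {0..}) f \<oplus>\<^bsub>?E\<^esub> compose (carrier ?L) (T {..<0}) f"
      using clm_extend[OF f] by simp
    then show "f \<in> bounded_endos R ?L <+>\<^bsub>?E\<^esub> discrete_endos R ?L"
      unfolding set_add_def' using g h by blast
  qed
  then show ?thesis
    using assoc bounded discrete by (simp add: beilinson_cubical_algebra_def)
qed

end

text \<open>The two embeddings let copies of the summands of R((t)) and of \<open>E\<close> have
  their carriers in \<open>'m\<close> and \<open>'n\<close>, so that every idempotent of
  \<open>E\<close> is realised on both sides.\<close>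

theorem theorem2:
  fixes R :: "('a, 'x) ring_scheme"
  assumes "cring R"
    and large_m: "\<exists>\<iota> :: (int \<Rightarrow> 'a) \<Rightarrow> 'm. inj_on \<iota> (carrier (laurent R))"
    and large_n: "\<exists>\<iota> :: ((int \<Rightarrow> 'a) \<Rightarrow> (int \<Rightarrow> 'a)) \<Rightarrow> 'n.
                    inj_on \<iota> (carrier (End_algebra R (laurent R)))"
  shows "countable_tate_module R (laurent R)
    \<and> beilinson_cubical_algebra R (End_algebra R (laurent R))
        (bounded_endos R (laurent R)) (discrete_endos R (laurent R))
    \<and> (\<exists>Fo Fm. exact_equivalence
        (Tate_Dr R :: (('a, 'm) tmodule, 'm \<Rightarrow> 'm) exact_cat)
        (Pf (End_algebra R (laurent R)) ::
          (((int \<Rightarrow> 'a) \<Rightarrow> (int \<Rightarrow> 'a), 'n) module, 'n \<Rightarrow> 'n) exact_cat)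
        Fo Fm)"
proof (intro conjI)
  interpret cring R by fact
  show "countable_tate_module R (laurent R)" by (rule countable_tate_laurent)
  show "beilinson_cubical_algebra R (End_algebra R (laurent R))
        (bounded_endos R (laurent R)) (discrete_endos R (laurent R))" by (rule beilinson_End_laurent)
  obtain \<iota> :: "(int \<Rightarrow> 'a) \<Rightarrow> 'm" where \<iota>: "inj_on \<iota> (carrier (laurent R))" using large_m by blast
  have "\<exists>e \<theta>. idempotent_presentation (Tate_Dr R :: (('a, 'm) tmodule, 'm \<Rightarrow> 'm) exact_cat) (End_algebra R (laurent R)) e \<theta>"
  proof (rule Tate_presentation[OF cring_axioms topological_module_laurent])
    show "\<exists>i\<in>continuous_linear_maps R M (laurent R). \<exists>p\<in>continuous_linear_maps R (laurent R) M. \<forall>x\<in>carrier M. p (i x) = x"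
      if "M \<in> Ob (Tate_Dr R)" for M :: "('a, 'm) tmodule"
      using Tate_retract_of_laurent that by (simp add: Tate_simps)
  qed (use laurent_idempotent_splits[OF \<iota>] in \<open>auto simp: Tate_simps Bex_def\<close>)
  moreover have "\<exists>e \<theta>. idempotent_presentation (Pf (End_algebra R (laurent R)) ::
          (((int \<Rightarrow> 'a) \<Rightarrow> (int \<Rightarrow> 'a), 'n) module, 'n \<Rightarrow> 'n) exact_cat) (End_algebra R (laurent R)) e \<theta>"
    by (rule self_absorbing_ring.Pf_presentation[OF End_laurent_self_absorbing large_n])
  ultimately show "\<exists>Fo Fm. exact_equivalence
        (Tate_Dr R :: (('a, 'm) tmodule, 'm \<Rightarrow> 'm) exact_cat)
        (Pf (End_algebra R (laurent R)) ::
          (((int \<Rightarrow> 'a) \<Rightarrow> (int \<Rightarrow> 'a), 'n) module, 'n \<Rightarrow> 'n) exact_cat)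
        Fo Fm"
    using exact_equivalence_presentations by blast
qed

end
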